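(* Let $F$ be an algebraically closed field of characteristic $p>0$, let $G$ be a finite group, and let $B$ be a block of $FG$ with defect group $D\neq 1$. Let $(u_1,b_1),\ldots,(u_k,b_k)$ be a set of representatives for the ($G$-)conjugacy classes of non-trivial $B$-subsections. Then the map $$ZB/RB\to\bigoplus_{i=1}^k Zb_i/Rb_i,\qquad z+RB\mapsto\sum_{i=1}^k \bigl(\mathrm{Br}_{\langle u_i\rangle}(z)1_{b_i}+Rb_i\bigr)$$ is an embedding of $F$-algebras (that is, a well-defined injective homomorphism of $F$-algebras). In particular, $$LL(ZB/RB)\le\max\{LL(Zb_i/Rb_i):i=1,\ldots,k\}.$$
   Context: For a block $A$ of a finite group algebra over $F$ (viewed as an algebra), $1_A$ is its block idempotent, $ZA$ its center, $SA$ its socle, and $RA:=ZA\cap SA$ its Reynolds ideal. A $B$-subsection is a pair $(u,b)$ where $u\in G$ is a $p$-element and $b$ is a Brauer correspondent of $B$ in $\mathrm{C}_G(u)$, i.e. a block of $F\mathrm{C}_G(u)$ with $b^G=B$ (Brauer induction); it is non-trivial if $u\ne1$. $G$ acts on $B$-subsections by conjugation. For a $p$-element $u$, $\mathrm{Br}_{\langle u\rangle}:ZFG\to ZF\mathrm{C}_G(u)$ is the Brauer homomorphism $\sum_{g\in G}\alpha_g g\mapsto\sum_{g\in \mathrm{C}_G(u)}\alpha_g g$. For a finite-dimensional $F$-algebra $A$ with Jacobson radical $JA$, $LL(A)$ is the smallest positive integer $l$ such that $(JA)^l=0$. *)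

theory Defs
  imports "HOL-Algebra.QuotRing" "HOL-Algebra.Module" "HOL-Algebra.Ideal_Product"
    "HOL-Algebra.Generated_Groups" "HOL-Algebra.Multiplicative_Group"
    "HOL-Computational_Algebra.Polynomial"
begin

section \<open>Rings and algebras over a field\<close>

text \<open>
  The ground field is a type \<open>'k\<close>; an algebra over it is a record of type
  \<open>('k, 'a) module\<close>.  Algebras need not be commutative.
\<close>

definition alg_hom :: "('k::field, 'a, 'm) module_scheme \<Rightarrow> ('k, 'b, 'n) module_scheme \<Rightarrow> ('a \<Rightarrow> 'b) set"
  where "alg_hom A B =
    {f \<in> ring_hom A B. \<forall>c. \<forall>x \<in> carrier A. f (c \<odot>\<^bsub>A\<^esub> x) = c \<odot>\<^bsub>B\<^esub> f x}"

definition base_algebra :: "('k::field, 'k) module"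
  where "base_algebra =
    \<lparr>carrier = UNIV, monoid.mult = (*), monoid.one = 1,
     ring.zero = 0, ring.add = (+), module.smult = (*)\<rparr>"

text \<open>The analogue for scalars of \<^const>\<open>rcoset_mult\<close>; \<^const>\<open>FactRing\<close> itself forgets scalars.\<close>

definition quot_algebra :: "('k::field, 'a) module \<Rightarrow> 'a set \<Rightarrow> ('k, 'a set) module"
  where "quot_algebra A I =
    \<lparr>carrier = carrier (A Quot I), monoid.mult = monoid.mult (A Quot I),
     monoid.one = monoid.one (A Quot I), ring.zero = ring.zero (A Quot I),
     ring.add = ring.add (A Quot I),
     module.smult = (\<lambda>c S. \<Union>x\<in>S. I +>\<^bsub>A\<^esub> (c \<odot>\<^bsub>A\<^esub> x))\<rparr>"

text \<open>Only used for finite index sets, where the direct sum is the full product.\<close>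

definition direct_sum_algebra :: "'i set \<Rightarrow> ('i \<Rightarrow> ('k::field, 'a) module) \<Rightarrow> ('k, 'i \<Rightarrow> 'a) module"
  where "direct_sum_algebra I A =
    \<lparr>carrier = (\<Pi>\<^sub>E i\<in>I. carrier (A i)),
     monoid.mult = (\<lambda>x y. \<lambda>i\<in>I. x i \<otimes>\<^bsub>A i\<^esub> y i), monoid.one = (\<lambda>i\<in>I. \<one>\<^bsub>A i\<^esub>),
     ring.zero = (\<lambda>i\<in>I. \<zero>\<^bsub>A i\<^esub>), ring.add = (\<lambda>x y. \<lambda>i\<in>I. x i \<oplus>\<^bsub>A i\<^esub> y i),
     module.smult = (\<lambda>c x. \<lambda>i\<in>I. c \<odot>\<^bsub>A i\<^esub> x i)\<rparr>"

definition center :: "('a, 'm) monoid_scheme \<Rightarrow> 'a set"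
  where "center A = {z \<in> carrier A. \<forall>x \<in> carrier A. z \<otimes>\<^bsub>A\<^esub> x = x \<otimes>\<^bsub>A\<^esub> z}"

abbreviation center_algebra :: "('k::field, 'a) module \<Rightarrow> ('k, 'a) module"
  where "center_algebra A \<equiv> A\<lparr>carrier := center A\<rparr>"

definition left_ideal :: "'a set \<Rightarrow> ('a, 'm) ring_scheme \<Rightarrow> bool"
  where "left_ideal L A \<longleftrightarrow>
    additive_subgroup L A \<and> (\<forall>x \<in> carrier A. \<forall>a \<in> L. x \<otimes>\<^bsub>A\<^esub> a \<in> L)"

definition maximal_left_ideal :: "'a set \<Rightarrow> ('a, 'm) ring_scheme \<Rightarrow> bool"
  where "maximal_left_ideal M A \<longleftrightarrow>
    left_ideal M A \<and> M \<noteq> carrier A \<and>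
    (\<forall>L. left_ideal L A \<and> M \<subseteq> L \<longrightarrow> L = M \<or> L = carrier A)"

definition minimal_left_ideal :: "'a set \<Rightarrow> ('a, 'm) ring_scheme \<Rightarrow> bool"
  where "minimal_left_ideal M A \<longleftrightarrow>
    left_ideal M A \<and> M \<noteq> {\<zero>\<^bsub>A\<^esub>} \<and>
    (\<forall>L. left_ideal L A \<and> L \<subseteq> M \<longrightarrow> L = {\<zero>\<^bsub>A\<^esub>} \<or> L = M)"

definition jacobson_radical :: "('a, 'm) ring_scheme \<Rightarrow> 'a set"
  where "jacobson_radical A = carrier A \<inter> \<Inter>{M. maximal_left_ideal M A}"

text \<open>The socle of the left regular module, i.e. the sum of all minimal left ideals.\<close>

definition socle :: "('a, 'm) ring_scheme \<Rightarrow> 'a set"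
  where "socle A = generate (add_monoid A) (\<Union>{M. minimal_left_ideal M A})"

definition reynolds :: "('a, 'm) ring_scheme \<Rightarrow> 'a set"
  where "reynolds A = center A \<inter> socle A"

primrec ideal_power :: "('a, 'm) ring_scheme \<Rightarrow> 'a set \<Rightarrow> nat \<Rightarrow> 'a set"
  where
    "ideal_power A I 0 = carrier A"
  | "ideal_power A I (Suc n) = ideal_prod A I (ideal_power A I n)"

definition loewy_length :: "('a, 'm) ring_scheme \<Rightarrow> nat"
  where "loewy_length A = (LEAST l. l > 0 \<and> ideal_power A (jacobson_radical A) l = {\<zero>\<^bsub>A\<^esub>})"

definition center_mod_reynolds :: "('k::field, 'a) module \<Rightarrow> ('k, 'a set) module"
  where "center_mod_reynolds A = quot_algebra (center_algebra A) (reynolds A)"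

text \<open>A block is an indecomposable two-sided ideal that is a direct summand.\<close>

definition is_block :: "('k::field, 'a) module \<Rightarrow> 'a set \<Rightarrow> bool"
  where "is_block A B \<longleftrightarrow>
    ideal B A \<and> B \<noteq> {\<zero>\<^bsub>A\<^esub>} \<and>
    (\<exists>C. ideal C A \<and> B \<inter> C = {\<zero>\<^bsub>A\<^esub>} \<and> B <+>\<^bsub>A\<^esub> C = carrier A) \<and>
    (\<forall>I J. ideal I A \<and> ideal J A \<and> I \<inter> J = {\<zero>\<^bsub>A\<^esub>} \<and> I <+>\<^bsub>A\<^esub> J = B \<longrightarrow>
       I = {\<zero>\<^bsub>A\<^esub>} \<or> J = {\<zero>\<^bsub>A\<^esub>})"

definition block_idem :: "('k::field, 'a) module \<Rightarrow> 'a set \<Rightarrow> 'a"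
  where "block_idem A B = (THE e. e \<in> B \<and> (\<forall>x \<in> B. e \<otimes>\<^bsub>A\<^esub> x = x \<and> x \<otimes>\<^bsub>A\<^esub> e = x))"

definition block_algebra :: "('k::field, 'a) module \<Rightarrow> 'a set \<Rightarrow> ('k, 'a) module"
  where "block_algebra A B = A\<lparr>carrier := B, one := block_idem A B\<rparr>"

text \<open>
  Over an algebraically closed field and in finite dimension, every block \<open>B\<close> has exactly one
  central character, up to values outside of the center.
\<close>

definition central_character :: "('k::field, 'a) module \<Rightarrow> 'a set \<Rightarrow> ('a \<Rightarrow> 'k) \<Rightarrow> bool"
  where "central_character A B \<omega> \<longleftrightarrow>
    \<omega> \<in> alg_hom (center_algebra A) base_algebra \<and> \<omega> (block_idem A B) = 1"


section \<open>Group algebras\<close>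

text \<open>
  For a finite group \<open>G\<close>, the elements of the group algebra are the functions vanishing outside
  of \<open>G\<close>, so that the group algebra of a subgroup \<open>H\<close> is literally contained in that of \<open>G\<close>.
\<close>

definition group_algebra :: "('g, 'm) monoid_scheme \<Rightarrow> ('k::field, 'g \<Rightarrow> 'k) module"
  where "group_algebra G =
    \<lparr>carrier = {a. \<forall>g. g \<notin> carrier G \<longrightarrow> a g = 0},
     monoid.mult = (\<lambda>a b g. \<Sum>(x, y) \<in> {(x, y) \<in> carrier G \<times> carrier G. x \<otimes>\<^bsub>G\<^esub> y = g}. a x * b y),
     monoid.one = (\<lambda>g. if g = \<one>\<^bsub>G\<^esub> then 1 else 0),
     ring.zero = (\<lambda>g. 0),
     ring.add = (\<lambda>a b g. a g + b g),
     module.smult = (\<lambda>c a g. c * a g)\<rparr>"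

abbreviation subgroup_algebra :: "('g, 'm) monoid_scheme \<Rightarrow> 'g set \<Rightarrow> ('k::field, 'g \<Rightarrow> 'k) module"
  where "subgroup_algebra G H \<equiv> group_algebra (G\<lparr>carrier := H\<rparr>)"

definition centralizer :: "('g, 'm) monoid_scheme \<Rightarrow> 'g \<Rightarrow> 'g set"
  where "centralizer G u = {g \<in> carrier G. g \<otimes>\<^bsub>G\<^esub> u = u \<otimes>\<^bsub>G\<^esub> g}"

text \<open>\<open>conj_elem G g a\<close> is the element \<open>g a g\<inverse>\<close> of the group algebra.\<close>

definition conj_elem :: "('g, 'm) monoid_scheme \<Rightarrow> 'g \<Rightarrow> ('g \<Rightarrow> 'k::field) \<Rightarrow> 'g \<Rightarrow> 'k"
  where "conj_elem G g a =
    (\<lambda>h. if h \<in> carrier G then a (inv\<^bsub>G\<^esub> g \<otimes>\<^bsub>G\<^esub> h \<otimes>\<^bsub>G\<^esub> g) else 0)"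

definition restrict_to :: "'g set \<Rightarrow> ('g \<Rightarrow> 'k::field) \<Rightarrow> 'g \<Rightarrow> 'k"
  where "restrict_to H a = (\<lambda>h. if h \<in> H then a h else 0)"

definition brauer_hom :: "('g, 'm) monoid_scheme \<Rightarrow> 'g \<Rightarrow> ('g \<Rightarrow> 'k::field) \<Rightarrow> 'g \<Rightarrow> 'k"
  where "brauer_hom G u = restrict_to (centralizer G u)"


section \<open>Defect groups\<close>

definition fixed_elems :: "('g, 'm) monoid_scheme \<Rightarrow> 'g set \<Rightarrow> ('g \<Rightarrow> 'k::field) set"
  where "fixed_elems G D = {a \<in> carrier (group_algebra G). \<forall>d \<in> D. conj_elem G d a = a}"

text \<open>
  The relative trace \<open>\<Sum> t\<inverse> a t\<close> over representatives \<open>t\<close> of the right cosets of \<open>D\<close>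
  (so \<open>t\<inverse>\<close> runs over representatives of the left cosets); for \<open>D\<close>-fixed \<open>a\<close> the choice of
  representatives is immaterial.
\<close>

definition rel_trace :: "('g, 'm) monoid_scheme \<Rightarrow> 'g set \<Rightarrow> ('g \<Rightarrow> 'k::field) \<Rightarrow> 'g \<Rightarrow> 'k"
  where "rel_trace G D a =
    (\<lambda>h. \<Sum>C \<in> rcosets\<^bsub>G\<^esub> D. conj_elem G (inv\<^bsub>G\<^esub> (SOME t. t \<in> C)) a h)"

definition trace_covers :: "('g, 'm) monoid_scheme \<Rightarrow> ('g \<Rightarrow> 'k::field) set \<Rightarrow> 'g set \<Rightarrow> bool"
  where "trace_covers G B D \<longleftrightarrow>
    subgroup D G \<and> block_idem (group_algebra G) B \<in> rel_trace G D ` fixed_elems G D"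

text \<open>Green's definition: a minimal subgroup \<open>D\<close> with \<open>1\<^sub>B\<close> in the image of the relative trace from \<open>D\<close>.\<close>

definition defect_group :: "('g, 'm) monoid_scheme \<Rightarrow> ('g \<Rightarrow> 'k::field) set \<Rightarrow> 'g set \<Rightarrow> bool"
  where "defect_group G B D \<longleftrightarrow>
    trace_covers G B D \<and> (\<forall>Q. trace_covers G B Q \<and> Q \<subseteq> D \<longrightarrow> Q = D)"


section \<open>Brauer induction and subsections\<close>

text \<open>
  \<open>b\<^sup>G = B\<close> for a block \<open>b\<close> of the group algebra of \<open>H\<close>: the central character of \<open>b\<close>, composed with
  the truncation of the center to \<open>H\<close>, is the central character of \<open>B\<close>.
\<close>

definition brauer_induces :: "('g, 'm) monoid_scheme \<Rightarrow> 'g set \<Rightarrow>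
    ('g \<Rightarrow> 'k::field) set \<Rightarrow> ('g \<Rightarrow> 'k) set \<Rightarrow> bool"
  where "brauer_induces G H b B \<longleftrightarrow>
    is_block (subgroup_algebra G H) b \<and> is_block (group_algebra G) B \<and>
    (\<exists>\<omega> \<omega>'. central_character (subgroup_algebra G H) b \<omega> \<and>
       central_character (group_algebra G) B \<omega>' \<and>
       (\<forall>z \<in> center (group_algebra G). \<omega> (restrict_to H z) = \<omega>' z))"

definition p_element :: "nat \<Rightarrow> ('g, 'm) monoid_scheme \<Rightarrow> 'g \<Rightarrow> bool"
  where "p_element p G u \<longleftrightarrow> u \<in> carrier G \<and> (\<exists>n. group.ord G u = p ^ n)"

definition subsections :: "nat \<Rightarrow> ('g, 'm) monoid_scheme \<Rightarrow> ('g \<Rightarrow> 'k::field) set \<Rightarrow>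
    ('g \<times> ('g \<Rightarrow> 'k) set) set"
  where "subsections p G B =
    {(u, b). p_element p G u \<and> brauer_induces G (centralizer G u) b B}"

definition nontrivial_subsections :: "nat \<Rightarrow> ('g, 'm) monoid_scheme \<Rightarrow> ('g \<Rightarrow> 'k::field) set \<Rightarrow>
    ('g \<times> ('g \<Rightarrow> 'k) set) set"
  where "nontrivial_subsections p G B = {(u, b) \<in> subsections p G B. u \<noteq> \<one>\<^bsub>G\<^esub>}"

definition subsection_conj :: "('g, 'm) monoid_scheme \<Rightarrow>
    ('g \<times> ('g \<Rightarrow> 'k::field) set) \<Rightarrow> ('g \<times> ('g \<Rightarrow> 'k) set) \<Rightarrow> bool"
  where "subsection_conj G s t \<longleftrightarrow>
    (\<exists>g \<in> carrier G. fst t = g \<otimes>\<^bsub>G\<^esub> fst s \<otimes>\<^bsub>G\<^esub> inv\<^bsub>G\<^esub> g \<and> snd t = conj_elem G g ` snd s)"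

abbreviation centralizer_block :: "('g, 'm) monoid_scheme \<Rightarrow> 'g \<Rightarrow> ('g \<Rightarrow> 'k::field) set \<Rightarrow>
    ('k, 'g \<Rightarrow> 'k) module"
  where "centralizer_block G u b \<equiv> block_algebra (subgroup_algebra G (centralizer G u)) b"

end

theory Submission
  imports Defs "HOL-Algebra.Sylow" "HOL-Library.Function_Algebras" "HOL-Number_Theory.Residues"
begin

text \<open>
  The Reynolds ideal of a block consists of its central elements that are constant on \<open>p\<close>-sections.
  Such an element annihilates the Jacobson radical, because the coefficients of a nilpotent element
  add up to zero over every \<open>p\<close>-section; an element annihilating the Jacobson radical lies in the
  socle.  Conversely, a central element \<open>z\<close> of the socle turns \<open>a \<mapsto> (a z)(1)\<close> into a trace form on a
  von Neumann regular quotient, which vanishes on nilpotent elements such as \<open>y - y\<^sub>p\<^sub>'\<close>.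
  Writing \<open>x = u s\<close> with a \<open>p\<close>-element \<open>u\<close> and a \<open>p'\<close>-element \<open>s\<close> of \<open>C\<^sub>G(u)\<close>, the condition \<open>z x = z s\<close> only
  concerns the image of \<open>z\<close> under \<open>Br\<^sub>u\<close>.  As \<open>Br\<^sub>u(z) 1\<^sub>b\<close> vanishes unless \<open>b\<^sup>G = B\<close>, the kernel of the
  map is the Reynolds ideal of \<open>B\<close>.  The inequality of Loewy lengths follows since the embedding maps
  the radical, which is the set of nilpotent elements, into the radical.  If there were no non-trivial
  subsection, \<open>1\<^sub>B\<close> would be supported on elements whose centralizer has order prime to \<open>p\<close>, hence would be
  a trace from the trivial subgroup.

  The \<open>p'\<close>-part of \<open>x\<close> is written as \<open>x [^] q\<close>, for a power \<open>q\<close> of \<open>p\<close> such that \<open>q\<^sup>2 \<equiv> q\<close> modulo the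
  order of \<open>G\<close>.
\<close>

text \<open>The obstacle is that radical and socle are given by maximal and minimal left ideals,
  whereas the map is about coefficients. The bridge is the symmetric form
  \<open>a \<mapsto> a \<one>\<close>. Both inclusions for the Reynolds ideal are obtained from
  chain conditions and this form, without a structure theorem for semisimple algebras. If the order
  of \<open>G\<close> divides \<open>q * q - q\<close> for a power \<open>q > 1\<close> of
  \<open>p\<close>, then its \<open>p\<close>-part divides \<open>q\<close> and its
  \<open>p'\<close>-part divides \<open>q - 1\<close>; so taking \<open>q\<close>-th powers kills
  the \<open>p\<close>-part of \<open>x\<close> and fixes the \<open>p'\<close>-part. A single
  exponent chosen for \<open>G\<close> serves all centralizers and commutes with conjugation. Being
  a power of \<open>p\<close>, it is also a Frobenius exponent, and this ties the group side to
  nilpotency. Algebraic closedness enters through eigenvalues: they yield the central characters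
  that detect whether a block induces to \<open>B\<close>. The nontrivial defect group enters
  through the maximum, which has to be taken over a nonempty set.\<close>

no_notation Sum_Type.Plus (infixr \<open><+>\<close> 65)

section \<open>Left ideals, Jacobson radical and socle\<close>

text \<open>A single measure that grows strictly along inclusions supplies both chain conditions and
  a bound on the length of chains. For corners of group algebras and for their centers it is the
  dimension.\<close>

definition finite_length :: "('a, 'm) ring_scheme \<Rightarrow> bool"
  where "finite_length A \<longleftrightarrow>
    (\<exists>len :: 'a set \<Rightarrow> nat. \<forall>L L'. left_ideal L A \<and> left_ideal L' A \<and> L \<subset> L' \<longrightarrow> len L < len L')"

context ring
begin

lemma left_idealI:
  assumes "L \<subseteq> carrier R" "\<zero> \<in> L" "\<And>x y. x \<in> L \<Longrightarrow> y \<in> L \<Longrightarrow> x \<oplus> y \<in> L"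
    and lmult: "\<And>r x. r \<in> carrier R \<Longrightarrow> x \<in> L \<Longrightarrow> r \<otimes> x \<in> L"
  shows "left_ideal L R"
proof -
  have "\<ominus> x \<in> L" if "x \<in> L" for x
    using lmult[of "\<ominus> \<one>" x] that assms(1) by (auto simp: l_minus)
  then show ?thesis
    using assms unfolding left_ideal_def
    by (auto intro!: additive_subgroup.intro subgroup.intro simp flip: a_inv_def)
qed

lemma left_idealD:
  assumes "left_ideal L R"
  shows "L \<subseteq> carrier R" "\<zero> \<in> L" "x \<in> L \<Longrightarrow> y \<in> L \<Longrightarrow> x \<oplus> y \<in> L"
    "r \<in> carrier R \<Longrightarrow> x \<in> L \<Longrightarrow> r \<otimes> x \<in> L" "x \<in> L \<Longrightarrow> \<ominus> x \<in> L"
    "x \<in> L \<Longrightarrow> y \<in> L \<Longrightarrow> x \<ominus> y \<in> L" "x \<in> L \<Longrightarrow> x \<in> carrier R"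
proof -
  interpret additive_subgroup L R
    using assms by (auto simp: left_ideal_def)
  show sub: "L \<subseteq> carrier R" and "\<zero> \<in> L" "x \<in> L \<Longrightarrow> y \<in> L \<Longrightarrow> x \<oplus> y \<in> L"
    "r \<in> carrier R \<Longrightarrow> x \<in> L \<Longrightarrow> r \<otimes> x \<in> L" "x \<in> L \<Longrightarrow> x \<in> carrier R"
    using assms by (auto simp: left_ideal_def a_subset)
  show minus: "x \<in> L \<Longrightarrow> \<ominus> x \<in> L" for x
    using a_subgroup subgroup.m_inv_closed unfolding a_inv_def by fastforce
  show "x \<in> L \<Longrightarrow> y \<in> L \<Longrightarrow> x \<ominus> y \<in> L"
    using minus by (auto simp: a_minus_def)
qed

lemma left_ideal_carrier: "left_ideal (carrier R) R"
  by (rule left_idealI) auto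

lemma left_ideal_zero: "left_ideal {\<zero>} R"
  by (rule left_idealI) auto

lemma left_ideal_Int: "left_ideal L R \<Longrightarrow> left_ideal M R \<Longrightarrow> left_ideal (L \<inter> M) R"
  by (rule left_idealI) (auto dest: left_idealD)

lemma left_ideal_Inter:
  assumes "\<And>L. L \<in> \<M> \<Longrightarrow> left_ideal L R"
  shows "left_ideal (carrier R \<inter> \<Inter>\<M>) R"
  by (rule left_idealI) (auto dest: assms left_idealD)

lemma set_add_iff: "x \<in> L <+> M \<longleftrightarrow> (\<exists>l\<in>L. \<exists>m\<in>M. x = l \<oplus> m)"
  by (auto simp: set_add_def set_mult_def)

lemma left_ideal_add:
  assumes L: "left_ideal L R" and M: "left_ideal M R"
  shows "left_ideal (L <+> M) R" "L \<subseteq> L <+> M" "M \<subseteq> L <+> M"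
proof -
  note [simp] = left_idealD(7)[OF L] left_idealD(7)[OF M] left_idealD(2)[OF L] left_idealD(2)[OF M]
  show "left_ideal (L <+> M) R"
  proof (rule left_idealI)
    show "\<zero> \<in> L <+> M"
      unfolding set_add_iff by (rule bexI[of _ \<zero>], rule bexI[of _ \<zero>]) auto
    show "x \<oplus> y \<in> L <+> M" if xy: "x \<in> L <+> M" "y \<in> L <+> M" for x y
    proof -
      obtain l m l' m' where *: "l \<in> L" "m \<in> M" "x = l \<oplus> m" "l' \<in> L" "m' \<in> M" "y = l' \<oplus> m'"
        using xy unfolding set_add_iff by blast
      then have "x \<oplus> y = (l \<oplus> l') \<oplus> (m \<oplus> m')"
        by (simp add: a_ac)
      then show ?thesis
        using * left_idealD(3)[OF L] left_idealD(3)[OF M] unfolding set_add_iff by blast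
    qed
    show "r \<otimes> x \<in> L <+> M" if rx: "r \<in> carrier R" "x \<in> L <+> M" for r x
    proof -
      obtain l m where *: "l \<in> L" "m \<in> M" "x = l \<oplus> m"
        using rx unfolding set_add_iff by blast
      then have "r \<otimes> x = r \<otimes> l \<oplus> r \<otimes> m"
        using rx by (simp add: r_distr)
      then show ?thesis
        using * rx left_idealD(4)[OF L] left_idealD(4)[OF M] unfolding set_add_iff by blast
    qed
  qed (auto simp: set_add_iff)
  show "L \<subseteq> L <+> M"
  proof
    fix x assume "x \<in> L"
    then show "x \<in> L <+> M"
      unfolding set_add_iff by (intro bexI[of _ x] bexI[of _ \<zero>]) auto
  qed
  show "M \<subseteq> L <+> M"
  proof
    fix x assume "x \<in> M"
    then show "x \<in> L <+> M"
      unfolding set_add_iff by (intro bexI[of _ \<zero>] bexI[of _ x]) auto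
  qed
qed

lemma left_ideal_mult_right:
  assumes L: "left_ideal L R" and z: "z \<in> carrier R"
  shows "left_ideal ((\<lambda>x. x \<otimes> z) ` L) R"
proof (rule left_idealI)
  note [simp] = left_idealD(7)[OF L] z
  show "\<zero> \<in> (\<lambda>x. x \<otimes> z) ` L"
    using left_idealD(2)[OF L] by (intro image_eqI[of _ _ \<zero>]) auto
  show "x \<oplus> y \<in> (\<lambda>x. x \<otimes> z) ` L" if xy: "x \<in> (\<lambda>x. x \<otimes> z) ` L" "y \<in> (\<lambda>x. x \<otimes> z) ` L" for x y
  proof -
    obtain a where "a \<in> L" "x = a \<otimes> z"
      using xy(1) by blast
    moreover obtain c where "c \<in> L" "y = c \<otimes> z"
      using xy(2) by blast
    ultimately show ?thesis
      using left_idealD(3)[OF L] by (intro image_eqI[of _ _ "a \<oplus> c"]) (auto simp: l_distr)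
  qed
  show "r \<otimes> x \<in> (\<lambda>x. x \<otimes> z) ` L" if rx: "r \<in> carrier R" "x \<in> (\<lambda>x. x \<otimes> z) ` L" for r x
  proof -
    obtain a where "a \<in> L" "x = a \<otimes> z"
      using rx by blast
    then show ?thesis
      using rx left_idealD(4)[OF L] by (intro image_eqI[of _ _ "r \<otimes> a"]) (auto simp: m_assoc)
  qed
qed (use assms left_idealD(7)[OF L] in auto)

lemma left_ideal_eq_carrier:
  assumes "left_ideal L R" "\<one> \<in> L"
  shows "L = carrier R"
proof
  show "carrier R \<subseteq> L"
    using left_idealD(4)[OF assms(1) _ assms(2)] by fastforce
qed (use left_idealD(1)[OF assms(1)] in auto)

lemma finite_length_maximal:
  assumes fl: "finite_length R" and L: "left_ideal L R" "P L"
  obtains M where "left_ideal M R" "P M"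
    "\<And>K. left_ideal K R \<Longrightarrow> P K \<Longrightarrow> M \<subseteq> K \<Longrightarrow> K = M"
proof -
  obtain len :: "'a set \<Rightarrow> nat"
    where len: "\<And>L L'. left_ideal L R \<Longrightarrow> left_ideal L' R \<Longrightarrow> L \<subset> L' \<Longrightarrow> len L < len L'"
    using fl unfolding finite_length_def by blast
  have "len K \<le> len (carrier R)" if "left_ideal K R" for K
    using len[OF that left_ideal_carrier] left_idealD(1)[OF that] by (cases "K = carrier R") force+
  then have "\<exists>M. (left_ideal M R \<and> P M) \<and> (\<forall>K. left_ideal K R \<and> P K \<longrightarrow> len K \<le> len M)"
    using L by (intro ex_has_greatest_nat[of _ L len "Suc (len (carrier R))"]) (auto simp: less_Suc_eq_le)
  then obtain M where M: "left_ideal M R \<and> P M"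
    "\<And>K. left_ideal K R \<and> P K \<Longrightarrow> len K \<le> len M"
    by blast
  show thesis
  proof (rule that[of M])
    show "K = M" if K: "left_ideal K R" "P K" "M \<subseteq> K" for K
      using M(2)[of K] len[of M K] M(1) K by force
  qed (use M(1) in auto)
qed

lemma finite_length_minimal:
  assumes fl: "finite_length R" and L: "left_ideal L R" "P L"
  obtains M where "left_ideal M R" "P M"
    "\<And>K. left_ideal K R \<Longrightarrow> P K \<Longrightarrow> K \<subseteq> M \<Longrightarrow> K = M"
proof -
  obtain len :: "'a set \<Rightarrow> nat"
    where len: "\<And>L L'. left_ideal L R \<Longrightarrow> left_ideal L' R \<Longrightarrow> L \<subset> L' \<Longrightarrow> len L < len L'"
    using fl unfolding finite_length_def by blast
  obtain M where M: "left_ideal M R \<and> P M"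
    "\<And>K. left_ideal K R \<and> P K \<Longrightarrow> len M \<le> len K"
    using ex_has_least_nat[of "\<lambda>K. left_ideal K R \<and> P K" L len] L by blast
  show thesis
  proof (rule that[of M])
    show "K = M" if K: "left_ideal K R" "P K" "K \<subseteq> M" for K
      using M(2)[of K] len[of K M] M(1) K by force
  qed (use M(1) in auto)
qed

lemma proper_in_maximal:
  assumes fl: "finite_length R" and L: "left_ideal L R" "\<one> \<notin> L"
  obtains M where "maximal_left_ideal M R" "L \<subseteq> M" "\<one> \<notin> M"
proof -
  obtain M where M: "left_ideal M R" "L \<subseteq> M \<and> \<one> \<notin> M"
    "\<And>K. left_ideal K R \<Longrightarrow> L \<subseteq> K \<and> \<one> \<notin> K \<Longrightarrow> M \<subseteq> K \<Longrightarrow> K = M"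
    using finite_length_maximal[OF fl, of L "\<lambda>K. L \<subseteq> K \<and> \<one> \<notin> K"] L by blast
  have "maximal_left_ideal M R"
    unfolding maximal_left_ideal_def
  proof (intro conjI allI impI)
    show "M \<noteq> carrier R"
      using M(2) by auto
    show "K = M \<or> K = carrier R" if K: "left_ideal K R \<and> M \<subseteq> K" for K
    proof (cases "\<one> \<in> K")
      case False
      then show ?thesis
        using M(2) M(3)[of K] K by blast
    qed (use left_ideal_eq_carrier K in blast)
  qed (rule M(1))
  then show thesis
    using that M by blast
qed

section \<open>Jacobson radical: quasi-inverses and nilpotency\<close>

lemma left_ideal_jacobson_radical: "left_ideal (jacobson_radical R) R"
  unfolding jacobson_radical_def
  by (rule left_ideal_Inter) (auto simp: maximal_left_ideal_def)

text \<open>If \<open>1 - a\<close> generated a proper left ideal, a maximal left ideal above it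
  would contain \<open>1 - a\<close> and, as every maximal one does, \<open>a\<close>; hence it
  would contain 1.\<close>

lemma jacobson_radical_left_inverse:
  assumes fl: "finite_length R" and a: "a \<in> jacobson_radical R"
  obtains y where "y \<in> carrier R" "y \<otimes> (\<one> \<ominus> a) = \<one>"
proof -
  have [simp]: "a \<in> carrier R"
    using a by (auto simp: jacobson_radical_def)
  let ?L = "(\<lambda>x. x \<otimes> (\<one> \<ominus> a)) ` carrier R"
  have L: "left_ideal ?L R"
    by (rule left_ideal_mult_right[OF left_ideal_carrier]) auto
  have "\<one> \<in> ?L"
  proof (rule ccontr)
    assume "\<one> \<notin> ?L"
    then obtain M where M: "maximal_left_ideal M R" "?L \<subseteq> M" "\<one> \<notin> M"
      using proper_in_maximal[OF fl L] by blast
    have "\<one> \<ominus> a \<in> ?L"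
      by (rule image_eqI[of _ _ \<one>]) auto
    then have "\<one> \<ominus> a \<in> M" "a \<in> M"
      using M a by (auto simp: jacobson_radical_def)
    then have "(\<one> \<ominus> a) \<oplus> a \<in> M"
      using M(1) left_idealD(3) by (auto simp: maximal_left_ideal_def)
    moreover have "(\<one> \<ominus> a) \<oplus> a = \<one>"
      by (simp add: a_minus_def a_assoc l_neg)
    ultimately show False
      using M(3) by simp
  qed
  then show thesis
    using that by force
qed

text \<open>Nakayama's lemma for single elements: a left inverse \<open>y\<close> of
  \<open>1 - a\<close> gives \<open>z = y (z - a z)\<close>. It serves for nilpotency, with
  \<open>L\<close> zero, and for the strict descent of radical powers.\<close>

lemma jacobson_radical_nakayama:
  assumes fl: "finite_length R" and a: "a \<in> jacobson_radical R"
    and L: "left_ideal L R" and z: "z \<in> carrier R" "z \<ominus> a \<otimes> z \<in> L"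
  shows "z \<in> L"
proof -
  have [simp]: "a \<in> carrier R"
    using a by (auto simp: jacobson_radical_def)
  obtain y where y: "y \<in> carrier R" "y \<otimes> (\<one> \<ominus> a) = \<one>"
    using jacobson_radical_left_inverse[OF fl a] .
  have "z = (y \<otimes> (\<one> \<ominus> a)) \<otimes> z"
    using y z by simp
  also have "\<dots> = y \<otimes> (z \<ominus> a \<otimes> z)"
    using y(1) z(1) by (simp add: m_assoc a_minus_def l_distr l_minus)
  also have "\<dots> \<in> L"
    using left_idealD(4)[OF L] y(1) z by blast
  finally show ?thesis .
qed

text \<open>The left ideals generated by the powers of \<open>a\<close> stabilize, so some
  \<open>a^n\<close> equals \<open>(x a) a^n\<close>. As \<open>x a\<close> is again in the radical,
  Nakayama with the zero ideal kills \<open>a^n\<close>.\<close>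

lemma jacobson_radical_nilpotent:
  assumes fl: "finite_length R" and a: "a \<in> jacobson_radical R"
  shows "\<exists>n::nat. a [^] n = \<zero>"
proof -
  have [simp]: "a \<in> carrier R"
    using a by (auto simp: jacobson_radical_def)
  let ?L = "\<lambda>n::nat. (\<lambda>x. x \<otimes> a [^] n) ` carrier R"
  have L: "left_ideal (?L n) R" for n
    by (rule left_ideal_mult_right[OF left_ideal_carrier]) auto
  obtain M where M: "left_ideal M R" "\<exists>n. M = ?L n"
    "\<And>K. left_ideal K R \<Longrightarrow> (\<exists>n. K = ?L n) \<Longrightarrow> K \<subseteq> M \<Longrightarrow> K = M"
    by (rule finite_length_minimal[OF fl, of "?L 0" "\<lambda>K. \<exists>n. K = ?L n"]) (use L in blast)+
  obtain n where n: "M = ?L n"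
    using M(2) by blast
  have "?L (Suc n) \<subseteq> ?L n"
  proof
    fix y assume "y \<in> ?L (Suc n)"
    then obtain x where "x \<in> carrier R" "y = x \<otimes> (a \<otimes> a [^] n)"
      using nat_pow_Suc2[of a n] by auto
    then show "y \<in> ?L n"
      by (intro image_eqI[of _ _ "x \<otimes> a"]) (auto simp: m_assoc)
  qed
  then have eq: "?L (Suc n) = ?L n"
    using M(3)[OF L[of "Suc n"]] n by blast
  have "a [^] n \<in> ?L n"
    by (rule image_eqI[of _ _ \<one>]) auto
  then obtain x where x: "x \<in> carrier R" "a [^] n = x \<otimes> a [^] Suc n"
    unfolding eq[symmetric] by blast
  have "a [^] n = x \<otimes> (a \<otimes> a [^] n)"
    by (rule trans[OF x(2)]) (simp only: nat_pow_Suc2[OF \<open>a \<in> carrier R\<close>])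
  also have "\<dots> = (x \<otimes> a) \<otimes> a [^] n"
    by (rule m_assoc[symmetric]) (use x(1) in auto)
  finally have e: "a [^] n = (x \<otimes> a) \<otimes> a [^] n" .
  have "a [^] n \<ominus> (x \<otimes> a) \<otimes> a [^] n = \<zero>"
    by (rule r_right_minus_eq[THEN iffD2, OF _ _ e]) (use x(1) in auto)
  then have "a [^] n \<ominus> (x \<otimes> a) \<otimes> a [^] n \<in> {\<zero>}"
    by blast
  then have "a [^] n \<in> {\<zero>}"
    using jacobson_radical_nakayama[OF fl left_idealD(4)[OF left_ideal_jacobson_radical x(1) a]
        left_ideal_zero nat_pow_closed[OF \<open>a \<in> carrier R\<close>]] by blast
  then show ?thesis
    by auto
qed

section \<open>Socle, annihilators and complements\<close>

lemma subgroup_socle: "subgroup (socle R) (add_monoid R)"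
  unfolding socle_def
  by (rule add.generate_is_subgroup)
    (auto simp: minimal_left_ideal_def dest: left_idealD)

lemma minimal_left_ideal_subset_socle: "minimal_left_ideal M R \<Longrightarrow> M \<subseteq> socle R"
  unfolding socle_def by (auto intro: generate.incl)

lemma socle_subsetI:
  assumes L: "left_ideal L R" and sub: "\<And>M. minimal_left_ideal M R \<Longrightarrow> M \<subseteq> L"
  shows "socle R \<subseteq> L"
proof -
  have "subgroup L (add_monoid R)"
    using L by (auto simp: left_ideal_def additive_subgroup_def)
  then show ?thesis
    unfolding socle_def using sub by (intro add.generate_subgroup_incl) auto
qed

lemma left_ideal_socle: "left_ideal (socle R) R"
proof (rule left_idealI)
  interpret S: subgroup "socle R" "add_monoid R"
    by (rule subgroup_socle)
  show "socle R \<subseteq> carrier R" "\<zero> \<in> socle R" "\<And>x y. x \<in> socle R \<Longrightarrow> y \<in> socle R \<Longrightarrow> x \<oplus> y \<in> socle R"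
    using S.subset S.one_closed S.m_closed by auto
  fix r x assume r: "r \<in> carrier R" and "x \<in> socle R"
  then have "x \<in> generate (add_monoid R) (\<Union>{M. minimal_left_ideal M R})"
    by (simp add: socle_def)
  then have "x \<in> carrier R \<and> r \<otimes> x \<in> socle R"
  proof induction
    case one
    then show ?case
      using r S.one_closed by auto
  next
    case (incl h)
    then obtain M where "h \<in> M" "minimal_left_ideal M R"
      by blast
    then have "h \<in> carrier R" "r \<otimes> h \<in> M" "M \<subseteq> socle R"
      using left_idealD(4,7) minimal_left_ideal_subset_socle r by (auto simp: minimal_left_ideal_def)
    then show ?case
      by blast
  next
    case (inv h)
    then obtain M where "h \<in> M" "minimal_left_ideal M R"
      by blast
    then have "h \<in> carrier R" "r \<otimes> (\<ominus> h) \<in> M" "M \<subseteq> socle R"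
      using left_idealD(4,5,7) minimal_left_ideal_subset_socle r by (auto simp: minimal_left_ideal_def)
    then show ?case
      by (auto simp flip: a_inv_def)
  next
    case (eng h1 h2)
    then show ?case
      using r S.m_closed by (auto simp: r_distr)
  qed
  then show "r \<otimes> x \<in> socle R"
    by blast
qed

text \<open>Stands in for semisimplicity of the ring modulo a finite intersection of maximal left
  ideals. With \<open>I\<close> the intersection of all but \<open>M\<close>, either
  \<open>M\<close> is redundant or \<open>1 = n + m\<close> with \<open>n\<close> in
  \<open>I\<close> and \<open>m\<close> in \<open>M\<close>. Then \<open>m z\<close> is covered by
  the induction hypothesis, and \<open>n z\<close> lies in \<open>I z\<close>, which is zero or a
  minimal left ideal.\<close>

lemma annihilated_by_Inter_maximal_imp_socle:
  assumes "finite \<M>" "\<And>M. M \<in> \<M> \<Longrightarrow> maximal_left_ideal M R" "z \<in> carrier R"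
    and "\<And>x. x \<in> carrier R \<inter> \<Inter>\<M> \<Longrightarrow> x \<otimes> z = \<zero>"
  shows "z \<in> socle R"
  using assms
proof (induction arbitrary: z rule: finite_induct)
  case empty
  then have "\<one> \<otimes> z = \<zero>"
    by blast
  then have "z = \<zero>"
    using empty.prems(2) by simp
  then show ?case
    using left_idealD(2)[OF left_ideal_socle] by simp
next
  case (insert M \<M>)
  note [simp] = \<open>z \<in> carrier R\<close>
  define I where "I = carrier R \<inter> \<Inter>\<M>"
  have I: "left_ideal I R"
    unfolding I_def using insert.prems(1)
    by (intro left_ideal_Inter) (auto simp: maximal_left_ideal_def)
  have M: "left_ideal M R" and Mmax: "\<And>L. left_ideal L R \<Longrightarrow> M \<subseteq> L \<Longrightarrow> L = M \<or> L = carrier R"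
    using insert.prems(1)[of M] by (auto simp: maximal_left_ideal_def)
  note [simp] = left_idealD(7)[OF I] left_idealD(7)[OF M]
  have zero: "x \<otimes> z = \<zero>" if "x \<in> I" "x \<in> M" for x
    using insert.prems(3)[of x] that by (auto simp: I_def)
  show ?case
  proof (cases "I \<subseteq> M")
    case True
    show ?thesis
      using insert.prems zero True by (intro insert.IH) (auto simp: I_def)
  next
    case False
    have sum_carrier: "L <+> M = carrier R" if "left_ideal L R" "\<not> L \<subseteq> M" for L
      using Mmax[OF left_ideal_add(1)[OF that(1) M] left_ideal_add(3)[OF that(1) M]]
        left_ideal_add(2)[OF that(1) M] that(2) by auto
    then have "\<one> \<in> I <+> M"
      using I False by auto
    then obtain n m where nm: "n \<in> I" "m \<in> M" "\<one> = n \<oplus> m"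
      unfolding set_add_iff by blast
    have z_eq: "z = n \<otimes> z \<oplus> m \<otimes> z"
      using nm(1,2) l_distr[of n m z] by (simp flip: nm(3))
    have mz: "m \<otimes> z \<in> socle R"
    proof (rule insert.IH)
      fix x assume "x \<in> carrier R \<inter> \<Inter>\<M>"
      then have x: "x \<in> I"
        by (simp add: I_def)
      have xeq: "x = x \<otimes> n \<oplus> x \<otimes> m"
        using x nm(1,2) r_distr[of n m x] by (simp flip: nm(3))
      \<comment> \<open>\<open>x m = x - x n\<close> stays in \<open>I\<close> and also lies in
        \<open>M\<close>, so it annihilates \<open>z\<close>.\<close>
      have "x \<otimes> m = \<ominus> (x \<otimes> n) \<oplus> (x \<otimes> n \<oplus> x \<otimes> m)"
        using x nm by (simp add: r_neg1)
      also have "\<dots> = \<ominus> (x \<otimes> n) \<oplus> x"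
        using xeq by simp
      also have "\<dots> \<in> I"
        using left_idealD[OF I] x nm by auto
      finally have "x \<otimes> m \<in> I" .
      moreover have "x \<otimes> m \<in> M"
        using left_idealD[OF M] x nm by auto
      ultimately show "x \<otimes> (m \<otimes> z) = \<zero>"
        using zero[of "x \<otimes> m"] x nm by (simp add: m_assoc)
    qed (use insert.prems nm in auto)
    let ?Iz = "(\<lambda>x. x \<otimes> z) ` I"
    have Iz: "left_ideal ?Iz R"
      using I by (intro left_ideal_mult_right) auto
    have "n \<otimes> z \<in> socle R"
    proof (cases "?Iz = {\<zero>}")
      case True
      then have "n \<otimes> z = \<zero>"
        using nm by auto
      then show ?thesis
        using left_idealD(2)[OF left_ideal_socle] by simp
    next
      case False
      \<comment> \<open>Right multiplication by \<open>z\<close> kills the intersection of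
        \<open>I\<close> and \<open>M\<close>, so \<open>I z\<close> is a quotient of
        \<open>I\<close> modulo that intersection, which is isomorphic to the simple module
        \<open>R\<close> modulo \<open>M\<close>. The proof runs through preimages \<open>P\<close>
        of left ideals below \<open>I z\<close>.\<close>
      have "minimal_left_ideal ?Iz R"
        unfolding minimal_left_ideal_def
      proof (intro conjI allI impI)
        fix L assume "left_ideal L R \<and> L \<subseteq> ?Iz"
        then have L: "left_ideal L R" "L \<subseteq> ?Iz"
          by auto
        define P where "P = {x \<in> I. x \<otimes> z \<in> L}"
        have P: "left_ideal P R"
        proof (rule left_idealI)
          show "\<zero> \<in> P"
            using left_idealD(2)[OF I] left_idealD(2)[OF L(1)] by (simp add: P_def)
          show "x \<oplus> y \<in> P" if "x \<in> P" "y \<in> P" for x y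
            using that left_idealD(3)[OF I] left_idealD(3)[OF L(1)] by (simp add: P_def l_distr)
          show "r \<otimes> x \<in> P" if "r \<in> carrier R" "x \<in> P" for r x
            using that left_idealD(4)[OF I] left_idealD(4)[OF L(1)] by (simp add: P_def m_assoc)
        qed (auto simp: P_def)
        have L_eq: "L = (\<lambda>x. x \<otimes> z) ` P"
          using L(2) by (auto simp: P_def)
        show "L = {\<zero>} \<or> L = ?Iz"
        proof (cases "P \<subseteq> M")
          case True
          have "x \<otimes> z = \<zero>" if "x \<in> P" for x
            using that True by (intro zero) (auto simp: P_def)
          then have "L = {\<zero>}"
            unfolding L_eq using left_idealD(2)[OF P] by force
          then show ?thesis ..
        next
          case False
          have "y \<otimes> z \<in> L" if y: "y \<in> I" for y
          proof -
            have "y \<in> P <+> M"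
              using y sum_carrier[OF P False] by auto
            then obtain x m where xm: "x \<in> P" "m \<in> M" "y = x \<oplus> m"
              unfolding set_add_iff by blast
            then have [simp]: "x \<in> carrier R" and x: "x \<in> I" "x \<otimes> z \<in> L"
              by (auto simp: P_def)
            have "m = \<ominus> x \<oplus> y"
              using xm by (simp add: r_neg1)
            also have "\<dots> \<in> I"
              using x y left_idealD[OF I] by auto
            finally have "m \<otimes> z = \<zero>"
              using xm by (intro zero)
            then show ?thesis
              using xm x by (simp add: l_distr)
          qed
          then show ?thesis
            using L(2) by blast
        qed
      qed (use Iz False in auto)
      then show ?thesis
        using nm minimal_left_ideal_subset_socle by blast
    qed
    then show ?thesis
      by (intro ssubst[OF z_eq, of "\<lambda>x. x \<in> socle R"] left_idealD(3)[OF left_ideal_socle _ mz])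
  qed
qed

text \<open>Finitely many maximal left ideals already intersect in the radical: a minimal member
  among the finite intersections cannot shrink when one more maximal left ideal is added.\<close>

lemma jacobson_radical_annihilated_imp_socle:
  assumes fl: "finite_length R" and z: "z \<in> carrier R"
    and zero: "\<And>a. a \<in> jacobson_radical R \<Longrightarrow> a \<otimes> z = \<zero>"
  shows "z \<in> socle R"
proof -
  let ?P = "\<lambda>K. \<exists>\<M>. finite \<M> \<and> (\<forall>M\<in>\<M>. maximal_left_ideal M R) \<and> K = carrier R \<inter> \<Inter>\<M>"
  have left_ideal: "left_ideal (carrier R \<inter> \<Inter>\<M>) R" if "\<forall>M\<in>\<M>. maximal_left_ideal M R" for \<M>
    using that by (intro left_ideal_Inter) (auto simp: maximal_left_ideal_def)
  have P0: "?P (carrier R)"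
    by (rule exI[of _ "{}"]) auto
  obtain K where K: "left_ideal K R" "?P K"
    "\<And>L. left_ideal L R \<Longrightarrow> ?P L \<Longrightarrow> L \<subseteq> K \<Longrightarrow> L = K"
    by (rule finite_length_minimal[OF fl left_ideal_carrier, of ?P, OF P0]) (rule that)
  then obtain \<M> where \<M>: "finite \<M>" "\<forall>M\<in>\<M>. maximal_left_ideal M R" "K = carrier R \<inter> \<Inter>\<M>"
    by blast
  have "K \<subseteq> M" if M: "maximal_left_ideal M R" for M
  proof -
    have "carrier R \<inter> \<Inter>(insert M \<M>) = K"
      using M \<M> by (intro K(3) left_ideal exI[of _ "insert M \<M>"]) auto
    then show ?thesis
      by blast
  qed
  then have "K \<subseteq> jacobson_radical R"
    using \<M>(3) by (auto simp: jacobson_radical_def)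
  then show ?thesis
    using \<M> z zero by (intro annihilated_by_Inter_maximal_imp_socle[of \<M>]) auto
qed

text \<open>Take \<open>C\<close> maximal among the left ideals meeting \<open>L\<close> trivially.
  A minimal left ideal outside of \<open>C + L\<close> meets that sum trivially and could be added
  to \<open>C\<close>.\<close>

lemma socle_complement:
  assumes fl: "finite_length R" and L: "left_ideal L R"
  obtains C where "left_ideal C R" "C \<inter> L = {\<zero>}" "socle R \<subseteq> C <+> L"
proof -
  obtain C where C: "left_ideal C R" "C \<inter> L = {\<zero>}"
    "\<And>K. left_ideal K R \<Longrightarrow> K \<inter> L = {\<zero>} \<Longrightarrow> C \<subseteq> K \<Longrightarrow> K = C"
    using finite_length_maximal[OF fl left_ideal_zero, of "\<lambda>K. K \<inter> L = {\<zero>}"]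
      left_idealD(2)[OF L] by auto
  note [simp] = left_idealD(7)[OF C(1)] left_idealD(7)[OF L]
  note CL = left_ideal_add[OF C(1) L]
  have "M \<subseteq> C <+> L" if M: "minimal_left_ideal M R" for M
  proof (rule ccontr)
    assume nsub: "\<not> M \<subseteq> C <+> L"
    have M_ideal: "left_ideal M R"
      using M by (simp add: minimal_left_ideal_def)
    note [simp] = left_idealD(7)[OF M_ideal]
    have "M \<inter> (C <+> L) = {\<zero>} \<or> M \<inter> (C <+> L) = M"
      using M left_ideal_Int[OF M_ideal CL(1)] by (auto simp: minimal_left_ideal_def)
    then have disj: "M \<inter> (C <+> L) = {\<zero>}"
      using nsub by blast
    note CM = left_ideal_add[OF C(1) M_ideal]
    have "x = \<zero>" if x: "x \<in> C <+> M" "x \<in> L" for x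
    proof -
      obtain c m where cm: "c \<in> C" "m \<in> M" "x = c \<oplus> m"
        using x(1) unfolding set_add_iff by blast
      then have "m = \<ominus> c \<oplus> x"
        by (simp add: r_neg1)
      then have "m \<in> C <+> L"
        using cm x left_idealD(5)[OF C(1)] unfolding set_add_iff by blast
      then have "m = \<zero>"
        using disj cm by blast
      then show ?thesis
        using cm x C(2) by auto
    qed
    then have "(C <+> M) \<inter> L = {\<zero>}"
      using left_idealD(2)[OF CM(1)] left_idealD(2)[OF L] by blast
    then have "C <+> M = C"
      using CM by (intro C(3)) auto
    then show False
      using CM(3) CL(2) nsub by blast
  qed
  then have "socle R \<subseteq> C <+> L"
    by (intro socle_subsetI CL(1))
  then show thesis
    using that C by blast
qed

text \<open>The ring modulo the annihilator of a central socle element is von Neumann regular.\<close>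

lemma central_socle_regular:
  assumes fl: "finite_length R" and z: "z \<in> center R" "z \<in> socle R" and n: "n \<in> carrier R"
  obtains y where "y \<in> carrier R" "n \<otimes> z = n \<otimes> y \<otimes> n \<otimes> z"
proof -
  have [simp]: "z \<in> carrier R" "n \<in> carrier R"
    using z n by (auto simp: center_def)
  let ?L = "(\<lambda>x. x \<otimes> (n \<otimes> z)) ` carrier R"
  have L: "left_ideal ?L R"
    by (rule left_ideal_mult_right[OF left_ideal_carrier]) auto
  obtain C where C: "left_ideal C R" "C \<inter> ?L = {\<zero>}" "socle R \<subseteq> C <+> ?L"
    using socle_complement[OF fl L] .
  obtain c x where cx: "c \<in> C" "x \<in> carrier R" "z = c \<oplus> x \<otimes> (n \<otimes> z)"
    using z(2) C(3) unfolding set_add_def set_mult_def by auto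
  have [simp]: "c \<in> carrier R"
    using left_idealD(7)[OF C(1)] cx(1) .
  have nz: "n \<otimes> z = n \<otimes> c \<oplus> (n \<otimes> x) \<otimes> (n \<otimes> z)"
  proof -
    have "n \<otimes> z = n \<otimes> (c \<oplus> x \<otimes> (n \<otimes> z))"
      using cx(3) by (rule arg_cong)
    also have "\<dots> = n \<otimes> c \<oplus> (n \<otimes> x) \<otimes> (n \<otimes> z)"
      using cx(2) by (simp add: r_distr m_assoc)
    finally show ?thesis .
  qed
  have nzL: "n \<otimes> z \<in> ?L"
    by (rule image_eqI[of _ _ \<one>]) auto
  have nxL: "(n \<otimes> x) \<otimes> (n \<otimes> z) \<in> ?L"
    using cx(2) by (intro image_eqI[of _ _ "n \<otimes> x"]) auto
  \<comment> \<open>\<open>n c\<close> lies in \<open>C\<close> and, as the difference of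
    \<open>n z\<close> and \<open>n x n z\<close>, also in the left ideal generated by
    \<open>n z\<close>; these two meet trivially.\<close>
  have "n \<otimes> c = (n \<otimes> c \<oplus> (n \<otimes> x) \<otimes> (n \<otimes> z)) \<ominus> (n \<otimes> x) \<otimes> (n \<otimes> z)"
    using cx(2) by (simp add: a_minus_def a_assoc r_neg)
  also have "\<dots> = n \<otimes> z \<ominus> (n \<otimes> x) \<otimes> (n \<otimes> z)"
    using nz by simp
  also have "\<dots> \<in> ?L"
    using left_idealD(6)[OF L nzL nxL] .
  finally have "n \<otimes> c = \<zero>"
    using C(2) left_idealD(4)[OF C(1) n cx(1)] by blast
  then have "n \<otimes> z = \<zero> \<oplus> (n \<otimes> x) \<otimes> (n \<otimes> z)"
    using nz by simp
  also have "\<dots> = n \<otimes> x \<otimes> n \<otimes> z"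
    using cx(2) by (simp add: m_assoc)
  finally show thesis
    using that cx(2) by blast
qed

section \<open>Powers of the radical and the Loewy length\<close>

lemma left_ideal_ideal_prod:
  assumes J: "left_ideal J R" and L: "left_ideal L R"
  shows "left_ideal (J \<cdot> L) R" "J \<cdot> L \<subseteq> L"
proof -
  show sub: "J \<cdot> L \<subseteq> L"
  proof
    fix x assume "x \<in> J \<cdot> L"
    then show "x \<in> L"
      by induction (use left_idealD[OF L] left_idealD[OF J] in auto)
  qed
  show "left_ideal (J \<cdot> L) R"
  proof (rule left_idealI)
    show "J \<cdot> L \<subseteq> carrier R"
      using sub left_idealD(1)[OF L] by blast
    show "\<zero> \<in> J \<cdot> L"
      using ideal_prod.prod[OF left_idealD(2)[OF J] left_idealD(2)[OF L], of R] by simp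
    show "r \<otimes> x \<in> J \<cdot> L" if r: "r \<in> carrier R" and "x \<in> J \<cdot> L" for r x
      using that(2)
    proof induction
      case (prod i j)
      then have "(r \<otimes> i) \<otimes> j \<in> J \<cdot> L"
        using left_idealD(4)[OF J r] by (intro ideal_prod.prod)
      then show ?case
        using prod r left_idealD(7)[OF J] left_idealD(7)[OF L] by (simp add: m_assoc)
    next
      case (sum x y)
      then have "x \<in> carrier R" "y \<in> carrier R"
        using sub left_idealD(1)[OF L] by auto
      then show ?case
        using sum r by (auto simp: r_distr intro: ideal_prod.sum)
    qed
  qed (rule ideal_prod.sum)
qed

text \<open>Take \<open>K\<close> maximal among the left ideals properly inside \<open>L\<close>.
  The radical must annihilate the simple quotient: if \<open>x a\<close> were outside of
  \<open>K\<close>, then \<open>a = k + y x a\<close> with \<open>k\<close> in \<open>K\<close>, and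
  Nakayama would put \<open>a\<close>, hence \<open>x a\<close>, into \<open>K\<close>.\<close>

lemma ideal_prod_jacobson_radical_psubset:
  assumes fl: "finite_length R" and L: "left_ideal L R" "L \<noteq> {\<zero>}"
  shows "jacobson_radical R \<cdot> L \<subset> L"
proof -
  let ?J = "jacobson_radical R"
  have "{\<zero>} \<subset> L"
    using L left_idealD(2)[OF L(1)] by auto
  then obtain K where K: "left_ideal K R" "K \<subset> L"
    "\<And>K'. left_ideal K' R \<Longrightarrow> K' \<subset> L \<Longrightarrow> K \<subseteq> K' \<Longrightarrow> K' = K"
    using finite_length_maximal[OF fl left_ideal_zero, of "\<lambda>K. K \<subset> L"] by blast
  note [simp] = left_idealD(7)[OF K(1)] left_idealD(7)[OF L(1)]
  have xa: "x \<otimes> a \<in> K" if x: "x \<in> ?J" and a: "a \<in> L" for x a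
  proof (rule ccontr)
    assume notin: "x \<otimes> a \<notin> K"
    have [simp]: "x \<in> carrier R"
      using x by (simp add: jacobson_radical_def)
    let ?P = "(\<lambda>y. y \<otimes> (x \<otimes> a)) ` carrier R"
    have P: "left_ideal ?P R"
      using a by (intro left_ideal_mult_right left_ideal_carrier) auto
    note KP = left_ideal_add[OF K(1) P]
    have "x \<otimes> a \<in> ?P"
      using a by (intro image_eqI[of _ _ \<one>]) auto
    then have "K <+> ?P \<noteq> K"
      using KP(3) notin by blast
    moreover have "K <+> ?P \<subseteq> L"
    proof
      fix w assume "w \<in> K <+> ?P"
      then obtain k y where "k \<in> K" "y \<in> carrier R" "w = k \<oplus> y \<otimes> (x \<otimes> a)"
        unfolding set_add_iff by blast
      then show "w \<in> L"
        using K(2) a left_idealD(3,4)[OF L(1)] by auto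
    qed
    ultimately have "a \<in> K <+> ?P"
      using K(3)[OF KP(1)] KP(2) a by blast
    then obtain k y where ky: "k \<in> K" "y \<in> carrier R" "a = k \<oplus> y \<otimes> (x \<otimes> a)"
      unfolding set_add_iff by blast
    have "a \<ominus> (y \<otimes> x) \<otimes> a = k"
    proof -
      have "a \<ominus> (y \<otimes> x) \<otimes> a = (k \<oplus> y \<otimes> (x \<otimes> a)) \<ominus> y \<otimes> (x \<otimes> a)"
        using a ky(2) by (simp flip: ky(3) add: m_assoc)
      also have "\<dots> = k"
        using a ky(1,2) by (simp add: a_minus_def a_assoc r_neg)
      finally show ?thesis .
    qed
    then have *: "a \<ominus> (y \<otimes> x) \<otimes> a \<in> K"
      using ky(1) by simp
    have "a \<in> K"
      using a by (intro jacobson_radical_nakayama[OF fl _ K(1) _ *]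
          left_idealD(4)[OF left_ideal_jacobson_radical ky(2) x]) auto
    then show False
      using notin left_idealD(4)[OF K(1)] by simp
  qed
  have "z \<in> K" if "z \<in> ?J \<cdot> L" for z
    using that by induction (use xa left_idealD(3)[OF K(1)] in auto)
  then show ?thesis
    using K(2) by blast
qed

lemma left_ideal_ideal_power:
  "left_ideal (ideal_power R (jacobson_radical R) n) R"
  by (induction n) (auto intro: left_ideal_carrier left_ideal_ideal_prod left_ideal_jacobson_radical)

lemma ideal_power_antimono:
  assumes "m \<le> n"
  shows "ideal_power R (jacobson_radical R) n \<subseteq> ideal_power R (jacobson_radical R) m"
  by (rule lift_Suc_antimono_le[OF _ assms])
    (auto simp: subset_iff dest!: left_ideal_ideal_prod(2)[THEN subsetD, rotated 2]
      intro: left_ideal_jacobson_radical left_ideal_ideal_power)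

lemma loewy_length:
  assumes fl: "finite_length R"
  shows "0 < loewy_length R" "ideal_power R (jacobson_radical R) (loewy_length R) = {\<zero>}"
proof -
  let ?I = "ideal_power R (jacobson_radical R)"
  obtain len :: "'a set \<Rightarrow> nat"
    where len: "\<And>L L'. left_ideal L R \<Longrightarrow> left_ideal L' R \<Longrightarrow> L \<subset> L' \<Longrightarrow> len L < len L'"
    using fl unfolding finite_length_def by blast
  \<comment> \<open>Each factor of the radical lowers the measure by at least one until zero is
    reached. The exponent \<open>Suc (len (carrier R))\<close> violates the bound and is positive,
    so the least exponent in \<open>loewy_length\<close> exists.\<close>
  have *: "?I n = {\<zero>} \<or> len (?I n) + n \<le> len (carrier R)" for n
  proof (induction n)
    case (Suc n)
    show ?case
    proof (cases "?I n = {\<zero>}")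
      case True
      then have "?I (Suc n) \<subseteq> {\<zero>}"
        using ideal_power_antimono[of n "Suc n"] by simp
      then show ?thesis
        using left_idealD(2)[OF left_ideal_ideal_power[of "Suc n"]] by blast
    next
      case False
      then have "?I (Suc n) \<subset> ?I n"
        using ideal_prod_jacobson_radical_psubset[OF fl left_ideal_ideal_power] by simp
      then have "len (?I (Suc n)) < len (?I n)"
        by (intro len left_ideal_ideal_power)
      then show ?thesis
        using Suc False by auto
    qed
  qed auto
  have "?I (Suc (len (carrier R))) = {\<zero>}"
    using *[of "Suc (len (carrier R))"] by auto
  then have "\<exists>l. l > 0 \<and> ?I l = {\<zero>}"
    by blast
  then show "0 < loewy_length R" "?I (loewy_length R) = {\<zero>}"
    using LeastI_ex[of "\<lambda>l. l > 0 \<and> ?I l = {\<zero>}"] unfolding loewy_length_def by blast+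
qed

end

section \<open>Commutative rings and comparison of Loewy lengths\<close>

lemma (in cring) maximal_left_ideal_prime:
  assumes M: "maximal_left_ideal M R" and xy: "x \<in> carrier R" "y \<in> carrier R" "x \<otimes> y \<in> M"
  shows "x \<in> M \<or> y \<in> M"
proof (rule disjCI)
  assume notin: "y \<notin> M"
  have M_ideal: "left_ideal M R"
    using M by (simp add: maximal_left_ideal_def)
  let ?P = "(\<lambda>r. r \<otimes> y) ` carrier R"
  have P: "left_ideal ?P R"
    using xy(2) by (intro left_ideal_mult_right left_ideal_carrier)
  note MP = left_ideal_add[OF M_ideal P]
  have "y \<in> ?P"
    using xy(2) by (intro image_eqI[of _ _ \<one>]) auto
  then have "M <+> ?P = carrier R"
    using M MP notin unfolding maximal_left_ideal_def by blast
  then have "\<one> \<in> M <+> ?P"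
    by simp
  then obtain m r where mr: "m \<in> M" "r \<in> carrier R" "\<one> = m \<oplus> r \<otimes> y"
    unfolding set_add_iff by blast
  note [simp] = xy(1,2) mr(2) left_idealD(7)[OF M_ideal mr(1)]
  have "x = x \<otimes> (m \<oplus> r \<otimes> y)"
    by (simp flip: mr(3))
  also have "\<dots> = x \<otimes> m \<oplus> r \<otimes> (x \<otimes> y)"
    by (simp add: r_distr m_lcomm)
  also have "\<dots> \<in> M"
    using xy(3) mr(1) left_idealD(3,4)[OF M_ideal] by simp
  finally show "x \<in> M" .
qed

lemma (in cring) nilpotent_in_jacobson_radical:
  assumes x: "x \<in> carrier R" and "x [^] (n::nat) = \<zero>"
  shows "x \<in> jacobson_radical R"
proof -
  have "x \<in> M" if M: "maximal_left_ideal M R" for M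
  proof -
    have M_ideal: "left_ideal M R"
      using M by (simp add: maximal_left_ideal_def)
    have "\<one> \<notin> M"
      using M left_ideal_eq_carrier[OF M_ideal] by (auto simp: maximal_left_ideal_def)
    then have "x \<in> M" if "x [^] k \<in> M" for k :: nat
      using that
    proof (induction k)
      case (Suc k)
      then show ?case
        using maximal_left_ideal_prime[OF M, of "x [^] k" x] x by auto
    qed simp
    then show ?thesis
      using assms(2) left_idealD(2)[OF M_ideal] by metis
  qed
  then show ?thesis
    using x by (auto simp: jacobson_radical_def)
qed

lemma (in ring) ring_hom_nat_pow:
  assumes S: "ring S" and h: "h \<in> ring_hom R S" and x: "x \<in> carrier R"
  shows "h (x [^] (n::nat)) = h x [^]\<^bsub>S\<^esub> n"
proof -
  interpret S: ring S by (rule S)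
  show ?thesis
    by (induction n) (use h x in \<open>auto simp: ring_hom_one[OF h] ring_hom_mult[OF h]\<close>)
qed

text \<open>The components \<open>f i\<close> are handled one at a time, so nothing about the
  radical of a direct sum is required. They need not be surjective; radical elements go to radical
  elements because they are nilpotent and the targets are commutative.\<close>

lemma loewy_length_le_Max:
  assumes A: "cring A" "finite_length A" and I: "finite I" "I \<noteq> {}"
    and A': "\<And>i. i \<in> I \<Longrightarrow> cring (A' i)" "\<And>i. i \<in> I \<Longrightarrow> finite_length (A' i)"
    and f: "\<And>i. i \<in> I \<Longrightarrow> f i \<in> ring_hom A (A' i)"
    and inj: "\<And>x. x \<in> carrier A \<Longrightarrow> (\<And>i. i \<in> I \<Longrightarrow> f i x = \<zero>\<^bsub>A' i\<^esub>) \<Longrightarrow> x = \<zero>\<^bsub>A\<^esub>"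
  shows "loewy_length A \<le> Max ((\<lambda>i. loewy_length (A' i)) ` I)"
proof -
  interpret A: cring A by (rule A)
  let ?l = "Max ((\<lambda>i. loewy_length (A' i)) ` I)"
  let ?J = "\<lambda>B. jacobson_radical B"
  have "f i x \<in> ideal_power (A' i) (?J (A' i)) n"
    if i: "i \<in> I" and "x \<in> ideal_power A (?J A) n" for i n x
    using that(2)
  proof (induction n arbitrary: x)
    case 0
    then show ?case
      using ring_hom_closed[OF f[OF i]] by simp
  next
    case (Suc n)
    interpret A': cring "A' i" by (rule A'[OF i])
    have "x \<in> ?J A \<cdot>\<^bsub>A\<^esub> ideal_power A (?J A) n"
      using Suc.prems by simp
    then have "x \<in> carrier A \<and> f i x \<in> ?J (A' i) \<cdot>\<^bsub>A' i\<^esub> ideal_power (A' i) (?J (A' i)) n"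
    proof induction
      case (prod a b)
      have a: "a \<in> carrier A"
        using prod(1) by (simp add: jacobson_radical_def)
      have b: "b \<in> carrier A"
        using A.left_idealD(7)[OF A.left_ideal_ideal_power prod(2)] .
      obtain k :: nat where "a [^]\<^bsub>A\<^esub> k = \<zero>\<^bsub>A\<^esub>"
        using A.jacobson_radical_nilpotent[OF A(2) prod(1)] by blast
      then have "f i a [^]\<^bsub>A' i\<^esub> k = \<zero>\<^bsub>A' i\<^esub>"
        using A.ring_hom_nat_pow[OF A'.ring_axioms f[OF i] a, of k]
          ring_hom_zero[OF f[OF i] A.ring_axioms A'.ring_axioms] by simp
      then have "f i a \<in> ?J (A' i)"
        using ring_hom_closed[OF f[OF i] a] A'.nilpotent_in_jacobson_radical by blast
      then show ?case
        using a b Suc.IH[OF prod(2)] ring_hom_mult[OF f[OF i] a b]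
        by (auto intro: ideal_prod.prod)
    next
      case (sum a b)
      then show ?case
        using ring_hom_add[OF f[OF i], of a b] by (auto intro: ideal_prod.sum)
    qed
    then show ?case
      by simp
  qed
  moreover have "ideal_power (A' i) (?J (A' i)) ?l \<subseteq> {\<zero>\<^bsub>A' i\<^esub>}" if i: "i \<in> I" for i
  proof -
    interpret A': cring "A' i" by (rule A'[OF i])
    have "loewy_length (A' i) \<le> ?l"
      using I i by (intro Max_ge) auto
    then show ?thesis
      using A'.ideal_power_antimono A'.loewy_length(2)[OF A'(2)[OF i]] by blast
  qed
  ultimately have "x = \<zero>\<^bsub>A\<^esub>" if "x \<in> ideal_power A (?J A) ?l" for x
    using that A.left_idealD(7)[OF A.left_ideal_ideal_power that] by (intro inj) blast+
  then have "ideal_power A (?J A) ?l = {\<zero>\<^bsub>A\<^esub>}"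
    using A.left_idealD(2)[OF A.left_ideal_ideal_power] by blast
  \<comment> \<open>Loewy lengths are least positive exponents, so the candidate has to be positive;
    this rests on the index set being nonempty.\<close>
  moreover have "0 < ?l"
  proof -
    obtain i where i: "i \<in> I"
      using I by blast
    interpret A': cring "A' i" by (rule A'[OF i])
    have "0 < loewy_length (A' i)"
      by (rule A'.loewy_length(1)[OF A'(2)[OF i]])
    also have "\<dots> \<le> ?l"
      using I i by (intro Max_ge) auto
    finally show ?thesis .
  qed
  ultimately show ?thesis
    unfolding loewy_length_def by (intro Least_le) auto
qed

section \<open>Rings of functions\<close>

lemma sum_fun_apply: "(\<Sum>i\<in>I. f i :: 'a \<Rightarrow> 'b::comm_monoid_add) x = (\<Sum>i\<in>I. f i x)"
  by (induction I rule: infinite_finite_induct) auto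

interpretation fun_vs: vector_space "\<lambda>(c::'k::field) (f::'x \<Rightarrow> 'k) x. c * f x"
  by unfold_locales (auto simp: fun_eq_iff algebra_simps)

lemma fun_vs_span_delta:
  assumes "finite X" "\<And>x. x \<notin> X \<Longrightarrow> f x = 0"
  shows "(f :: 'x \<Rightarrow> 'k::field) \<in> fun_vs.span ((\<lambda>y x. if x = y then 1 else 0) ` X)"
proof -
  have "f = (\<Sum>y\<in>X. (\<lambda>x. f y * (if x = y then 1 else 0)))"
    using assms by (auto simp: fun_eq_iff sum_fun_apply if_distrib cong: if_cong)
  also have "\<dots> \<in> fun_vs.span ((\<lambda>y x. if x = y then 1 else 0) ` X)"
    by (intro fun_vs.span_sum fun_vs.span_scale fun_vs.span_base) auto
  finally show ?thesis .
qed

lemma fun_vs_independent_bound: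
  fixes S :: "('x \<Rightarrow> 'k::field) set"
  assumes "finite X" "fun_vs.independent S" "\<And>f x. f \<in> S \<Longrightarrow> x \<notin> X \<Longrightarrow> f x = 0"
  shows "finite S" "card S \<le> card X"
proof -
  let ?T = "(\<lambda>y x. if x = y then 1 else 0) ` X :: ('x \<Rightarrow> 'k) set"
  have "S \<subseteq> fun_vs.span ?T"
    using fun_vs_span_delta assms by blast
  then have *: "finite S" "card S \<le> card ?T"
    using fun_vs.independent_span_bound[of ?T S] assms by auto
  then show "finite S" "card S \<le> card X"
    using card_image_le[OF assms(1), of "\<lambda>y x. if x = y then 1 else 0 :: 'k"] by auto
qed

text \<open>The ambient function space may be infinite dimensional. Finiteness of the bases comes
  from the common finite support \<open>X\<close>, and extending a basis of \<open>L\<close> to one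
  of \<open>L'\<close> adds at least one vector.\<close>

lemma fun_vs_dim_strict_mono:
  fixes L L' :: "('x \<Rightarrow> 'k::field) set"
  assumes X: "finite X" "\<And>f x. f \<in> L' \<Longrightarrow> x \<notin> X \<Longrightarrow> f x = 0"
    and L: "fun_vs.subspace L" "L \<subset> L'"
  shows "fun_vs.dim L < fun_vs.dim L'"
proof -
  obtain C where C: "C \<subseteq> L" "fun_vs.independent C" "L \<subseteq> fun_vs.span C" "card C = fun_vs.dim L"
    by (rule fun_vs.basis_exists)
  obtain C' where C': "C \<subseteq> C'" "C' \<subseteq> L'" "fun_vs.independent C'" "L' \<subseteq> fun_vs.span C'"
    using fun_vs.maximal_independent_subset_extend[of C L'] C L by blast
  have "fun_vs.span C \<subseteq> L"
    using C(1) L(1) by (rule fun_vs.span_minimal)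
  then have "C \<subset> C'"
    using C' L(2) by blast
  moreover have "finite C'"
    using C' X by (intro fun_vs_independent_bound(1)[of X]) auto
  ultimately show ?thesis
    using C(4) fun_vs.basis_card_eq_dim[OF C'(2,4,3)] by (metis psubset_card_mono)
qed

lemma fun_vs_linear_dependence:
  fixes v :: "nat \<Rightarrow> 'x \<Rightarrow> 'k::field"
  assumes X: "finite X" "\<And>i x. x \<notin> X \<Longrightarrow> v i x = 0"
  obtains c n where "c n \<noteq> (0::'k)" "n \<le> card X" "\<And>x. (\<Sum>i\<le>card X. c i * v i x) = 0"
proof -
  let ?N = "card X"
  show thesis
  proof (cases "inj_on v {..?N}")
    case True
    have "fun_vs.dependent (v ` {..?N})"
    proof (rule ccontr)
      assume "fun_vs.independent (v ` {..?N})"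
      then have "card (v ` {..?N}) \<le> ?N"
        using X by (intro fun_vs_independent_bound(2)) auto
      then show False
        using card_image[OF True] by simp
    qed
    then obtain u where u: "\<exists>f\<in>v ` {..?N}. u f \<noteq> 0" "(\<Sum>f\<in>v ` {..?N}. (\<lambda>x. u f * f x)) = 0"
      by (subst (asm) fun_vs.dependent_finite) auto
    have "(\<Sum>i\<le>?N. u (v i) * v i x) = 0" for x
      using fun_cong[OF u(2), of x] by (simp add: sum_fun_apply sum.reindex[OF True])
    then show thesis
      using u(1) that[of "\<lambda>i. u (v i)"] by auto
  next
    \<comment> \<open>Repeated vectors collapse in the image set, whose independence then says
      nothing; the relation \<open>v i - v j = 0\<close> is written down directly.\<close>
    case False
    then obtain i j where ij: "i \<le> ?N" "j \<le> ?N" "i \<noteq> j" "v i = v j"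
      by (auto simp: inj_on_def)
    have "(\<Sum>l\<le>?N. (if l = i then 1 else if l = j then - 1 else 0) * v l x) = 0" for x
    proof -
      have "(\<Sum>l\<le>?N. (if l = i then 1 else if l = j then - 1 else 0) * v l x) =
          (\<Sum>l\<le>?N. (if l = i then v l x else 0) - (if l = j then v l x else 0))"
        using ij(3) by (intro sum.cong) auto
      then show ?thesis
        using ij by (simp add: sum_subtractf)
    qed
    then show thesis
      using ij by (intro that[of "\<lambda>l. if l = i then 1 else if l = j then - 1 else 0" i]) auto
  qed
qed

text \<open>The condition on scalars says that scaling is a left multiplication, so left ideals are
  subspaces and the dimension is a measure. This covers blocks and their centers alike.\<close>

lemma finite_length_functions:
  fixes A :: "('x \<Rightarrow> 'k::field, 'm) ring_scheme"
  assumes "ring A" "finite X" "\<And>f x. f \<in> carrier A \<Longrightarrow> x \<notin> X \<Longrightarrow> f x = 0"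
    and add: "\<And>f g. f \<oplus>\<^bsub>A\<^esub> g = (\<lambda>x. f x + g x)" and zero: "\<zero>\<^bsub>A\<^esub> = (\<lambda>x. 0)"
    and scale: "\<And>c f. f \<in> carrier A \<Longrightarrow> \<exists>d\<in>carrier A. d \<otimes>\<^bsub>A\<^esub> f = (\<lambda>x. c * f x)"
  shows "finite_length A"
proof -
  interpret A: ring A by (rule assms(1))
  have subspace: "fun_vs.subspace L" if L: "left_ideal L A" for L
    unfolding fun_vs.subspace_def
  proof (intro conjI ballI allI)
    show "0 \<in> L"
      using A.left_idealD(2)[OF L] by (simp add: zero zero_fun_def)
    show "f + g \<in> L" if "f \<in> L" "g \<in> L" for f g
      using A.left_idealD(3)[OF L that] by (simp add: add plus_fun_def)
    show "(\<lambda>x. c * f x) \<in> L" if "f \<in> L" for c f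
      using scale[OF A.left_idealD(7)[OF L that], of c] A.left_idealD(4)[OF L _ that] by metis
  qed
  have "fun_vs.dim L < fun_vs.dim L'" if "left_ideal L A" "left_ideal L' A" "L \<subset> L'" for L L'
    using that assms(2,3) A.left_idealD(7)[OF that(2)]
    by (intro fun_vs_dim_strict_mono[of X] subspace) auto
  then show ?thesis
    unfolding finite_length_def by blast
qed

section \<open>Group algebras\<close>

text \<open>Orbits under \<open>\<sigma>\<close> have \<open>p\<close>-power length, so an orbit
  without fixed points contributes a multiple of \<open>p\<close>, that is zero. Such orbits are
  removed from \<open>X\<close> one after the other.\<close>

lemma sum_eq_sum_fixed_points:
  fixes h :: "'x \<Rightarrow> 'k::comm_ring_1"
  assumes p: "CHAR('k) = p" "prime p"
    and X: "finite X" "\<And>x. x \<in> X \<Longrightarrow> \<sigma> x \<in> X" "\<And>x. x \<in> X \<Longrightarrow> (\<sigma> ^^ (p ^ n)) x = x"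
    and h: "\<And>x. x \<in> X \<Longrightarrow> h (\<sigma> x) = h x"
  shows "sum h X = sum h {x \<in> X. \<sigma> x = x}"
  using X h
proof (induction X rule: finite_psubset_induct)
  case (psubset X)
  show ?case
  proof (cases "\<forall>x\<in>X. \<sigma> x = x")
    case True
    then show ?thesis
      by (intro sum.cong) auto
  next
    case False
    then obtain x where x: "x \<in> X" "\<sigma> x \<noteq> x"
      by blast
    have iter: "(\<sigma> ^^ i) x \<in> X" "h ((\<sigma> ^^ i) x) = h x" for i
      by (induction i) (use x psubset.prems in auto)
    define Ob where "Ob = range (\<lambda>i. (\<sigma> ^^ i) x)"
    define d where "d = (LEAST d. 0 < d \<and> (\<sigma> ^^ d) x = x)"
    have "0 < p ^ n"
      using p(2) by (simp add: prime_gt_0_nat)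
    then have d: "0 < d" "(\<sigma> ^^ d) x = x"
      using LeastI[of "\<lambda>d. 0 < d \<and> (\<sigma> ^^ d) x = x" "p ^ n"] psubset.prems(2) x
      unfolding d_def by auto
    have d_least: "\<not> (0 < i \<and> (\<sigma> ^^ i) x = x)" if "i < d" for i
      using not_less_Least[of i "\<lambda>d. 0 < d \<and> (\<sigma> ^^ d) x = x"] that unfolding d_def by blast
    have "(\<sigma> ^^ (p ^ n mod d)) x = x"
      using funpow_mod_eq[of d \<sigma> x, OF d(2)] psubset.prems(2)[OF x(1)] by simp
    then have "d dvd p ^ n"
      using d_least[of "p ^ n mod d"] d(1) by (auto simp: dvd_eq_mod_eq_0)
    moreover have "d \<noteq> 1"
      using d(2) x(2) by auto
    ultimately have "p dvd d"
      using p(2) by (metis divides_primepow_nat dvd_power gr0I power_0)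
    have Ob_eq: "Ob = (\<lambda>i. (\<sigma> ^^ i) x) ` {..<d}"
    proof
      show "Ob \<subseteq> (\<lambda>i. (\<sigma> ^^ i) x) ` {..<d}"
      proof
        fix y assume "y \<in> Ob"
        then obtain i where "y = (\<sigma> ^^ i) x"
          by (auto simp: Ob_def)
        then have "y = (\<sigma> ^^ (i mod d)) x"
          using funpow_mod_eq[of d \<sigma> x, OF d(2)] by simp
        then show "y \<in> (\<lambda>i. (\<sigma> ^^ i) x) ` {..<d}"
          using d(1) by (intro image_eqI[of _ _ "i mod d"]) auto
      qed
    qed (auto simp: Ob_def)
    have inj: "i = j" if "i \<le> j" "j < d" "(\<sigma> ^^ i) x = (\<sigma> ^^ j) x" for i j
    proof -
      have "(\<sigma> ^^ (d - j + i)) x = (\<sigma> ^^ (d - j + j)) x"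
        using that(3) by (simp add: funpow_add)
      then have "(\<sigma> ^^ (d - j + i)) x = x"
        using d(2) that(2) by simp
      then show ?thesis
        using d_least[of "d - j + i"] that(1,2) by linarith
    qed
    have "inj_on (\<lambda>i. (\<sigma> ^^ i) x) {..<d}"
      by (rule inj_onI) (metis inj lessThan_iff nle_le)
    then have "card Ob = d"
      by (simp add: Ob_eq card_image)
    have "sum h Ob = (\<Sum>y\<in>Ob. h x)"
      using iter(2) by (intro sum.cong) (auto simp: Ob_def)
    also have "\<dots> = of_nat d * h x"
      using \<open>card Ob = d\<close> by simp
    also have "\<dots> = 0"
      using \<open>p dvd d\<close> p(1) by (auto simp: of_nat_eq_0_iff_char_dvd)
    finally have sum_Ob: "sum h Ob = 0" .
    have Ob_sub: "Ob \<subseteq> X"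
      using iter(1) by (auto simp: Ob_def)
    have x_Ob: "x \<in> Ob"
      unfolding Ob_def by (rule range_eqI[of _ _ 0]) simp
    \<comment> \<open>The complement of the orbit must be stable under \<open>\<sigma>\<close>. The
      iterate of order \<open>p ^ n - 1\<close> inverts \<open>\<sigma>\<close>, so a point mapped
      into the orbit was already there.\<close>
    have pre_Ob: "y \<in> Ob" if y: "y \<in> X" "\<sigma> y \<in> Ob" for y
    proof -
      obtain i where "\<sigma> y = (\<sigma> ^^ i) x"
        using y(2) by (auto simp: Ob_def)
      moreover obtain m where m: "p ^ n = Suc m"
        using \<open>0 < p ^ n\<close> gr0_conv_Suc by blast
      ultimately have "(\<sigma> ^^ (p ^ n)) y = (\<sigma> ^^ (m + i)) x"
        by (simp add: m funpow_add funpow_swap1)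
      then show ?thesis
        using psubset.prems(2)[OF y(1)] by (auto simp: Ob_def)
    qed
    have "sum h (X - Ob) = sum h {y \<in> X - Ob. \<sigma> y = y}"
    proof (rule psubset.IH)
      show "X - Ob \<subset> X"
        using Ob_sub x_Ob by blast
      show "\<sigma> y \<in> X - Ob" if "y \<in> X - Ob" for y
        using that pre_Ob psubset.prems(1) by blast
    qed (use psubset.prems in auto)
    \<comment> \<open>A fixed point in the orbit would be carried to \<open>x\<close> by the
      remaining \<open>d - i\<close> steps and hence equal \<open>x\<close>, which moves. So
      removing the orbit leaves the set of fixed points unchanged.\<close>
    moreover have "\<sigma> y \<noteq> y" if y: "y \<in> Ob" for y
    proof
      assume fixed: "\<sigma> y = y"
      obtain i where i: "i < d" "y = (\<sigma> ^^ i) x"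
        using y unfolding Ob_eq by blast
      have "(\<sigma> ^^ k) y = y" for k
        using fixed by (induction k) auto
      moreover have "(\<sigma> ^^ (d - i)) y = (\<sigma> ^^ (d - i + i)) x"
        unfolding i(2) by (simp add: funpow_add)
      ultimately have "y = x"
        using i(1) d(2) by simp
      then show False
        using fixed x(2) by simp
    qed
    then have "{y \<in> X - Ob. \<sigma> y = y} = {y \<in> X. \<sigma> y = y}"
      by blast
    moreover have "sum h X = sum h (X - Ob) + sum h Ob"
      using sum.subset_diff[OF Ob_sub psubset.hyps] .
    ultimately show ?thesis
      using sum_Ob by simp
  qed
qed

lemma funpow_rotate1_length: "(rotate1 ^^ length xs) xs = xs"
  by (metis rotate_def rotate_conv_mod rotate_id mod_self)

lemma rotate1_eq_self_iff:
  assumes "xs \<noteq> []"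
  shows "rotate1 xs = xs \<longleftrightarrow> xs = replicate (length xs) (hd xs)"
proof
  assume "rotate1 xs = xs"
  then have "card (set xs) = 1"
    using rotate1_fixpoint_card[of xs] assms by blast
  then have "set xs = {hd xs}"
    by (metis assms card_1_singletonE hd_in_set singletonD)
  then show "xs = replicate (length xs) (hd xs)"
    by (intro replicate_eqI) auto
next
  assume "xs = replicate (length xs) (hd xs)"
  then show "rotate1 xs = xs"
    by (metis length_rotate1 list.size(3) replicate_eqI rotate1_replicate)
qed

locale finite_group = group +
  assumes finite_carrier [simp]: "finite (carrier G)"
begin

lemma inv_cancel [simp]:
  assumes "x \<in> carrier G" "y \<in> carrier G"
  shows "inv x \<otimes> (x \<otimes> y) = y" "x \<otimes> (inv x \<otimes> y) = y" "y \<otimes> x \<otimes> inv x = y" "y \<otimes> inv x \<otimes> x = y"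
  using assms by (simp_all add: m_assoc flip: m_assoc[of "inv x" x] m_assoc[of x "inv x"])

lemma sum_inv: "(\<Sum>x\<in>carrier G. f (inv x)) = (\<Sum>x\<in>carrier G. f x)"
  by (rule sum.reindex_bij_witness[of _ "\<lambda>x. inv x" "\<lambda>x. inv x"]) auto

end

lemma group_algebra_simps:
  "a \<in> carrier (group_algebra G) \<longleftrightarrow> (\<forall>g. g \<notin> carrier G \<longrightarrow> a g = 0)"
  "\<one>\<^bsub>group_algebra G\<^esub> = (\<lambda>g. if g = \<one>\<^bsub>G\<^esub> then 1 else 0)"
  "\<zero>\<^bsub>group_algebra G\<^esub> = (\<lambda>g. 0)"
  "a \<oplus>\<^bsub>group_algebra G\<^esub> a' = (\<lambda>g. a g + a' g)"
  "c \<odot>\<^bsub>group_algebra G\<^esub> a = (\<lambda>g. c * a g)"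
  by (auto simp: group_algebra_def)

abbreviation (input) galg_mult ("_ \<otimes>\<^sub>F\<index> _" [71, 70] 70)
  where "galg_mult G a a' \<equiv> a \<otimes>\<^bsub>group_algebra G\<^esub> a'"

context finite_group
begin

lemma group_algebra_mult:
  "(a \<otimes>\<^sub>F a') g = (if g \<in> carrier G then \<Sum>x\<in>carrier G. a x * a' (inv x \<otimes> g) else 0)"
proof (cases "g \<in> carrier G")
  case True
  have "(\<Sum>(x, y) \<in> {(x, y) \<in> carrier G \<times> carrier G. x \<otimes> y = g}. a x * a' y) =
      (\<Sum>x\<in>carrier G. a x * a' (inv x \<otimes> g))"
    by (rule sum.reindex_bij_witness[of _ "\<lambda>x. (x, inv x \<otimes> g)" fst])
      (use True in \<open>auto simp: inv_solve_left'\<close>)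
  then show ?thesis
    using True by (simp add: group_algebra_def)
next
  case False
  then have empty: "{(x, y) \<in> carrier G \<times> carrier G. x \<otimes> y = g} = {}"
    by auto
  have "(a \<otimes>\<^sub>F a') g = (\<Sum>(x, y) \<in> {(x, y) \<in> carrier G \<times> carrier G. x \<otimes> y = g}. a x * a' y)"
    by (simp add: group_algebra_def)
  then show ?thesis
    unfolding empty using False by simp
qed

lemma group_algebra_mult':
  "(a \<otimes>\<^sub>F a') g = (if g \<in> carrier G then \<Sum>y\<in>carrier G. a (g \<otimes> inv y) * a' y else 0)"
proof (cases "g \<in> carrier G")
  case True
  have "(\<Sum>x\<in>carrier G. a x * a' (inv x \<otimes> g)) = (\<Sum>y\<in>carrier G. a (g \<otimes> inv y) * a' y)"
    by (rule sum.reindex_bij_witness[of _ "\<lambda>y. g \<otimes> inv y" "\<lambda>x. inv x \<otimes> g"])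
      (use True in \<open>auto simp: inv_mult_group m_assoc inv_solve_right\<close>)
  then show ?thesis
    using True by (simp add: group_algebra_mult)
qed (simp add: group_algebra_mult)

lemma ring_group_algebra: "ring (group_algebra G :: ('k::field, 'a \<Rightarrow> 'k) module)"
proof (rule ringI)
  let ?A = "group_algebra G :: ('k, 'a \<Rightarrow> 'k) module"
  show "abelian_group ?A"
  proof (rule abelian_groupI)
    show "\<exists>y\<in>carrier ?A. y \<oplus>\<^bsub>?A\<^esub> x = \<zero>\<^bsub>?A\<^esub>" if "x \<in> carrier ?A" for x
      using that by (intro bexI[of _ "\<lambda>g. - x g"]) (auto simp: group_algebra_simps)
  qed (auto simp: group_algebra_simps add_ac)
  show "monoid ?A"
  proof
    show "x \<otimes>\<^sub>F y \<in> carrier ?A" for x y :: "'a \<Rightarrow> 'k"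
      by (simp add: group_algebra_simps group_algebra_mult)
    show "\<one>\<^bsub>?A\<^esub> \<in> carrier ?A"
      by (auto simp: group_algebra_simps)
    show "\<one>\<^bsub>?A\<^esub> \<otimes>\<^sub>F x = x" if "x \<in> carrier ?A" for x
    proof
      fix g
      have "(\<Sum>y\<in>carrier G. (if y = \<one> then 1 else 0) * x (inv y \<otimes> g)) =
          (\<Sum>y\<in>carrier G. if y = \<one> then x (inv y \<otimes> g) else 0)"
        by (intro sum.cong) auto
      then show "(\<one>\<^bsub>?A\<^esub> \<otimes>\<^sub>F x) g = x g"
        using that by (simp add: group_algebra_mult group_algebra_simps)
    qed
    show "x \<otimes>\<^sub>F \<one>\<^bsub>?A\<^esub> = x" if "x \<in> carrier ?A" for x
    proof
      fix g
      have "(\<Sum>y\<in>carrier G. x (g \<otimes> inv y) * (if y = \<one> then 1 else 0)) =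
          (\<Sum>y\<in>carrier G. if y = \<one> then x (g \<otimes> inv y) else 0)"
        by (intro sum.cong) auto
      then show "(x \<otimes>\<^sub>F \<one>\<^bsub>?A\<^esub>) g = x g"
        using that by (simp add: group_algebra_mult' group_algebra_simps)
    qed
    show "(x \<otimes>\<^sub>F y) \<otimes>\<^sub>F z = x \<otimes>\<^sub>F (y \<otimes>\<^sub>F z)" for x y z :: "'a \<Rightarrow> 'k"
    proof
      fix g
      show "((x \<otimes>\<^sub>F y) \<otimes>\<^sub>F z) g = (x \<otimes>\<^sub>F (y \<otimes>\<^sub>F z)) g"
      proof (cases "g \<in> carrier G")
        case True
        have "((x \<otimes>\<^sub>F y) \<otimes>\<^sub>F z) g =
            (\<Sum>w\<in>carrier G. \<Sum>v\<in>carrier G. x v * (y (inv v \<otimes> (g \<otimes> inv w)) * z w))"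
          using True by (subst group_algebra_mult')
            (simp add: group_algebra_mult sum_distrib_left sum_distrib_right mult_ac)
        also have "\<dots> = (\<Sum>v\<in>carrier G. x v * (\<Sum>w\<in>carrier G. y ((inv v \<otimes> g) \<otimes> inv w) * z w))"
          using True by (subst sum.swap) (simp add: sum_distrib_left m_assoc)
        also have "\<dots> = (\<Sum>v\<in>carrier G. x v * (y \<otimes>\<^sub>F z) (inv v \<otimes> g))"
          using True by (intro sum.cong refl) (simp add: group_algebra_mult'[of y z])
        also have "\<dots> = (x \<otimes>\<^sub>F (y \<otimes>\<^sub>F z)) g"
          using True by (simp add: group_algebra_mult[of x])
        finally show ?thesis .
      qed (simp add: group_algebra_mult)
    qed
  qed
  show "(x \<oplus>\<^bsub>?A\<^esub> y) \<otimes>\<^sub>F z = (x \<otimes>\<^sub>F z) \<oplus>\<^bsub>?A\<^esub> (y \<otimes>\<^sub>F z)" for x y z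
    by (rule ext) (simp add: group_algebra_mult group_algebra_simps distrib_right sum.distrib)
  show "z \<otimes>\<^sub>F (x \<oplus>\<^bsub>?A\<^esub> y) = (z \<otimes>\<^sub>F x) \<oplus>\<^bsub>?A\<^esub> (z \<otimes>\<^sub>F y)" for x y z
    by (rule ext) (simp add: group_algebra_mult group_algebra_simps distrib_left sum.distrib)
qed

lemma group_algebra_smult_mult:
  "c \<odot>\<^bsub>group_algebra G\<^esub> (x \<otimes>\<^sub>F y) = (c \<odot>\<^bsub>group_algebra G\<^esub> x) \<otimes>\<^sub>F y"
  "c \<odot>\<^bsub>group_algebra G\<^esub> (x \<otimes>\<^sub>F y) = x \<otimes>\<^sub>F (c \<odot>\<^bsub>group_algebra G\<^esub> y)"
  by (rule ext, simp add: group_algebra_mult group_algebra_simps sum_distrib_left mult_ac)+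

lemma mult_delta_right:
  assumes "g \<in> carrier G"
  shows "(a \<otimes>\<^sub>F (\<lambda>h. if h = g then 1 else 0)) h = (if h \<in> carrier G then a (h \<otimes> inv g) else 0)"
proof -
  have "(\<Sum>y\<in>carrier G. a (h \<otimes> inv y) * (if y = g then 1 else 0)) =
      (\<Sum>y\<in>carrier G. if y = g then a (h \<otimes> inv y) else 0)"
    by (intro sum.cong) auto
  then show ?thesis
    using assms by (simp add: group_algebra_mult')
qed

lemma mult_delta_left:
  assumes "g \<in> carrier G"
  shows "((\<lambda>h. if h = g then 1 else 0) \<otimes>\<^sub>F a) h = (if h \<in> carrier G then a (inv g \<otimes> h) else 0)"
proof -
  have "(\<Sum>y\<in>carrier G. (if y = g then 1 else 0) * a (inv y \<otimes> h)) =
      (\<Sum>y\<in>carrier G. if y = g then a (inv y \<otimes> h) else 0)"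
    by (intro sum.cong) auto
  then show ?thesis
    using assms by (simp add: group_algebra_mult)
qed

lemma center_group_algebra_iff:
  fixes z :: "'a \<Rightarrow> 'k::field"
  shows "z \<in> center (group_algebra G) \<longleftrightarrow> z \<in> carrier (group_algebra G) \<and>
    (\<forall>x\<in>carrier G. \<forall>y\<in>carrier G. z (x \<otimes> y) = z (y \<otimes> x))" (is "?L \<longleftrightarrow> ?R")
proof
  assume L: ?L
  have "z (x \<otimes> y) = z (y \<otimes> x)" if "x \<in> carrier G" "y \<in> carrier G" for x y
  proof -
    \<comment> \<open>Multiplying by the basis element of \<open>inv y\<close> and reading off the
      coefficient at \<open>x\<close> gives \<open>z (x y)\<close> on one side and
      \<open>z (y x)\<close> on the other.\<close>
    let ?d = "\<lambda>h. if h = inv y then 1 else 0 :: 'k"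
    have "?d \<in> carrier (group_algebra G)"
      using that by (auto simp: group_algebra_simps)
    then have "(z \<otimes>\<^sub>F ?d) x = (?d \<otimes>\<^sub>F z) x"
      using L by (simp add: center_def)
    then show ?thesis
      using that by (simp add: mult_delta_left mult_delta_right)
  qed
  then show ?R
    using L by (auto simp: center_def)
next
  assume R: ?R
  have "z \<otimes>\<^sub>F a = a \<otimes>\<^sub>F z" for a
  proof
    fix g
    have "(\<Sum>y\<in>carrier G. z (g \<otimes> inv y) * a y) = (\<Sum>y\<in>carrier G. a y * z (inv y \<otimes> g))" if "g \<in> carrier G"
      using that R by (intro sum.cong) auto
    then show "(z \<otimes>\<^sub>F a) g = (a \<otimes>\<^sub>F z) g"
      by (simp add: group_algebra_mult'[of z] group_algebra_mult[of a])
  qed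
  then show ?L
    using R by (simp add: center_def)
qed

lemma coeff_one_mult: "(a \<otimes>\<^sub>F a') \<one> = (\<Sum>x\<in>carrier G. a x * a' (inv x))"
  by (simp add: group_algebra_mult)

text \<open>The coefficient at the identity is the symmetrizing form of the group algebra. Its
  symmetry makes it a trace for elements of the socle; its nondegeneracy, below, detects
  annihilation of the radical.\<close>

lemma coeff_one_commute: "(a \<otimes>\<^sub>F a') \<one> = (a' \<otimes>\<^sub>F a) \<one>"
  unfolding coeff_one_mult by (subst sum_inv[symmetric]) (simp add: mult.commute)

lemma coeff_one_nondegenerate:
  assumes "a \<in> carrier (group_algebra G)" "\<And>y. y \<in> carrier (group_algebra G) \<Longrightarrow> (a \<otimes>\<^sub>F y) \<one> = 0"
  shows "a = \<zero>\<^bsub>group_algebra G\<^esub>"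
proof
  fix g
  show "a g = \<zero>\<^bsub>group_algebra G\<^esub> g"
  proof (cases "g \<in> carrier G")
    case True
    let ?d = "\<lambda>h. if h = inv g then 1 else 0"
    have "?d \<in> carrier (group_algebra G)"
      using True by (auto simp: group_algebra_simps)
    then show ?thesis
      using assms(2)[of ?d] True by (simp add: mult_delta_right group_algebra_simps)
  qed (use assms(1) in \<open>auto simp: group_algebra_simps\<close>)
qed

text \<open>Indexing the terms by lists of factors makes cyclic rotation available. The set
  \<open>K\<close> only has to contain the support of \<open>a\<close>, so it may be the whole group
  or the powers of one element.\<close>

lemma group_algebra_pow:
  assumes a: "a \<in> carrier (group_algebra G)" "K \<subseteq> carrier G" "\<And>x. x \<notin> K \<Longrightarrow> a x = 0"
    and g: "g \<in> carrier G"
  shows "(a [^]\<^bsub>group_algebra G\<^esub> n) g =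
    (\<Sum>xs | set xs \<subseteq> K \<and> length xs = n \<and> foldr (\<otimes>) xs \<one> = g. prod_list (map a xs))"
  using g
proof (induction n arbitrary: g)
  case 0
  have "{xs :: 'a list. set xs \<subseteq> K \<and> length xs = 0 \<and> foldr (\<otimes>) xs \<one> = g} = (if g = \<one> then {[]} else {})"
    by auto
  then show ?case
    by (simp add: group_algebra_simps)
next
  case (Suc n)
  interpret A: ring "group_algebra G" by (rule ring_group_algebra)
  let ?S = "\<lambda>n g. {xs. set xs \<subseteq> K \<and> length xs = n \<and> foldr (\<otimes>) xs \<one> = g}"
  have finite_K: "finite K"
    using a(2) finite_subset finite_carrier by blast
  have finite: "finite (?S n g)" for n g
    by (rule finite_subset[OF _ finite_lists_length_eq[OF finite_K, of n]]) auto
  have in_carrier: "foldr (\<otimes>) xs \<one> \<in> carrier G" if "set xs \<subseteq> K" for xs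
    using that a(2) by (induction xs) auto
  have "(a [^]\<^bsub>group_algebra G\<^esub> Suc n) g = (a \<otimes>\<^sub>F (a [^]\<^bsub>group_algebra G\<^esub> n)) g"
    using A.nat_pow_Suc2[OF a(1)] by simp
  also have "\<dots> = (\<Sum>x\<in>carrier G. a x * (a [^]\<^bsub>group_algebra G\<^esub> n) (inv x \<otimes> g))"
    using Suc.prems by (simp add: group_algebra_mult)
  also have "\<dots> = (\<Sum>x\<in>K. a x * (a [^]\<^bsub>group_algebra G\<^esub> n) (inv x \<otimes> g))"
    using a by (intro sum.mono_neutral_right) auto
  also have "\<dots> = (\<Sum>x\<in>K. \<Sum>xs\<in>?S n (inv x \<otimes> g). a x * prod_list (map a xs))"
    using a(2) Suc.prems by (intro sum.cong refl) (subst Suc.IH, auto simp: sum_distrib_left)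
  also have "\<dots> = (\<Sum>(x, xs)\<in>(SIGMA x:K. ?S n (inv x \<otimes> g)). a x * prod_list (map a xs))"
    using finite finite_K by (intro sum.Sigma) auto
  also have "\<dots> = (\<Sum>xs\<in>?S (Suc n) g. prod_list (map a xs))"
    by (rule sum.reindex_bij_witness[of _ "\<lambda>xs. (hd xs, tl xs)" "\<lambda>(x, xs). x # xs"])
      (use a(2) Suc.prems in_carrier in \<open>auto simp: length_Suc_conv subset_iff inv_solve_left\<close>)
  finally show ?case .
qed

text \<open>Rotating the factors of a product permutes the terms of a \<open>p\<close>-power; only constant lists are fixed.\<close>

lemma sum_pow_CHAR:
  fixes a :: "'a \<Rightarrow> 'k::field"
  assumes p: "CHAR('k) = p" "prime p"
    and K: "K \<subseteq> carrier G" "\<one> \<in> K" "\<And>x y. x \<in> K \<Longrightarrow> y \<in> K \<Longrightarrow> x \<otimes> y \<in> K"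
    and a: "a \<in> carrier (group_algebra G)" "\<And>x. x \<notin> K \<Longrightarrow> a x = 0"
    and H: "H \<subseteq> carrier G" "\<And>x y. x \<in> K \<Longrightarrow> y \<in> K \<Longrightarrow> x \<otimes> y \<in> H \<Longrightarrow> y \<otimes> x \<in> H"
  shows "(\<Sum>h\<in>H. (a [^]\<^bsub>group_algebra G\<^esub> (p ^ n)) h) = (\<Sum>x | x \<in> K \<and> x [^] (p ^ n) \<in> H. a x) ^ (p ^ n)"
proof -
  let ?q = "p ^ n"
  have q: "0 < ?q"
    using p(2) by (simp add: prime_gt_0_nat)
  let ?X = "{xs. set xs \<subseteq> K \<and> length xs = ?q \<and> foldr (\<otimes>) xs \<one> \<in> H}"
  let ?m = "\<lambda>xs. prod_list (map a xs)"
  have finite: "finite K" "finite H"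
    using K(1) H(1) finite_subset finite_carrier by blast+
  have finX: "finite ?X"
    by (rule finite_subset[OF _ finite_lists_length_eq[of K ?q]]) (use finite in auto)
  have prod_K: "foldr (\<otimes>) xs \<one> \<in> K" if "set xs \<subseteq> K" for xs
    using that K(2,3) by (induction xs) auto
  have prod_snoc: "foldr (\<otimes>) (xs @ [x]) \<one> = foldr (\<otimes>) xs \<one> \<otimes> x" if "set xs \<subseteq> K" "x \<in> K" for xs x
    using that
  proof (induction xs)
    case (Cons y ys)
    then have "foldr (\<otimes>) ys \<one> \<in> carrier G" "x \<in> carrier G" "y \<in> carrier G"
      using K(1) prod_K[of ys] by auto
    then show ?case
      using Cons by (simp add: m_assoc)
  qed (use K(1) in auto)
  have prod_replicate: "foldr (\<otimes>) (replicate k x) \<one> = x [^] k" if "x \<in> K" for x k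
    using that K(1) by (induction k) (simp, simp only: replicate_Suc foldr_Cons nat_pow_Suc2 o_apply subsetD)
  have "(\<Sum>h\<in>H. (a [^]\<^bsub>group_algebra G\<^esub> ?q) h) =
      (\<Sum>h\<in>H. \<Sum>xs | xs \<in> ?X \<and> foldr (\<otimes>) xs \<one> = h. ?m xs)"
  proof (rule sum.cong)
    fix h assume h: "h \<in> H"
    then have "{xs. xs \<in> ?X \<and> foldr (\<otimes>) xs \<one> = h} = {xs. set xs \<subseteq> K \<and> length xs = ?q \<and> foldr (\<otimes>) xs \<one> = h}"
      by auto
    then show "(a [^]\<^bsub>group_algebra G\<^esub> ?q) h = (\<Sum>xs | xs \<in> ?X \<and> foldr (\<otimes>) xs \<one> = h. ?m xs)"
      using group_algebra_pow[OF a(1) K(1) a(2), of h ?q] h H(1) by auto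
  qed simp
  also have "\<dots> = sum ?m ?X"
    using finX finite by (intro sum.group) auto
  also have "\<dots> = sum ?m {xs \<in> ?X. rotate1 xs = xs}"
  proof (rule sum_eq_sum_fixed_points[OF p finX, of rotate1 n])
    fix xs assume xs: "xs \<in> ?X"
    then obtain y ys where ys: "xs = y # ys"
      using q by (cases xs) auto
    \<comment> \<open>Rotation turns the product \<open>y w\<close> into \<open>w y\<close>; the
      symmetry condition on \<open>H\<close> keeps the product in \<open>H\<close>.\<close>
    show "rotate1 xs \<in> ?X"
      using xs H(2)[of y "foldr (\<otimes>) ys \<one>"] prod_K[of ys] prod_snoc[of ys y] by (auto simp: ys)
    show "(rotate1 ^^ ?q) xs = xs"
      using xs funpow_rotate1_length[of xs] by simp
    show "?m (rotate1 xs) = ?m xs"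
      by (simp add: ys mult.commute)
  qed
  also have "\<dots> = (\<Sum>x | x \<in> K \<and> x [^] ?q \<in> H. a x ^ ?q)"
  proof (rule sum.reindex_bij_witness[of _ "replicate ?q" hd])
    fix xs assume xs: "xs \<in> {xs \<in> ?X. rotate1 xs = xs}"
    then have "xs \<noteq> []"
      using q by auto
    then have eq: "xs = replicate ?q (hd xs)" and hd: "hd xs \<in> K"
      using xs rotate1_eq_self_iff[of xs] by auto
    show "replicate ?q (hd xs) = xs"
      using eq by simp
    have "hd xs [^] ?q \<in> H"
      using xs prod_replicate[OF hd, of ?q] eq by auto
    then show "hd xs \<in> {x. x \<in> K \<and> x [^] ?q \<in> H}"
      using hd by blast
    show "a (hd xs) ^ ?q = ?m xs"
      by (subst (2) eq) (simp add: prod_list_replicate)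
  next
    fix x assume x: "x \<in> {x. x \<in> K \<and> x [^] ?q \<in> H}"
    then show "hd (replicate ?q x) = x" "replicate ?q x \<in> {xs \<in> ?X. rotate1 xs = xs}"
      using q prod_replicate[of x ?q] by auto
  qed
  also have "\<dots> = (\<Sum>x | x \<in> K \<and> x [^] ?q \<in> H. a x) ^ ?q"
    using p by (intro freshmans_dream_sum'[symmetric]) auto
  finally show ?thesis .
qed

end

section \<open>Central idempotents and blocks\<close>

definition central_idempotent :: "('a, 'm) ring_scheme \<Rightarrow> 'a \<Rightarrow> bool"
  where "central_idempotent A e \<longleftrightarrow> e \<in> center A \<and> e \<otimes>\<^bsub>A\<^esub> e = e"

text \<open>For a central idempotent this is the ideal \<open>e A = e A e\<close>, described by an
  equation so that membership is immediate to use.\<close>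

definition corner :: "('a, 'm) ring_scheme \<Rightarrow> 'a \<Rightarrow> 'a set"
  where "corner A e = {x \<in> carrier A. e \<otimes>\<^bsub>A\<^esub> x = x}"

context ring
begin

lemma center_carrier: "z \<in> center R \<Longrightarrow> z \<in> carrier R"
  and center_commute: "z \<in> center R \<Longrightarrow> x \<in> carrier R \<Longrightarrow> z \<otimes> x = x \<otimes> z"
  by (auto simp: center_def)

lemma center_closed:
  "\<zero> \<in> center R" "\<one> \<in> center R"
  "x \<in> center R \<Longrightarrow> y \<in> center R \<Longrightarrow> x \<oplus> y \<in> center R"
  "x \<in> center R \<Longrightarrow> \<ominus> x \<in> center R"
  "x \<in> center R \<Longrightarrow> y \<in> center R \<Longrightarrow> x \<ominus> y \<in> center R"
  "x \<in> center R \<Longrightarrow> y \<in> center R \<Longrightarrow> x \<otimes> y \<in> center R"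
proof -
  show "x \<otimes> y \<in> center R" if xy: "x \<in> center R" "y \<in> center R"
  proof -
    note [simp] = center_carrier[OF xy(1)] center_carrier[OF xy(2)]
    have "x \<otimes> y \<otimes> w = w \<otimes> (x \<otimes> y)" if w: "w \<in> carrier R" for w
    proof -
      have "x \<otimes> y \<otimes> w = x \<otimes> (w \<otimes> y)"
        using w center_commute[OF xy(2) w] by (simp add: m_assoc)
      also have "\<dots> = w \<otimes> x \<otimes> y"
        using w center_commute[OF xy(1) w] by (simp flip: m_assoc)
      finally show ?thesis
        using w by (simp add: m_assoc)
    qed
    then show ?thesis
      by (simp add: center_def)
  qed
qed (auto simp: center_def l_distr r_distr l_minus r_minus a_minus_def)

lemma central_idempotentD:
  assumes "central_idempotent R e"
  shows "e \<in> center R" "e \<in> carrier R" "e \<otimes> e = e"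
    "x \<in> carrier R \<Longrightarrow> e \<otimes> x = x \<otimes> e" "x \<in> carrier R \<Longrightarrow> e \<otimes> (e \<otimes> x) = e \<otimes> x"
proof -
  show c: "e \<in> center R" "e \<in> carrier R" and ee: "e \<otimes> e = e"
    using assms center_carrier by (auto simp: central_idempotent_def)
  show "x \<in> carrier R \<Longrightarrow> e \<otimes> x = x \<otimes> e"
    by (rule center_commute[OF c(1)])
  show "x \<in> carrier R \<Longrightarrow> e \<otimes> (e \<otimes> x) = e \<otimes> x"
    using c(2) ee by (simp flip: m_assoc)
qed

lemma central_idempotent_zero_one: "central_idempotent R \<zero>" "central_idempotent R \<one>"
  by (auto simp: central_idempotent_def center_closed)

lemma central_idempotent_diff:
  assumes e: "central_idempotent R e" and f: "central_idempotent R f" and ef: "e \<otimes> f = f"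
  shows "central_idempotent R (e \<ominus> f)"
proof -
  have [simp]: "e \<in> carrier R" "f \<in> carrier R"
    using central_idempotentD(2)[OF e] central_idempotentD(2)[OF f] by auto
  have fe: "f \<otimes> e = f"
    using ef central_idempotentD(4)[OF e, of f] by simp
  have "(e \<ominus> f) \<otimes> (e \<ominus> f) = (e \<otimes> e \<ominus> e \<otimes> f) \<ominus> (f \<otimes> e \<ominus> f \<otimes> f)"
    by (simp add: a_minus_def l_distr r_distr l_minus r_minus minus_add a_ac)
  also have "\<dots> = e \<ominus> f"
    using central_idempotentD(3)[OF e] central_idempotentD(3)[OF f] ef fe by (simp add: a_minus_def r_neg)
  finally show ?thesis
    using e f by (auto simp: central_idempotent_def intro: center_closed)
qed

lemma corner_carrier: "x \<in> corner R e \<Longrightarrow> x \<in> carrier R"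
  by (simp add: corner_def)

lemma central_idempotent_in_corner: "central_idempotent R e \<Longrightarrow> e \<in> corner R e"
  using central_idempotentD(2,3)[of e] by (simp add: corner_def)

lemma corner_mult:
  assumes e: "central_idempotent R e" and x: "x \<in> carrier R"
  shows "e \<otimes> x \<in> corner R e" "x \<otimes> e \<in> corner R e"
proof -
  show *: "e \<otimes> x \<in> corner R e"
    using x central_idempotentD(2,5)[OF e] by (simp add: corner_def)
  show "x \<otimes> e \<in> corner R e"
    using * central_idempotentD(4)[OF e x] by simp
qed

lemma ideal_imp_left_ideal:
  assumes "ideal I R"
  shows "left_ideal I R"
proof -
  interpret ideal I R by (rule assms)
  show ?thesis
    unfolding left_ideal_def by (simp add: I_l_closed is_additive_subgroup)
qed

lemma ideal_corner:
  assumes e: "central_idempotent R e"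
  shows "ideal (corner R e) R"
proof -
  note e' = central_idempotentD[OF e]
  have left: "left_ideal (corner R e) R"
  proof (rule left_idealI)
    show "r \<otimes> x \<in> corner R e" if "r \<in> carrier R" "x \<in> corner R e" for r x
    proof -
      have "e \<otimes> (r \<otimes> x) = r \<otimes> (e \<otimes> x)"
        using that e'(2) m_assoc[of e r x] m_assoc[of r e x] e'(4)[of r] by (simp add: corner_def)
      then show ?thesis
        using that by (simp add: corner_def)
    qed
  qed (use e'(2) in \<open>auto simp: corner_def r_distr\<close>)
  then have sub: "subgroup (corner R e) (add_monoid R)"
    by (auto simp: left_ideal_def additive_subgroup_def)
  show ?thesis
  proof (rule idealI[OF ring_axioms sub])
    show "x \<otimes> a \<in> corner R e" if "a \<in> corner R e" "x \<in> carrier R" for a x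
      using left_idealD(4)[OF left] that by blast
    show "a \<otimes> x \<in> corner R e" if "a \<in> corner R e" "x \<in> carrier R" for a x
      using that e'(2) by (auto simp: corner_def simp flip: m_assoc)
  qed
qed

lemma corner_closed:
  assumes "central_idempotent R e"
  shows "\<zero> \<in> corner R e" "x \<in> corner R e \<Longrightarrow> y \<in> corner R e \<Longrightarrow> x \<oplus> y \<in> corner R e"
    "x \<in> corner R e \<Longrightarrow> \<ominus> x \<in> corner R e"
    "r \<in> carrier R \<Longrightarrow> x \<in> corner R e \<Longrightarrow> r \<otimes> x \<in> corner R e"
    "r \<in> carrier R \<Longrightarrow> x \<in> corner R e \<Longrightarrow> x \<otimes> r \<in> corner R e"
    "x \<in> corner R e \<Longrightarrow> e \<otimes> x = x" "x \<in> corner R e \<Longrightarrow> x \<otimes> e = x"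
proof -
  interpret ideal "corner R e" R
    using assms by (rule ideal_corner)
  show "\<zero> \<in> corner R e" "x \<in> corner R e \<Longrightarrow> y \<in> corner R e \<Longrightarrow> x \<oplus> y \<in> corner R e"
    "x \<in> corner R e \<Longrightarrow> \<ominus> x \<in> corner R e"
    "r \<in> carrier R \<Longrightarrow> x \<in> corner R e \<Longrightarrow> r \<otimes> x \<in> corner R e"
    "r \<in> carrier R \<Longrightarrow> x \<in> corner R e \<Longrightarrow> x \<otimes> r \<in> corner R e"
    by (auto simp: I_l_closed I_r_closed)
  show ex: "x \<in> corner R e \<Longrightarrow> e \<otimes> x = x"
    unfolding corner_def by blast
  show "x \<otimes> e = x" if "x \<in> corner R e"
    by (rule trans[OF central_idempotentD(4)[OF assms corner_carrier[OF that], symmetric] ex[OF that]])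
qed

text \<open>Products of an element of \<open>I\<close> with one of \<open>J\<close> lie in the
  intersection and vanish, so the \<open>I\<close>-part of the unit \<open>g\<close> is a unit for
  \<open>I\<close>. It is central because \<open>e x\<close> and \<open>x e\<close> both equal
  \<open>e x e\<close>. The two ideals play asymmetric roles here; the lemma is applied
  twice.\<close>

lemma central_idempotent_split_half:
  assumes g: "central_idempotent R g"
    and I: "ideal I R" and J: "ideal J R" and disj: "I \<inter> J = {\<zero>}"
    and sub: "I \<subseteq> corner R g" and e: "e \<in> I" "f \<in> J" "g = e \<oplus> f"
  shows "central_idempotent R e" "I = corner R e"
proof -
  interpret I: ideal I R by (rule I)
  interpret J: ideal J R by (rule J)
  note [simp] = I.Icarr J.Icarr
  have unit: "e \<otimes> x = x" "x \<otimes> e = x" if x: "x \<in> I" for x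
  proof -
    have "f \<otimes> x \<in> I \<inter> J" "x \<otimes> f \<in> I \<inter> J"
      using x e(2) by (auto intro: I.I_l_closed I.I_r_closed J.I_l_closed J.I_r_closed)
    then have "f \<otimes> x = \<zero>" "x \<otimes> f = \<zero>"
      using disj by auto
    moreover have "(e \<oplus> f) \<otimes> x = x" "x \<otimes> (e \<oplus> f) = x"
      using corner_closed(6,7)[OF g, of x] sub x e(3) by auto
    ultimately show "e \<otimes> x = x" "x \<otimes> e = x"
      using x e by (auto simp: l_distr r_distr)
  qed
  have "e \<otimes> x = x \<otimes> e" if x: "x \<in> carrier R" for x
  proof -
    have "e \<otimes> x = (e \<otimes> x) \<otimes> e"
      using unit(2)[of "e \<otimes> x"] x e by (simp add: I.I_r_closed)
    also have "\<dots> = e \<otimes> (x \<otimes> e)"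
      using x e by (simp add: m_assoc)
    also have "\<dots> = x \<otimes> e"
      using unit(1)[of "x \<otimes> e"] x e by (simp add: I.I_l_closed)
    finally show ?thesis .
  qed
  then show "central_idempotent R e"
    using e(1) unit(1) by (auto simp: central_idempotent_def center_def)
  show "I = corner R e"
  proof
    show "I \<subseteq> corner R e"
      using unit(1) by (auto simp: corner_def)
    show "corner R e \<subseteq> I"
      using I.I_r_closed[OF e(1)] by (metis (mono_tags, lifting) corner_def mem_Collect_eq subsetI)
  qed
qed

lemma central_idempotent_split:
  assumes g: "central_idempotent R g"
    and I: "ideal I R" and J: "ideal J R" and disj: "I \<inter> J = {\<zero>}"
    and sum: "I <+> J = corner R g"
  obtains e f where "central_idempotent R e" "central_idempotent R f" "g = e \<oplus> f"
    "I = corner R e" "J = corner R f" "I \<subseteq> corner R g" "J \<subseteq> corner R g"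
proof -
  interpret I: ideal I R by (rule I)
  interpret J: ideal J R by (rule J)
  have sub: "I \<subseteq> corner R g" "J \<subseteq> corner R g"
    using left_ideal_add(2,3)[OF ideal_imp_left_ideal[OF I] ideal_imp_left_ideal[OF J]] unfolding sum .
  have "g \<in> I <+> J"
    using central_idempotent_in_corner[OF g] sum by simp
  then obtain e f where ef: "e \<in> I" "f \<in> J" "g = e \<oplus> f"
    unfolding set_add_iff by blast
  then have fe: "g = f \<oplus> e"
    by (simp add: a_comm I.Icarr J.Icarr)
  have disj': "J \<inter> I = {\<zero>}"
    using disj by blast
  show thesis
    using central_idempotent_split_half[OF g I J disj sub(1) ef]
      central_idempotent_split_half[OF g J I disj' sub(2) ef(2,1) fe] that ef(3) sub by blast
qed

lemma corner_one: "corner R \<one> = carrier R"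
  by (auto simp: corner_def)

lemma corner_sum:
  assumes e: "central_idempotent R e" and f: "central_idempotent R f" and ef: "e \<otimes> f = f"
  shows "corner R f \<inter> corner R (e \<ominus> f) = {\<zero>}" "corner R f <+> corner R (e \<ominus> f) = corner R e"
proof -
  have d: "central_idempotent R (e \<ominus> f)"
    using assms by (rule central_idempotent_diff)
  note e' = central_idempotentD[OF e] and f' = central_idempotentD[OF f]
  have [simp]: "e \<in> carrier R" "f \<in> carrier R"
    using e'(2) f'(2) by auto
  have sub_f: "e \<otimes> x = x" if "x \<in> corner R f" for x
  proof -
    have "e \<otimes> (f \<otimes> x) = f \<otimes> x"
      using corner_carrier[OF that] m_assoc[of e f x] ef by simp
    then show ?thesis
      using that by (simp add: corner_def)
  qed
  have "x = \<zero>" if x: "x \<in> corner R f" "x \<in> corner R (e \<ominus> f)" for x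
  proof -
    have [simp]: "x \<in> carrier R"
      using x by (simp add: corner_def)
    have "x = e \<otimes> x \<ominus> f \<otimes> x"
      using x(2) by (simp add: corner_def l_distr a_minus_def l_minus)
    also have "\<dots> = \<zero>"
      using sub_f[OF x(1)] x(1) by (simp add: corner_def a_minus_def r_neg)
    finally show ?thesis .
  qed
  then show "corner R f \<inter> corner R (e \<ominus> f) = {\<zero>}"
    using corner_closed(1)[OF f] corner_closed(1)[OF d] by blast
  show "corner R f <+> corner R (e \<ominus> f) = corner R e"
  proof (intro equalityI subsetI)
    fix x assume "x \<in> corner R f <+> corner R (e \<ominus> f)"
    then obtain y w where yw: "y \<in> corner R f" "w \<in> corner R (e \<ominus> f)" "x = y \<oplus> w"
      unfolding set_add_iff by blast
    then have [simp]: "y \<in> carrier R" "w \<in> carrier R"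
      by (auto simp: corner_def)
    have "e \<otimes> (e \<ominus> f) = e \<ominus> f"
      using e'(3) ef by (simp add: a_minus_def r_distr r_minus)
    then have "e \<otimes> ((e \<ominus> f) \<otimes> w) = (e \<ominus> f) \<otimes> w"
      by (simp flip: m_assoc)
    then have "e \<otimes> w = w"
      using yw(2) by (simp add: corner_def)
    then show "x \<in> corner R e"
      using yw sub_f[OF yw(1)] by (simp add: corner_def r_distr)
  next
    fix x assume x: "x \<in> corner R e"
    then have [simp]: "x \<in> carrier R"
      by (simp add: corner_def)
    have "x = f \<otimes> x \<oplus> (e \<ominus> f) \<otimes> x"
    proof -
      have "f \<otimes> x \<oplus> (e \<ominus> f) \<otimes> x = f \<otimes> x \<oplus> (\<ominus> (f \<otimes> x) \<oplus> e \<otimes> x)"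
        by (simp add: a_minus_def l_distr l_minus a_comm)
      also have "\<dots> = x"
        using x by (simp add: corner_def r_neg2)
      finally show ?thesis ..
    qed
    then show "x \<in> corner R f <+> corner R (e \<ominus> f)"
      using corner_mult(1)[OF f, of x] corner_mult(1)[OF d, of x] unfolding set_add_iff by auto
  qed
qed

lemma ring_corner:
  assumes e: "central_idempotent R e"
  shows "ring (R\<lparr>carrier := corner R e, one := e\<rparr>)"
proof (rule ringI)
  note corner_carrier[simp] corner_closed[OF e, simp]
  let ?S = "R\<lparr>carrier := corner R e, one := e\<rparr>"
  show "abelian_group ?S"
  proof (rule abelian_groupI)
    show "\<exists>y\<in>carrier ?S. y \<oplus>\<^bsub>?S\<^esub> x = \<zero>\<^bsub>?S\<^esub>" if "x \<in> carrier ?S" for x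
      using that by (intro bexI[of _ "\<ominus> x"]) (auto simp: l_neg)
  qed (auto simp: a_ac)
  show "monoid ?S"
    by (rule monoidI) (auto simp: m_assoc central_idempotent_in_corner[OF e])
qed (auto simp: l_distr r_distr corner_carrier)

lemma center_corner:
  assumes e: "central_idempotent R e"
  shows "center (R\<lparr>carrier := corner R e, one := e\<rparr>) = center R \<inter> corner R e"
proof (intro equalityI subsetI IntI)
  fix z assume z: "z \<in> center (R\<lparr>carrier := corner R e, one := e\<rparr>)"
  then show zc: "z \<in> corner R e"
    by (simp add: center_def)
  note e' = central_idempotentD[OF e]
  have "z \<otimes> x = x \<otimes> z" if x: "x \<in> carrier R" for x
  proof -
    have [simp]: "z \<in> carrier R"
      using zc by (rule corner_carrier)
    have "z \<otimes> x = z \<otimes> (e \<otimes> x)"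
      using x e'(2) corner_closed(7)[OF e zc] by (simp flip: m_assoc)
    also have "\<dots> = (e \<otimes> x) \<otimes> z"
      using z corner_mult(1)[OF e x] by (simp add: center_def)
    also have "\<dots> = x \<otimes> (e \<otimes> z)"
      using x e'(2) e'(4)[OF x] by (simp flip: m_assoc)
    also have "\<dots> = x \<otimes> z"
      using corner_closed(6)[OF e zc] by simp
    finally show ?thesis .
  qed
  then show "z \<in> center R"
    using zc by (simp add: center_def corner_def)
qed (auto simp: center_def corner_def)

lemma cring_center: "cring (R\<lparr>carrier := center R\<rparr>)"
proof (rule cringI)
  let ?S = "R\<lparr>carrier := center R\<rparr>"
  note center_carrier[simp] center_closed[simp]
  show "abelian_group ?S"
  proof (rule abelian_groupI)
    show "\<exists>y\<in>carrier ?S. y \<oplus>\<^bsub>?S\<^esub> x = \<zero>\<^bsub>?S\<^esub>" if "x \<in> carrier ?S" for x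
      using that by (intro bexI[of _ "\<ominus> x"]) (auto simp: l_neg)
  qed (auto simp: a_ac)
  show "comm_monoid ?S"
  proof (rule comm_monoidI)
    show "x \<otimes>\<^bsub>?S\<^esub> y = y \<otimes>\<^bsub>?S\<^esub> x" if "x \<in> carrier ?S" "y \<in> carrier ?S" for x y
      using center_commute[of x y] that by simp
  qed (auto simp: m_assoc)
qed (auto simp: l_distr center_carrier)

text \<open>The corner has its own unit, so powers taken in it start from \<open>e\<close>; the
  factor \<open>e\<close> on the right makes the formula hold for exponent 0 too.\<close>

lemma corner_pow:
  assumes e: "central_idempotent R e" and x: "x \<in> carrier R"
  shows "(e \<otimes> x) [^]\<^bsub>R\<lparr>carrier := corner R e, one := e\<rparr>\<^esub> (n::nat) = e \<otimes> x [^] n"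
proof (induction n)
  case 0
  then show ?case
    using central_idempotentD(2)[OF e] by (simp add: nat_pow_def)
next
  case (Suc n)
  have [simp]: "e \<in> carrier R"
    using central_idempotentD(2)[OF e] .
  have "(e \<otimes> x) [^]\<^bsub>R\<lparr>carrier := corner R e, one := e\<rparr>\<^esub> Suc n = (e \<otimes> x [^] n) \<otimes> (e \<otimes> x)"
    using Suc by (simp add: nat_pow_def)
  also have "\<dots> = e \<otimes> (x [^] n \<otimes> e) \<otimes> x"
    using x by (simp add: m_assoc)
  also have "\<dots> = (e \<otimes> e) \<otimes> (x [^] n \<otimes> x)"
    unfolding central_idempotentD(4)[OF e nat_pow_closed[OF x], symmetric]
    using x by (simp add: m_assoc)
  also have "\<dots> = e \<otimes> x [^] Suc n"
    using central_idempotentD(3)[OF e] by simp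
  finally show ?case .
qed

end

text \<open>Splitting 1 along the block and its complement yields a two-sided unit of the block.
  Uniqueness of such a unit identifies it with the definite description in
  \<open>block_idem\<close>.\<close>

lemma block_corner:
  assumes A: "ring A" and B: "is_block A B"
  shows "central_idempotent A (block_idem A B)" "B = corner A (block_idem A B)"
proof -
  interpret A: ring A by (rule A)
  obtain C where C: "ideal B A" "ideal C A" "B \<inter> C = {\<zero>\<^bsub>A\<^esub>}" "B <+>\<^bsub>A\<^esub> C = corner A \<one>\<^bsub>A\<^esub>"
    using B unfolding is_block_def A.corner_one by blast
  obtain e where e: "central_idempotent A e" "B = corner A e"
    by (rule A.central_idempotent_split[OF A.central_idempotent_zero_one(2) C]) (rule that)
  have unit: "e \<in> B \<and> (\<forall>x\<in>B. e \<otimes>\<^bsub>A\<^esub> x = x \<and> x \<otimes>\<^bsub>A\<^esub> e = x)"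
    using A.corner_closed(6,7)[OF e(1)] A.central_idempotent_in_corner[OF e(1)] by (auto simp: e(2))
  have "block_idem A B = e"
    unfolding block_idem_def
  proof (rule the_equality)
    show "e' = e" if "e' \<in> B \<and> (\<forall>x\<in>B. e' \<otimes>\<^bsub>A\<^esub> x = x \<and> x \<otimes>\<^bsub>A\<^esub> e' = x)" for e'
      using that unit by metis
  qed (rule unit)
  then show "central_idempotent A (block_idem A B)" "B = corner A (block_idem A B)"
    using e by auto
qed

lemma block_idem_eqI:
  assumes A: "ring A" and B: "is_block A B"
    and e: "e \<in> B" "\<And>x. x \<in> B \<Longrightarrow> e \<otimes>\<^bsub>A\<^esub> x = x"
  shows "block_idem A B = e"
proof -
  interpret A: ring A by (rule A)
  note * = block_corner[OF A B]
  show ?thesis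
    using A.corner_closed(7)[OF *(1), of e] A.central_idempotent_in_corner[OF *(1)] e *(2) by metis
qed

text \<open>Indecomposability is stated for ideals; a central idempotent \<open>f\<close> of the
  block splits it into the corners of \<open>f\<close> and \<open>1_B - f\<close>, and one of them
  has to be zero.\<close>

lemma block_idempotent_dichotomy:
  assumes A: "ring A" and B: "is_block A B"
    and f: "central_idempotent A f" "f \<in> B"
  shows "f = \<zero>\<^bsub>A\<^esub> \<or> f = block_idem A B"
proof -
  interpret A: ring A by (rule A)
  let ?e = "block_idem A B"
  note e = block_corner[OF A B]
  have ef: "?e \<otimes>\<^bsub>A\<^esub> f = f"
    using A.corner_closed(6)[OF e(1)] e(2) f(2) by metis
  have d: "central_idempotent A (?e \<ominus>\<^bsub>A\<^esub> f)"
    using A.central_idempotent_diff[OF e(1) f(1) ef] .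
  have "corner A f <+>\<^bsub>A\<^esub> corner A (?e \<ominus>\<^bsub>A\<^esub> f) = B"
    using A.corner_sum(2)[OF e(1) f(1) ef] e(2) by simp
  then have "corner A f = {\<zero>\<^bsub>A\<^esub>} \<or> corner A (?e \<ominus>\<^bsub>A\<^esub> f) = {\<zero>\<^bsub>A\<^esub>}"
    using B A.corner_sum(1)[OF e(1) f(1) ef] A.ideal_corner[OF f(1)] A.ideal_corner[OF d]
    unfolding is_block_def by blast
  then show ?thesis
  proof
    assume "corner A f = {\<zero>\<^bsub>A\<^esub>}"
    then show ?thesis
      using A.central_idempotent_in_corner[OF f(1)] by blast
  next
    assume "corner A (?e \<ominus>\<^bsub>A\<^esub> f) = {\<zero>\<^bsub>A\<^esub>}"
    then have "?e \<ominus>\<^bsub>A\<^esub> f = \<zero>\<^bsub>A\<^esub>"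
      using A.central_idempotent_in_corner[OF d] by blast
    then show ?thesis
      using A.r_right_minus_eq A.central_idempotentD(2)[OF e(1)] A.central_idempotentD(2)[OF f(1)] by auto
  qed
qed

text \<open>This replaces the decomposition of \<open>1\<close> into block idempotents.\<close>

lemma block_decomposition_induct:
  assumes A: "ring A" and fl: "finite_length A" and w: "w \<in> carrier A"
    and zero: "P \<zero>\<^bsub>A\<^esub>" and add: "\<And>x y. P x \<Longrightarrow> P y \<Longrightarrow> P (x \<oplus>\<^bsub>A\<^esub> y)"
    and block: "\<And>b. is_block A b \<Longrightarrow> P (w \<otimes>\<^bsub>A\<^esub> block_idem A b)"
  shows "P w"
proof (rule ccontr)
  interpret A: ring A by (rule A)
  assume "\<not> P w"
  \<comment> \<open>A minimal counterexample: among the central idempotents \<open>g\<close> for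
    which \<open>P (w g)\<close> fails, one with a smallest corner is taken. A proper splitting of
    that corner would give two pieces satisfying \<open>P\<close>, so the corner is a block.\<close>
  let ?Q = "\<lambda>L. \<exists>g. central_idempotent A g \<and> L = corner A g \<and> \<not> P (w \<otimes>\<^bsub>A\<^esub> g)"
  have "?Q (corner A \<one>\<^bsub>A\<^esub>)"
    using \<open>\<not> P w\<close> w A.central_idempotent_zero_one(2) by (intro exI[of _ "\<one>\<^bsub>A\<^esub>"]) simp
  then obtain L where L: "?Q L" "\<And>K. left_ideal K A \<Longrightarrow> ?Q K \<Longrightarrow> K \<subseteq> L \<Longrightarrow> K = L"
    by (rule A.finite_length_minimal[OF fl A.ideal_imp_left_ideal[OF A.ideal_corner[OF A.central_idempotent_zero_one(2)]], of ?Q])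
      (rule that)
  then obtain g where g: "central_idempotent A g" "L = corner A g" "\<not> P (w \<otimes>\<^bsub>A\<^esub> g)"
    by blast
  note [simp] = A.central_idempotentD(2)[OF g(1)]
  have smaller: "P (w \<otimes>\<^bsub>A\<^esub> e)" if "central_idempotent A e" "corner A e \<subset> corner A g" for e
    using L(2)[OF A.ideal_imp_left_ideal[OF A.ideal_corner[OF that(1)]]] that g(2) by blast
  have "is_block A (corner A g)"
    unfolding is_block_def
  proof (intro conjI allI impI)
    show "ideal (corner A g) A"
      by (rule A.ideal_corner[OF g(1)])
    show "corner A g \<noteq> {\<zero>\<^bsub>A\<^esub>}"
      using A.central_idempotent_in_corner[OF g(1)] g(3) w zero by auto
    have one: "\<one>\<^bsub>A\<^esub> \<otimes>\<^bsub>A\<^esub> g = g"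
      by simp
    show "\<exists>C. ideal C A \<and> corner A g \<inter> C = {\<zero>\<^bsub>A\<^esub>} \<and> corner A g <+>\<^bsub>A\<^esub> C = carrier A"
      using A.corner_sum[OF A.central_idempotent_zero_one(2) g(1) one] A.corner_one
        A.ideal_corner[OF A.central_idempotent_diff[OF A.central_idempotent_zero_one(2) g(1) one]] by metis
    fix I J assume IJ: "ideal I A \<and> ideal J A \<and> I \<inter> J = {\<zero>\<^bsub>A\<^esub>} \<and> I <+>\<^bsub>A\<^esub> J = corner A g"
    then obtain e f where ef: "central_idempotent A e" "central_idempotent A f" "g = e \<oplus>\<^bsub>A\<^esub> f"
      "I = corner A e" "J = corner A f" "I \<subseteq> corner A g" "J \<subseteq> corner A g"
      using A.central_idempotent_split[OF g(1), of I J] by blast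
    show "I = {\<zero>\<^bsub>A\<^esub>} \<or> J = {\<zero>\<^bsub>A\<^esub>}"
    proof (rule ccontr)
      assume "\<not> (I = {\<zero>\<^bsub>A\<^esub>} \<or> J = {\<zero>\<^bsub>A\<^esub>})"
      then have "I \<subset> corner A g" "J \<subset> corner A g"
        using IJ ef(6,7) by blast+
      then have "P (w \<otimes>\<^bsub>A\<^esub> e \<oplus>\<^bsub>A\<^esub> w \<otimes>\<^bsub>A\<^esub> f)"
        using smaller ef by (intro add) auto
      then show False
        using g(3) w ef(3) A.central_idempotentD(2)[OF ef(1)] A.central_idempotentD(2)[OF ef(2)]
        by (simp add: A.r_distr)
    qed
  qed
  moreover from this have "block_idem A (corner A g) = g"
    using A.corner_closed(6)[OF g(1)] A.central_idempotent_in_corner[OF g(1)]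
    by (intro block_idem_eqI[OF A]) auto
  ultimately show False
    using block g(3) by metis
qed

section \<open>The Reynolds ideal of a block\<close>

text \<open>
  Modulo the annihilator of \<open>z\<close>, a nilpotent \<open>n\<close> with \<open>n = n y n\<close> satisfies \<open>t (n z) = t (n' z)\<close>
  for \<open>n' = n (n y)\<close>, and \<open>n'\<close> has smaller nilpotency index than \<open>n\<close>.
\<close>

lemma (in ring) trace_nilpotent_socle:
  assumes fl: "finite_length R" and z: "z \<in> center R" "z \<in> socle R"
    and t: "\<And>x y. x \<in> carrier R \<Longrightarrow> y \<in> carrier R \<Longrightarrow> t (x \<otimes> y) = t (y \<otimes> x)"
    and n: "n \<in> carrier R" "n [^] (m::nat) \<otimes> z = \<zero>"
  shows "t (n \<otimes> z) = t \<zero>"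
  using n
proof (induction m arbitrary: n)
  case 0
  then have "z = \<zero>"
    using center_carrier[OF z(1)] by simp
  then show ?case
    using 0 by simp
next
  case (Suc m)
  note [simp] = center_carrier[OF z(1)] \<open>n \<in> carrier R\<close>
  note zc = center_commute[OF z(1)]
  show ?case
  proof (cases m)
    case 0
    then show ?thesis
      using Suc.prems by simp
  next
    case (Suc m')
    obtain y where y: "y \<in> carrier R" "n \<otimes> z = n \<otimes> y \<otimes> n \<otimes> z"
      using central_socle_regular[OF fl z] Suc.prems(1) by blast
    define e where "e = n \<otimes> y"
    have [simp]: "e \<in> carrier R"
      using y(1) by (simp add: e_def)
    have enz: "e \<otimes> n \<otimes> z = n \<otimes> z"
      using y(2) unfolding e_def by (rule sym)
    \<comment> \<open>Modulo the annihilator of \<open>z\<close>, the element \<open>e = n y\<close>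
      is a left unit for \<open>n\<close>, so all inner factors \<open>e\<close> of a power of
      \<open>n e\<close> cancel and one is left at the end. Since \<open>n^m e = n^(m+1) y\<close>,
      the exponent \<open>m\<close> suffices for \<open>n e\<close>.\<close>
    have pow: "(n \<otimes> e) [^] Suc k \<otimes> z = n [^] Suc k \<otimes> e \<otimes> z" for k
    proof (induction k)
      case (Suc k)
      have "(n \<otimes> e) [^] Suc (Suc k) \<otimes> z = (n \<otimes> e) \<otimes> ((n \<otimes> e) [^] Suc k \<otimes> z)"
        using nat_pow_Suc2[of "n \<otimes> e" "Suc k"] by (simp add: m_assoc del: nat_pow_Suc)
      also have "\<dots> = (n \<otimes> e) \<otimes> (n [^] Suc k \<otimes> e \<otimes> z)"
        by (simp only: Suc)
      also have "\<dots> = n \<otimes> (e \<otimes> n \<otimes> ((n [^] k \<otimes> e) \<otimes> z))"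
        using nat_pow_Suc2[of n k] by (simp add: m_assoc del: nat_pow_Suc)
      also have "\<dots> = n \<otimes> ((e \<otimes> n \<otimes> z) \<otimes> (n [^] k \<otimes> e))"
        unfolding zc[of "n [^] k \<otimes> e", symmetric, OF m_closed[OF nat_pow_closed \<open>e \<in> carrier R\<close>, OF \<open>n \<in> carrier R\<close>]]
        by (simp add: m_assoc)
      also have "\<dots> = n \<otimes> (n \<otimes> (z \<otimes> (n [^] k \<otimes> e)))"
        unfolding enz by (simp add: m_assoc)
      also have "\<dots> = n \<otimes> (n \<otimes> n [^] k) \<otimes> e \<otimes> z"
        by (subst zc) (simp_all add: m_assoc)
      also have "\<dots> = n [^] Suc (Suc k) \<otimes> e \<otimes> z"
        using nat_pow_Suc2[of n k] nat_pow_Suc2[of n "Suc k"] by (simp del: nat_pow_Suc)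
      finally show ?case .
    qed simp
    have "(n \<otimes> e) [^] m \<otimes> z = n [^] m \<otimes> e \<otimes> z"
      using pow[of m'] Suc by simp
    also have "\<dots> = n [^] Suc m \<otimes> (y \<otimes> z)"
      using y(1) by (simp add: e_def m_assoc)
    also have "\<dots> = n [^] Suc m \<otimes> z \<otimes> y"
      unfolding zc[OF y(1), symmetric] using y(1) by (simp add: m_assoc)
    also have "\<dots> = \<zero>"
      unfolding Suc.prems(2) using y(1) by simp
    finally have "t ((n \<otimes> e) \<otimes> z) = t \<zero>"
      by (intro Suc.IH) auto
    moreover have "t (n \<otimes> z) = t (e \<otimes> (n \<otimes> z))"
      using enz by (simp add: m_assoc)
    moreover have "\<dots> = t ((n \<otimes> z) \<otimes> e)"
      by (rule t) auto
    moreover have "(n \<otimes> z) \<otimes> e = (n \<otimes> e) \<otimes> z"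
      using zc[of e] by (simp add: m_assoc)
    ultimately show ?thesis
      by simp
  qed
qed

context finite_group
begin

interpretation A: ring "group_algebra G :: ('k::field, 'a \<Rightarrow> 'k) module"
  by (rule ring_group_algebra)

lemma smult_closed:
  "x \<in> carrier (group_algebra G) \<Longrightarrow> c \<odot>\<^bsub>group_algebra G\<^esub> x \<in> carrier (group_algebra G)"
  by (simp add: group_algebra_simps)

lemma smult_center:
  "x \<in> center (group_algebra G) \<Longrightarrow> c \<odot>\<^bsub>group_algebra G\<^esub> x \<in> center (group_algebra G)"
  unfolding center_group_algebra_iff by (simp add: group_algebra_simps)

lemma smult_corner:
  assumes "central_idempotent (group_algebra G) e" "x \<in> corner (group_algebra G) e"
  shows "c \<odot>\<^bsub>group_algebra G\<^esub> x \<in> corner (group_algebra G) e"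
  using assms(2) by (simp add: corner_def smult_closed flip: group_algebra_smult_mult(2))

lemma
  fixes e :: "'a \<Rightarrow> 'k::field"
  assumes e: "central_idempotent (group_algebra G) e"
  defines "S \<equiv> (group_algebra G)\<lparr>carrier := corner (group_algebra G) e, one := e\<rparr>"
  shows finite_length_corner: "finite_length S"
    and finite_length_center_corner: "finite_length (S\<lparr>carrier := center S\<rparr>)"
proof -
  note e' = A.central_idempotentD[OF e]
  have scale: "(c \<odot>\<^bsub>group_algebra G\<^esub> e) \<otimes>\<^sub>F f = (\<lambda>x. c * f x)" if "f \<in> corner (group_algebra G) e" for c f
  proof -
    have "(c \<odot>\<^bsub>group_algebra G\<^esub> e) \<otimes>\<^sub>F f = c \<odot>\<^bsub>group_algebra G\<^esub> (e \<otimes>\<^sub>F f)"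
      by (simp only: group_algebra_smult_mult(1))
    also have "e \<otimes>\<^sub>F f = f"
      by (rule A.corner_closed(6)[OF e that])
    finally show ?thesis
      by (simp add: group_algebra_simps)
  qed
  interpret S: ring S
    unfolding S_def by (rule A.ring_corner[OF e])
  have S_simps: "carrier S = corner (group_algebra G) e" "monoid.mult S = monoid.mult (group_algebra G)"
    "ring.add S = ring.add (group_algebra G)" "\<zero>\<^bsub>S\<^esub> = \<zero>\<^bsub>group_algebra G\<^esub>"
    by (simp_all add: S_def)
  have supp: "f x = 0" if "f \<in> corner (group_algebra G) e" "x \<notin> carrier G" for f x
    using A.corner_carrier[OF that(1)] that(2) by (simp add: group_algebra_simps)
  have e_corner: "e \<in> corner (group_algebra G) e"
    by (rule A.central_idempotent_in_corner[OF e])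
  show "finite_length S"
  proof (rule finite_length_functions[OF S.ring_axioms, of "carrier G"])
    show "\<exists>d\<in>carrier S. d \<otimes>\<^bsub>S\<^esub> f = (\<lambda>x. c * f x)" if "f \<in> carrier S" for c f
      using that scale smult_corner[OF e e_corner, of c]
      by (intro bexI[of _ "c \<odot>\<^bsub>group_algebra G\<^esub> e"]) (auto simp: S_simps)
  qed (use supp in \<open>auto simp: S_simps group_algebra_simps\<close>)
  have center: "center S = center (group_algebra G) \<inter> corner (group_algebra G) e"
    unfolding S_def by (rule A.center_corner[OF e])
  show "finite_length (S\<lparr>carrier := center S\<rparr>)"
  proof (rule finite_length_functions[of _ "carrier G"])
    show "ring (S\<lparr>carrier := center S\<rparr>)"
      using S.cring_center by (rule cring.axioms(1))
    show "\<exists>d\<in>carrier (S\<lparr>carrier := center S\<rparr>). d \<otimes>\<^bsub>S\<lparr>carrier := center S\<rparr>\<^esub> f = (\<lambda>x. c * f x)"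
      if "f \<in> carrier (S\<lparr>carrier := center S\<rparr>)" for c f
      using that scale smult_corner[OF e e_corner, of c] smult_center[OF e'(1)]
      by (intro bexI[of _ "c \<odot>\<^bsub>group_algebra G\<^esub> e"]) (auto simp: S_simps center)
  qed (use supp in \<open>auto simp: S_simps center group_algebra_simps\<close>)
qed

lemma block_algebra_eq:
  assumes "is_block (group_algebra G) b"
  shows "block_algebra (group_algebra G) b =
    (group_algebra G)\<lparr>carrier := corner (group_algebra G) (block_idem (group_algebra G) b),
      one := block_idem (group_algebra G) b\<rparr>"
  unfolding block_algebra_def using block_corner(2)[OF ring_group_algebra assms] by simp

lemma
  fixes b :: "('a \<Rightarrow> 'k::field) set"
  assumes b: "is_block (group_algebra G) b"
  shows ring_block_algebra: "ring (block_algebra (group_algebra G) b)"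
    and finite_length_block_algebra: "finite_length (block_algebra (group_algebra G) b)"
    and finite_length_center_block_algebra: "finite_length (center_algebra (block_algebra (group_algebra G) b))"
    and cring_center_block_algebra: "cring (center_algebra (block_algebra (group_algebra G) b))"
    and center_block_algebra: "center (block_algebra (group_algebra G) b) = center (group_algebra G) \<inter> b"
proof -
  note e = block_corner[OF ring_group_algebra b]
  show ring: "ring (block_algebra (group_algebra G) b)"
    unfolding block_algebra_eq[OF b] by (rule A.ring_corner[OF e(1)])
  show "finite_length (block_algebra (group_algebra G) b)"
    unfolding block_algebra_eq[OF b] by (rule finite_length_corner[OF e(1)])
  show "finite_length (center_algebra (block_algebra (group_algebra G) b))"
    unfolding block_algebra_eq[OF b] by (rule finite_length_center_corner[OF e(1)])
  show "cring (center_algebra (block_algebra (group_algebra G) b))"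
    by (rule ring.cring_center[OF ring])
  show "center (block_algebra (group_algebra G) b) = center (group_algebra G) \<inter> b"
    unfolding block_algebra_eq[OF b] using A.center_corner[OF e(1)] e(2) by simp
qed

lemma pow_iterate_invariant:
  assumes "\<And>x. x \<in> carrier G \<Longrightarrow> z x = z (x [^] (q::nat))" "x \<in> carrier G"
  shows "z x = z (x [^] (q ^ k))"
proof (induction k)
  case (Suc k)
  have "z (x [^] (q ^ k)) = z ((x [^] (q ^ k)) [^] q)"
    using assms by blast
  then show ?case
    using Suc assms(2) by (simp add: nat_pow_pow mult.commute)
qed (use assms(2) in simp)

text \<open>The coefficient is the sum of all \<open>a x * w x\<close> with
  \<open>w x = z (inv x)\<close>. It is grouped by the values of \<open>w\<close>, whose level sets
  are unions of \<open>p\<close>-sections. The sum of \<open>a\<close> over a level set, raised to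
  the power \<open>Q\<close>, is a sum of coefficients of \<open>a^Q = 0\<close>.\<close>

lemma coeff_one_nilpotent_mult:
  fixes a z :: "'a \<Rightarrow> 'k::field"
  assumes p: "CHAR('k) = p" "prime p" "q = p ^ n" "n > 0"
    and a: "a \<in> carrier (group_algebra G)" "a [^]\<^bsub>group_algebra G\<^esub> (m::nat) = \<zero>\<^bsub>group_algebra G\<^esub>"
    and z: "z \<in> center (group_algebra G)" "\<And>x. x \<in> carrier G \<Longrightarrow> z x = z (x [^] q)"
  shows "(a \<otimes>\<^sub>F z) \<one> = 0"
proof -
  have "1 < q"
    using p prime_gt_1_nat one_less_power by blast
  \<comment> \<open>The exponent has to be a power of \<open>p\<close> for the Frobenius formula, a
    power of \<open>q\<close> for the invariance of \<open>w\<close>, and at least \<open>m\<close>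
    so that \<open>a^Q\<close> vanishes.\<close>
  define Q where "Q = p ^ (n * m)"
  have Q: "Q = q ^ m" "m \<le> Q"
    using power_gt_expt[of q m] \<open>1 < q\<close> p(3) by (auto simp: Q_def power_mult)
  have aQ: "a [^]\<^bsub>group_algebra G\<^esub> Q = \<zero>\<^bsub>group_algebra G\<^esub>"
  proof -
    have "a [^]\<^bsub>group_algebra G\<^esub> Q = a [^]\<^bsub>group_algebra G\<^esub> m \<otimes>\<^sub>F a [^]\<^bsub>group_algebra G\<^esub> (Q - m)"
      using A.nat_pow_mult[OF a(1), of m "Q - m"] Q(2) by simp
    then show ?thesis
      using a by simp
  qed
  \<comment> \<open>The form pairs the coefficient of \<open>a\<close> at \<open>x\<close> with that
    of \<open>z\<close> at the inverse of \<open>x\<close>.\<close>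
  define w where "w x = z (inv x)" for x
  have w: "w x = w (x [^] Q)" if "x \<in> carrier G" for x
    using pow_iterate_invariant[of z q "inv x" m] z(2) that by (simp add: w_def Q(1) nat_pow_inv)
  have zc: "z (x \<otimes> y) = z (y \<otimes> x)" if "x \<in> carrier G" "y \<in> carrier G" for x y
    using z(1) that by (auto simp: center_group_algebra_iff)
  have wc: "w (x \<otimes> y) = w (y \<otimes> x)" if "x \<in> carrier G" "y \<in> carrier G" for x y
    using zc[of "inv x" "inv y"] that by (simp add: w_def inv_mult_group)
  have level: "(\<Sum>x | x \<in> carrier G \<and> w x = v. a x) = 0" for v
  proof -
    let ?H = "{h \<in> carrier G. w h = v}"
    have "(\<Sum>x | x \<in> carrier G \<and> x [^] Q \<in> ?H. a x) ^ Q = (\<Sum>h\<in>?H. (a [^]\<^bsub>group_algebra G\<^esub> Q) h)"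
      unfolding Q_def using a(1) wc
      by (intro sum_pow_CHAR[OF p(1,2), symmetric]) (auto simp: group_algebra_simps)
    also have "\<dots> = 0"
      by (simp add: aQ group_algebra_simps)
    finally have "(\<Sum>x | x \<in> carrier G \<and> x [^] Q \<in> ?H. a x) = 0"
      by simp
    moreover have "{x. x \<in> carrier G \<and> x [^] Q \<in> ?H} = {x. x \<in> carrier G \<and> w x = v}"
      using w by auto
    ultimately show ?thesis
      by simp
  qed
  have "(a \<otimes>\<^sub>F z) \<one> = (\<Sum>x\<in>carrier G. a x * w x)"
    by (simp add: coeff_one_mult w_def)
  also have "\<dots> = (\<Sum>v\<in>w ` carrier G. \<Sum>x | x \<in> carrier G \<and> w x = v. a x * w x)"
    by (intro sum.group[symmetric]) auto
  also have "\<dots> = (\<Sum>v\<in>w ` carrier G. (\<Sum>x | x \<in> carrier G \<and> w x = v. a x) * v)"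
    by (intro sum.cong) (auto simp: sum_distrib_right)
  also have "\<dots> = 0"
    by (simp add: level)
  finally show ?thesis .
qed

text \<open>Frobenius in the commutative algebra spanned by the powers of \<open>y\<close>: the
  \<open>q\<close>-th power of \<open>y - y^q\<close> is \<open>y^q - y^(q*q) = 0\<close>. On
  coefficients, \<open>y\<close> and \<open>y^q\<close> have the same \<open>q\<close>-th power, so
  their contributions 1 and -1 are summed together.\<close>

lemma delta_diff_pow:
  fixes y :: 'a
  assumes p: "CHAR('k::field) = p" "prime p" "q = p ^ n" and y: "y \<in> carrier G" "y [^] (q * q) = y [^] q"
  defines "d \<equiv> (\<lambda>h. (if h = y then 1 else 0) - (if h = y [^] q then 1 else 0 :: 'k))"
  shows "d [^]\<^bsub>group_algebra G\<^esub> q = \<zero>\<^bsub>group_algebra G\<^esub>"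
proof
  fix h
  let ?K = "range (\<lambda>i::nat. y [^] i)"
  have d: "d \<in> carrier (group_algebra G)"
    using y(1) by (auto simp: d_def group_algebra_simps)
  then have "d [^]\<^bsub>group_algebra G\<^esub> q \<in> carrier (group_algebra G)"
    by simp
  moreover have "(d [^]\<^bsub>group_algebra G\<^esub> q) h = 0" if h: "h \<in> carrier G"
  proof -
    have K: "?K \<subseteq> carrier G"
      using y(1) by auto
    have one: "y \<in> ?K" "y [^] q \<in> ?K" "\<one> \<in> ?K"
      using y(1) nat_pow_eone by (auto intro: range_eqI[of _ _ "1::nat"] range_eqI[of _ _ "0::nat"])
    have Kc: "u \<otimes> v \<in> ?K \<and> u \<otimes> v = v \<otimes> u" if "u \<in> ?K" "v \<in> ?K" for u v
    proof -
      obtain i j :: nat where "u = y [^] i" "v = y [^] j"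
        using \<open>u \<in> ?K\<close> \<open>v \<in> ?K\<close> by auto
      then show ?thesis
        using y(1) by (simp add: nat_pow_mult add.commute)
    qed
    have "(\<Sum>h\<in>{h}. (d [^]\<^bsub>group_algebra G\<^esub> q) h) = (\<Sum>x | x \<in> ?K \<and> x [^] q \<in> {h}. d x) ^ q"
      unfolding p(3)
    proof (rule sum_pow_CHAR[OF p(1,2) K one(3)])
      show "d x = 0" if "x \<notin> ?K" for x
        using that one by (auto simp: d_def)
      show "v \<otimes> u \<in> {h}" if "u \<in> ?K" "v \<in> ?K" "u \<otimes> v \<in> {h}" for u v
        using Kc[OF that(1,2)] that(3) by simp
    qed (use Kc d h in auto)
    moreover have "(\<Sum>x | x \<in> ?K \<and> x [^] q \<in> {h}. d x) = 0"
    proof -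
      have fin: "finite {x. x \<in> ?K \<and> x [^] q \<in> {h}}"
        by (rule finite_subset[OF _ finite_carrier]) (use K in auto)
      have "(y [^] q) [^] q = y [^] q"
        using y by (simp add: nat_pow_pow)
      then show ?thesis
        using one fin unfolding d_def sum_subtractf by simp
    qed
    moreover have "0 < q"
      using p by (simp add: prime_gt_0_nat)
    ultimately show ?thesis
      by simp
  qed
  ultimately show "(d [^]\<^bsub>group_algebra G\<^esub> q) h = \<zero>\<^bsub>group_algebra G\<^esub> h"
    by (cases "h \<in> carrier G") (auto simp: group_algebra_simps)
qed

text \<open>For \<open>a\<close> in the radical, every \<open>y a\<close> is nilpotent, so
  \<open>y a z\<close> has coefficient 0 at the identity. As \<open>y\<close> is arbitrary,
  nondegeneracy gives \<open>a z = 0\<close>, and what the radical annihilates lies in the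
  socle.\<close>

lemma pow_invariant_imp_reynolds:
  fixes b :: "('a \<Rightarrow> 'k::field) set"
  assumes p: "CHAR('k) = p" "prime p" "q = p ^ n" "n > 0" and b: "is_block (group_algebra G) b"
    and z: "z \<in> center (group_algebra G)" "\<And>x. x \<in> carrier G \<Longrightarrow> z x = z (x [^] q)"
  shows "z \<otimes>\<^sub>F block_idem (group_algebra G) b \<in> reynolds (block_algebra (group_algebra G) b)"
proof -
  let ?A = "group_algebra G :: ('k, 'a \<Rightarrow> 'k) module"
  let ?e = "block_idem ?A b" and ?S = "block_algebra ?A b"
  note e = block_corner[OF ring_group_algebra b]
  note e' = A.central_idempotentD[OF e(1)]
  interpret S: ring ?S
    by (rule ring_block_algebra[OF b])
  note [simp] = e'(2) A.center_carrier[OF z(1)]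
  have S_simps: "carrier ?S = b" "monoid.mult ?S = monoid.mult ?A" "\<zero>\<^bsub>?S\<^esub> = \<zero>\<^bsub>?A\<^esub>"
    by (simp_all add: block_algebra_def)
  have ze: "z \<otimes>\<^sub>F ?e \<in> center ?A" "z \<otimes>\<^sub>F ?e \<in> b"
    using A.center_closed(6)[OF z(1) e'(1)] A.corner_mult(2)[OF e(1), of z] e(2) by auto
  have "a \<otimes>\<^bsub>?S\<^esub> (z \<otimes>\<^sub>F ?e) = \<zero>\<^bsub>?S\<^esub>" if a: "a \<in> jacobson_radical ?S" for a
  proof -
    have ab: "a \<in> b"
      using a by (simp add: jacobson_radical_def S_simps)
    have [simp]: "a \<in> carrier ?A"
      using ab e(2) A.corner_carrier by blast
    have "a \<otimes>\<^sub>F z = \<zero>\<^bsub>?A\<^esub>"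
    proof (rule coeff_one_nondegenerate)
      fix y :: "'a \<Rightarrow> 'k" assume [simp]: "y \<in> carrier ?A"
      have ea: "?e \<otimes>\<^sub>F a = a"
        using A.corner_closed(6)[OF e(1)] ab e(2) by blast
      \<comment> \<open>\<open>y\<close> runs over the whole group algebra; since \<open>a\<close>
        absorbs the block idempotent, \<open>y a = (y e) a\<close> is still a left multiple of
        \<open>a\<close> inside the block and lies in its radical.\<close>
      define c where "c = y \<otimes>\<^sub>F a"
      have c_eq: "c = (y \<otimes>\<^sub>F ?e) \<otimes>\<^sub>F a"
        unfolding c_def by (subst A.m_assoc) (simp_all add: ea)
      have "y \<otimes>\<^sub>F ?e \<in> carrier ?S"
        using A.corner_mult(2)[OF e(1), of y] e(2) by (simp add: S_simps)
      then have cJ: "c \<in> jacobson_radical ?S"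
        using S.left_idealD(4)[OF S.left_ideal_jacobson_radical _ a] unfolding c_eq by (simp add: S_simps)
      then obtain k :: nat where k: "c [^]\<^bsub>?S\<^esub> k = \<zero>\<^bsub>?S\<^esub>"
        using S.jacobson_radical_nilpotent[OF finite_length_block_algebra[OF b]] by blast
      have [simp]: "c \<in> carrier ?A"
        by (simp add: c_def)
      have ec: "?e \<otimes>\<^sub>F c = c"
        using cJ A.corner_closed(6)[OF e(1), of c] e(2) by (simp add: jacobson_radical_def S_simps)
      have "?e \<otimes>\<^sub>F c [^]\<^bsub>?A\<^esub> k = \<zero>\<^bsub>?A\<^esub>"
        using k A.corner_pow[OF e(1), of c k] unfolding ec block_algebra_eq[OF b, symmetric]
        by (simp add: S_simps)
      \<comment> \<open>Nilpotency inside the block means \<open>e c^k = 0\<close>; one more factor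
        \<open>c\<close> absorbs \<open>e\<close> and gives nilpotency in the group algebra.\<close>
      then have "c \<otimes>\<^sub>F c [^]\<^bsub>?A\<^esub> k = \<zero>\<^bsub>?A\<^esub>"
        using A.m_assoc[of c ?e "c [^]\<^bsub>?A\<^esub> k"] e'(4)[of c] ec by simp
      then have "c [^]\<^bsub>?A\<^esub> Suc k = \<zero>\<^bsub>?A\<^esub>"
        using A.nat_pow_Suc2[of c k] by simp
      then have "(c \<otimes>\<^sub>F z) \<one> = 0"
        by (intro coeff_one_nilpotent_mult[OF p _ _ z, of c "Suc k"]) auto
      moreover have "((a \<otimes>\<^sub>F z) \<otimes>\<^sub>F y) \<one> = (y \<otimes>\<^sub>F (a \<otimes>\<^sub>F z)) \<one>"
        by (rule coeff_one_commute)
      ultimately show "((a \<otimes>\<^sub>F z) \<otimes>\<^sub>F y) \<one> = 0"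
        by (simp add: c_def A.m_assoc)
    qed simp
    then have "(a \<otimes>\<^sub>F z) \<otimes>\<^sub>F ?e = \<zero>\<^bsub>?A\<^esub>"
      by simp
    then show ?thesis
      by (simp add: S_simps A.m_assoc)
  qed
  then have "z \<otimes>\<^sub>F ?e \<in> socle ?S"
    using ze(2) by (intro S.jacobson_radical_annihilated_imp_socle finite_length_block_algebra[OF b])
      (auto simp: S_simps)
  then show ?thesis
    using ze by (simp add: reynolds_def center_block_algebra[OF b])
qed

text \<open>The trace argument for socle elements is applied to \<open>e (y - y^q)\<close>: the
  factor \<open>e\<close> moves the nilpotent element into the block and is then absorbed by
  \<open>z\<close>. The condition on \<open>x\<close> is pointwise, so an exponent chosen for a
  larger group can be used.\<close>

lemma reynolds_imp_pow_invariant: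
  fixes b :: "('a \<Rightarrow> 'k::field) set"
  assumes p: "CHAR('k) = p" "prime p" "q = p ^ n" and b: "is_block (group_algebra G) b"
    and z: "z \<in> reynolds (block_algebra (group_algebra G) b)"
    and x: "x \<in> carrier G" "x [^] (q * q) = x [^] q"
  shows "z x = z (x [^] q)"
proof -
  let ?A = "group_algebra G :: ('k, 'a \<Rightarrow> 'k) module"
  let ?e = "block_idem ?A b" and ?S = "block_algebra ?A b"
  note e = block_corner[OF ring_group_algebra b]
  note e' = A.central_idempotentD[OF e(1)]
  interpret S: ring ?S
    by (rule ring_block_algebra[OF b])
  have S_simps: "carrier ?S = b" "monoid.mult ?S = monoid.mult ?A" "\<zero>\<^bsub>?S\<^esub> = \<zero>\<^bsub>?A\<^esub>"
    by (simp_all add: block_algebra_def)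
  have zb: "z \<in> center ?A" "z \<in> b" "z \<in> center ?S" "z \<in> socle ?S"
    using z center_block_algebra[OF b] by (auto simp: reynolds_def)
  have [simp]: "z \<in> carrier ?A"
    using zb(1) by (rule A.center_carrier)
  \<comment> \<open>The coefficient of \<open>d z\<close> at the identity evaluates \<open>z\<close>
    at inverses of the support of \<open>d\<close>, so inverting \<open>x\<close> first produces
    \<open>z x\<close> and \<open>z (x [^] q)\<close>.\<close>
  let ?y = "inv x"
  define d where "d = (\<lambda>h. (if h = ?y then 1 else 0) - (if h = ?y [^] q then 1 else 0 :: 'k))"
  have [simp]: "d \<in> carrier ?A"
    using x by (auto simp: d_def group_algebra_simps)
  have "?y [^] (q * q) = ?y [^] q"
    using x by (simp add: nat_pow_inv)
  then have dq: "d [^]\<^bsub>?A\<^esub> q = \<zero>\<^bsub>?A\<^esub>"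
    unfolding d_def using delta_diff_pow[OF p, of ?y] x(1) by simp
  have "(?e \<otimes>\<^sub>F d) [^]\<^bsub>?S\<^esub> q = ?e \<otimes>\<^sub>F d [^]\<^bsub>?A\<^esub> q"
    unfolding block_algebra_eq[OF b] by (rule A.corner_pow[OF e(1)]) simp
  then have nil: "(?e \<otimes>\<^sub>F d) [^]\<^bsub>?S\<^esub> q \<otimes>\<^bsub>?S\<^esub> z = \<zero>\<^bsub>?S\<^esub>"
    using e'(2) by (simp add: dq S_simps)
  have "((?e \<otimes>\<^sub>F d) \<otimes>\<^bsub>?S\<^esub> z) \<one> = \<zero>\<^bsub>?S\<^esub> \<one>"
  proof (rule S.trace_nilpotent_socle[where t = "\<lambda>a. a \<one>", OF finite_length_block_algebra[OF b] zb(3,4) _ _ nil])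
    show "?e \<otimes>\<^sub>F d \<in> carrier ?S"
      using A.corner_mult(1)[OF e(1), of d] e(2) by (simp add: S_simps)
    show "(u \<otimes>\<^bsub>?S\<^esub> v) \<one> = (v \<otimes>\<^bsub>?S\<^esub> u) \<one>" for u v
      unfolding S_simps by (rule coeff_one_commute)
  qed
  moreover have "(?e \<otimes>\<^sub>F d) \<otimes>\<^sub>F z = d \<otimes>\<^sub>F z"
  proof -
    have "(?e \<otimes>\<^sub>F d) \<otimes>\<^sub>F z = (d \<otimes>\<^sub>F ?e) \<otimes>\<^sub>F z"
      using e'(4)[of d] by simp
    also have "\<dots> = d \<otimes>\<^sub>F (?e \<otimes>\<^sub>F z)"
      using e'(2) by (simp add: A.m_assoc)
    also have "?e \<otimes>\<^sub>F z = z"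
      using A.corner_closed(6)[OF e(1)] zb(2) e(2) by blast
    finally show ?thesis .
  qed
  ultimately have "(d \<otimes>\<^sub>F z) \<one> = 0"
    by (simp add: S_simps group_algebra_simps)
  moreover have "(d \<otimes>\<^sub>F z) \<one> = z x - z (x [^] q)"
  proof -
    have "(d \<otimes>\<^sub>F z) \<one> = (\<Sum>h\<in>carrier G. (if h = ?y then z (inv h) else 0) - (if h = ?y [^] q then z (inv h) else 0))"
      unfolding coeff_one_mult by (intro sum.cong) (auto simp: d_def)
    also have "\<dots> = z (inv ?y) - z (inv (?y [^] q))"
      using x(1) unfolding sum_subtractf by simp
    also have "\<dots> = z x - z (x [^] q)"
      using x(1) by (simp add: nat_pow_inv)
    finally show ?thesis .
  qed
  ultimately show ?thesis
    by simp
qed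

end

section \<open>Central characters\<close>

context finite_group
begin

interpretation A: ring "group_algebra G :: ('k::field, 'a \<Rightarrow> 'k) module"
  by (rule ring_group_algebra)

text \<open>Horner evaluation with scalars embedded as multiples of 1; the algebra is a record and
  not a type of some class, so \<open>poly\<close> does not apply to its elements.\<close>

definition poly_eval :: "'k::field poly \<Rightarrow> ('a \<Rightarrow> 'k) \<Rightarrow> 'a \<Rightarrow> 'k"
  where "poly_eval f z = fold_coeffs
    (\<lambda>c a. c \<odot>\<^bsub>group_algebra G\<^esub> \<one>\<^bsub>group_algebra G\<^esub> \<oplus>\<^bsub>group_algebra G\<^esub> z \<otimes>\<^sub>F a) f \<zero>\<^bsub>group_algebra G\<^esub>"

lemma poly_eval_0: "poly_eval 0 z = \<zero>\<^bsub>group_algebra G\<^esub>"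
  by (simp add: poly_eval_def)

lemma poly_eval_pCons:
  fixes z :: "'a \<Rightarrow> 'k::field"
  assumes "z \<in> carrier (group_algebra G)"
  shows "poly_eval (pCons c f) z =
    c \<odot>\<^bsub>group_algebra G\<^esub> \<one>\<^bsub>group_algebra G\<^esub> \<oplus>\<^bsub>group_algebra G\<^esub> z \<otimes>\<^sub>F poly_eval f z"
proof (cases "c = 0 \<and> f = 0")
  case True
  have "0 \<odot>\<^bsub>group_algebra G\<^esub> \<one>\<^bsub>group_algebra G\<^esub> = (\<zero>\<^bsub>group_algebra G\<^esub> :: 'a \<Rightarrow> 'k)"
    by (simp add: group_algebra_simps)
  then show ?thesis
    using assms True by (simp add: poly_eval_0)
qed (auto simp: poly_eval_def fold_coeffs_pCons_coeff_not_0_eq fold_coeffs_pCons_not_0_0_eq)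

lemma poly_eval_closed:
  assumes "z \<in> carrier (group_algebra G)"
  shows "poly_eval f z \<in> carrier (group_algebra G)"
  by (induction f rule: pCons_induct)
    (use assms in \<open>auto simp: poly_eval_0 poly_eval_pCons smult_closed\<close>)

lemma poly_eval_add:
  assumes z: "z \<in> carrier (group_algebra G)"
  shows "poly_eval (f + f') z = poly_eval f z \<oplus>\<^bsub>group_algebra G\<^esub> poly_eval f' z"
proof (induction f f' rule: poly_induct2)
  case (pCons c f c' f')
  have "poly_eval (pCons c f + pCons c' f') z =
      (c + c') \<odot>\<^bsub>group_algebra G\<^esub> \<one>\<^bsub>group_algebra G\<^esub> \<oplus>\<^bsub>group_algebra G\<^esub>
      (z \<otimes>\<^sub>F poly_eval f z \<oplus>\<^bsub>group_algebra G\<^esub> z \<otimes>\<^sub>F poly_eval f' z)"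
    using z pCons by (simp add: poly_eval_pCons A.r_distr poly_eval_closed)
  also have "\<dots> = poly_eval (pCons c f) z \<oplus>\<^bsub>group_algebra G\<^esub> poly_eval (pCons c' f') z"
    unfolding poly_eval_pCons[OF z] by (simp add: group_algebra_simps fun_eq_iff algebra_simps)
  finally show ?case .
qed (simp add: poly_eval_0)

lemma poly_eval_smult:
  assumes z: "z \<in> carrier (group_algebra G)"
  shows "poly_eval (smult c f) z = c \<odot>\<^bsub>group_algebra G\<^esub> poly_eval f z"
proof (induction f rule: pCons_induct)
  case 0
  show ?case
    by (simp add: poly_eval_0 group_algebra_simps)
next
  case (pCons a f)
  have "poly_eval (smult c (pCons a f)) z =
      (c * a) \<odot>\<^bsub>group_algebra G\<^esub> \<one>\<^bsub>group_algebra G\<^esub> \<oplus>\<^bsub>group_algebra G\<^esub>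
      c \<odot>\<^bsub>group_algebra G\<^esub> (z \<otimes>\<^sub>F poly_eval f z)"
    using pCons z by (simp add: poly_eval_pCons group_algebra_smult_mult(2))
  also have "\<dots> = c \<odot>\<^bsub>group_algebra G\<^esub> poly_eval (pCons a f) z"
    unfolding poly_eval_pCons[OF z] group_algebra_simps(4,5) by (simp only: distrib_left mult.assoc)
  finally show ?case .
qed

lemma poly_eval_linear_mult:
  fixes z :: "'a \<Rightarrow> 'k::field"
  assumes z: "z \<in> carrier (group_algebra G)"
  shows "poly_eval ([:- c, 1:] * f) z =
    (z \<ominus>\<^bsub>group_algebra G\<^esub> c \<odot>\<^bsub>group_algebra G\<^esub> \<one>\<^bsub>group_algebra G\<^esub>) \<otimes>\<^sub>F poly_eval f z"
proof -
  let ?A = "group_algebra G :: ('k, 'a \<Rightarrow> 'k) module"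
  note [simp] = z poly_eval_closed[OF z] smult_closed
  have neg: "\<ominus>\<^bsub>?A\<^esub> (c \<odot>\<^bsub>?A\<^esub> \<one>\<^bsub>?A\<^esub>) = (- c) \<odot>\<^bsub>?A\<^esub> \<one>\<^bsub>?A\<^esub>"
    by (rule A.minus_equality) (simp_all, simp add: group_algebra_simps fun_eq_iff)
  have zero: "0 \<odot>\<^bsub>?A\<^esub> \<one>\<^bsub>?A\<^esub> = \<zero>\<^bsub>?A\<^esub>"
    by (simp add: group_algebra_simps)
  have "poly_eval ([:- c, 1:] * f) z = poly_eval (smult (- c) f + pCons 0 f) z"
    by simp
  also have "\<dots> = (- c) \<odot>\<^bsub>?A\<^esub> poly_eval f z \<oplus>\<^bsub>?A\<^esub> z \<otimes>\<^sub>F poly_eval f z"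
    by (simp only: poly_eval_add[OF z] poly_eval_smult[OF z] poly_eval_pCons[OF z] zero) simp
  also have "(- c) \<odot>\<^bsub>?A\<^esub> poly_eval f z = ((- c) \<odot>\<^bsub>?A\<^esub> \<one>\<^bsub>?A\<^esub>) \<otimes>\<^sub>F poly_eval f z"
    by (simp flip: group_algebra_smult_mult(1))
  finally show ?thesis
    unfolding a_minus_def neg by (simp add: A.l_distr A.a_comm)
qed

lemma poly_eval_monom:
  fixes z :: "'a \<Rightarrow> 'k::field"
  assumes z: "z \<in> carrier (group_algebra G)"
  shows "poly_eval (monom c n) z = c \<odot>\<^bsub>group_algebra G\<^esub> (z [^]\<^bsub>group_algebra G\<^esub> n)"
proof (induction n)
  case 0
  show ?case
    using z by (simp add: monom_0 poly_eval_pCons poly_eval_0 smult_closed)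
next
  case (Suc n)
  have "0 \<odot>\<^bsub>group_algebra G\<^esub> \<one>\<^bsub>group_algebra G\<^esub> = (\<zero>\<^bsub>group_algebra G\<^esub> :: 'a \<Rightarrow> 'k)"
    by (simp add: group_algebra_simps)
  then have "poly_eval (monom c (Suc n)) z = z \<otimes>\<^sub>F (c \<odot>\<^bsub>group_algebra G\<^esub> (z [^]\<^bsub>group_algebra G\<^esub> n))"
    using z Suc by (simp add: monom_Suc poly_eval_pCons smult_closed)
  also have "\<dots> = c \<odot>\<^bsub>group_algebra G\<^esub> (z [^]\<^bsub>group_algebra G\<^esub> Suc n)"
    using A.nat_pow_Suc2[OF z] by (simp flip: group_algebra_smult_mult(2) del: A.nat_pow_Suc)
  finally show ?case .
qed

text \<open>The powers of \<open>z\<close> with exponents from 0 up to the order of \<open>G\<close>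
  are one more in number than the dimension, hence linearly dependent.\<close>

lemma annihilating_poly_exists:
  fixes z :: "'a \<Rightarrow> 'k::field"
  assumes z: "z \<in> carrier (group_algebra G)"
  obtains f where "f \<noteq> 0" "poly_eval f z = \<zero>\<^bsub>group_algebra G\<^esub>"
proof -
  let ?v = "\<lambda>i::nat. z [^]\<^bsub>group_algebra G\<^esub> i" and ?N = "card (carrier G)"
  have "?v i \<in> carrier (group_algebra G)" for i
    using z by simp
  then have supp: "?v i g = 0" if "g \<notin> carrier G" for i g
    using that by (simp add: group_algebra_simps)
  obtain c n where c: "c n \<noteq> 0" "n \<le> ?N" "\<And>g. (\<Sum>i\<le>?N. c i * ?v i g) = 0"
    using fun_vs_linear_dependence[OF finite_carrier, of ?v] supp by blast
  let ?f = "\<lambda>N. \<Sum>i\<le>N. monom (c i) i"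
  have "coeff (?f ?N) n = c n"
    using c(2) by (simp add: coeff_sum)
  moreover have "poly_eval (?f N) z g = (\<Sum>i\<le>N. c i * ?v i g)" for N g
    by (induction N) (simp_all add: poly_eval_add[OF z] poly_eval_monom[OF z] group_algebra_simps(4,5))
  ultimately show thesis
    using c(1,3) by (intro that[of "?f ?N"]) (auto simp: group_algebra_simps fun_eq_iff)
qed

lemma smult_one_center: "c \<odot>\<^bsub>group_algebra G\<^esub> \<one>\<^bsub>group_algebra G\<^esub> \<in> center (group_algebra G)"
  by (intro smult_center A.center_closed(2))

text \<open>The quotient of the center by \<open>M\<close> is the ground field. Linear factors are
  split off an annihilating polynomial; as \<open>M\<close> is prime, each step either finds the
  eigenvalue or lowers the degree, and a nonzero constant cannot lie in \<open>M\<close>.\<close>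

lemma eigenvalue_modulo_maximal:
  fixes z :: "'a \<Rightarrow> 'k::alg_closed_field"
  assumes M: "maximal_left_ideal M (center_algebra (group_algebra G))" "\<one>\<^bsub>group_algebra G\<^esub> \<notin> M"
    and z: "z \<in> center (group_algebra G)"
  obtains c where "z \<ominus>\<^bsub>group_algebra G\<^esub> c \<odot>\<^bsub>group_algebra G\<^esub> \<one>\<^bsub>group_algebra G\<^esub> \<in> M"
proof -
  let ?A = "group_algebra G :: ('k, 'a \<Rightarrow> 'k) module"
  interpret Z: cring "center_algebra ?A"
    by (rule A.cring_center)
  have M_ideal: "left_ideal M (center_algebra ?A)"
    using M(1) by (simp add: maximal_left_ideal_def)
  have zc: "z \<in> carrier ?A"
    using z by (rule A.center_carrier)
  have center: "poly_eval f z \<in> center ?A" for f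
    by (induction f rule: pCons_induct)
      (use z zc in \<open>auto simp: poly_eval_0 poly_eval_pCons intro!: A.center_closed smult_one_center\<close>)
  have "\<exists>c. z \<ominus>\<^bsub>?A\<^esub> c \<odot>\<^bsub>?A\<^esub> \<one>\<^bsub>?A\<^esub> \<in> M" if "f \<noteq> 0" "poly_eval f z \<in> M" for f
    using that
  proof (induction "degree f" arbitrary: f rule: less_induct)
    case less
    show ?case
    proof (cases "degree f = 0")
      case True
      then obtain a where a: "f = [:a:]"
        by (metis degree_eq_zeroE)
      then have "a \<noteq> 0" and eval: "poly_eval f z = a \<odot>\<^bsub>?A\<^esub> \<one>\<^bsub>?A\<^esub>"
        using less.prems(1) zc by (simp_all add: poly_eval_pCons poly_eval_0 smult_closed)
      have "(inverse a \<odot>\<^bsub>?A\<^esub> \<one>\<^bsub>?A\<^esub>) \<otimes>\<^sub>F (a \<odot>\<^bsub>?A\<^esub> \<one>\<^bsub>?A\<^esub>) \<in> M"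
        using Z.left_idealD(4)[OF M_ideal, of "inverse a \<odot>\<^bsub>?A\<^esub> \<one>\<^bsub>?A\<^esub>"] less.prems(2)
          smult_one_center[of "inverse a"] unfolding eval by simp
      also have "(inverse a \<odot>\<^bsub>?A\<^esub> \<one>\<^bsub>?A\<^esub>) \<otimes>\<^sub>F (a \<odot>\<^bsub>?A\<^esub> \<one>\<^bsub>?A\<^esub>) = \<one>\<^bsub>?A\<^esub>"
      proof -
        have "(inverse a \<odot>\<^bsub>?A\<^esub> \<one>\<^bsub>?A\<^esub>) \<otimes>\<^sub>F (a \<odot>\<^bsub>?A\<^esub> \<one>\<^bsub>?A\<^esub>) = inverse a \<odot>\<^bsub>?A\<^esub> (a \<odot>\<^bsub>?A\<^esub> \<one>\<^bsub>?A\<^esub>)"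
          by (simp add: smult_closed flip: group_algebra_smult_mult(1))
        also have "\<dots> = \<one>\<^bsub>?A\<^esub>"
          using \<open>a \<noteq> 0\<close> by (simp add: group_algebra_simps fun_eq_iff)
        finally show ?thesis .
      qed
      finally show ?thesis
        using M(2) by simp
    next
      case False
      then obtain c where "poly f c = 0"
        using alg_closed_imp_poly_has_root[of f] by auto
      then obtain g where g: "f = [:- c, 1:] * g"
        by (metis dvdE poly_eq_0_iff_dvd)
      then have "g \<noteq> 0" "degree g < degree f"
        using less.prems(1) by (auto simp: degree_mult_eq simp del: mult_pCons_left)
      have "(z \<ominus>\<^bsub>?A\<^esub> c \<odot>\<^bsub>?A\<^esub> \<one>\<^bsub>?A\<^esub>) \<otimes>\<^sub>F poly_eval g z \<in> M"
        using less.prems(2) unfolding g poly_eval_linear_mult[OF zc] .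
      moreover have "z \<ominus>\<^bsub>?A\<^esub> c \<odot>\<^bsub>?A\<^esub> \<one>\<^bsub>?A\<^esub> \<in> center ?A"
        using z smult_one_center by (rule A.center_closed)
      ultimately have "z \<ominus>\<^bsub>?A\<^esub> c \<odot>\<^bsub>?A\<^esub> \<one>\<^bsub>?A\<^esub> \<in> M \<or> poly_eval g z \<in> M"
        using Z.maximal_left_ideal_prime[OF M(1)] center by simp
      then show ?thesis
        using less.hyps[OF \<open>degree g < degree f\<close> \<open>g \<noteq> 0\<close>] by blast
    qed
  qed
  moreover obtain f where f: "f \<noteq> 0" "poly_eval f z = \<zero>\<^bsub>?A\<^esub>"
    by (rule annihilating_poly_exists[OF zc])
  moreover have "poly_eval f z \<in> M"
    using Z.left_idealD(2)[OF M_ideal] unfolding f(2) by simp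
  ultimately show thesis
    using that by blast
qed

end

section \<open>Algebra homomorphisms and existence of central characters\<close>

lemma alg_homI:
  assumes "f \<in> ring_hom A B" "\<And>c x. x \<in> carrier A \<Longrightarrow> f (c \<odot>\<^bsub>A\<^esub> x) = c \<odot>\<^bsub>B\<^esub> f x"
  shows "f \<in> alg_hom A B"
  using assms by (simp add: alg_hom_def)

lemma alg_homD:
  assumes "f \<in> alg_hom A B"
  shows "f \<in> ring_hom A B" "x \<in> carrier A \<Longrightarrow> f (c \<odot>\<^bsub>A\<^esub> x) = c \<odot>\<^bsub>B\<^esub> f x"
  using assms by (auto simp: alg_hom_def)

context finite_group
begin

interpretation A: ring "group_algebra G :: ('k::field, 'a \<Rightarrow> 'k) module"
  by (rule ring_group_algebra)

lemma smult_one_mult: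
  "x \<in> carrier (group_algebra G) \<Longrightarrow>
    (c \<odot>\<^bsub>group_algebra G\<^esub> \<one>\<^bsub>group_algebra G\<^esub>) \<otimes>\<^sub>F x = c \<odot>\<^bsub>group_algebra G\<^esub> x"
  by (simp flip: group_algebra_smult_mult(1))

text \<open>The character sends \<open>z\<close> to its eigenvalue modulo a maximal ideal
  \<open>M\<close> of the center. Choosing \<open>M\<close> above the annihilator of
  \<open>e\<close> puts \<open>e - 1\<close> into \<open>M\<close>, so the value at \<open>e\<close>
  is 1.\<close>

lemma central_character_exists:
  fixes e :: "'a \<Rightarrow> 'k::alg_closed_field"
  assumes e: "central_idempotent (group_algebra G) e" "e \<noteq> \<zero>\<^bsub>group_algebra G\<^esub>"
  obtains \<omega> where "\<omega> \<in> alg_hom (center_algebra (group_algebra G)) base_algebra" "\<omega> e = 1"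
proof -
  let ?A = "group_algebra G :: ('k, 'a \<Rightarrow> 'k) module"
  let ?Z = "center_algebra ?A"
  let ?s = "\<lambda>c. c \<odot>\<^bsub>?A\<^esub> \<one>\<^bsub>?A\<^esub>"
  interpret Z: cring ?Z
    by (rule A.cring_center)
  note e' = A.central_idempotentD[OF e(1)]
  have cc: "x \<in> carrier ?A" if "x \<in> center ?A" for x
    using that by (rule A.center_carrier)
  have fl: "finite_length ?Z"
    using finite_length_center_corner[OF A.central_idempotent_zero_one(2)] by (simp add: A.corner_one)
  let ?L = "{x \<in> center ?A. e \<otimes>\<^sub>F x = \<zero>\<^bsub>?A\<^esub>}"
  have L: "left_ideal ?L ?Z"
  proof (rule Z.left_idealI)
    show "r \<otimes>\<^bsub>?Z\<^esub> x \<in> ?L" if "r \<in> carrier ?Z" "x \<in> ?L" for r x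
    proof -
      have rx: "r \<in> center ?A" "x \<in> center ?A" "e \<otimes>\<^sub>F x = \<zero>\<^bsub>?A\<^esub>"
        using that by auto
      have "e \<otimes>\<^sub>F (r \<otimes>\<^sub>F x) = e \<otimes>\<^sub>F (x \<otimes>\<^sub>F r)"
        using A.center_commute[OF rx(1) cc[OF rx(2)]] by simp
      also have "\<dots> = \<zero>\<^bsub>?A\<^esub> \<otimes>\<^sub>F r"
        using e'(2) cc[OF rx(1)] cc[OF rx(2)] rx(3) by (simp flip: A.m_assoc)
      finally show ?thesis
        using rx cc[OF rx(1)] A.center_closed(6)[OF rx(1,2)] by simp
    qed
  qed (use e'(2) in \<open>auto simp: A.center_closed A.r_distr cc\<close>)
  have "\<one>\<^bsub>?Z\<^esub> \<notin> ?L"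
    using e(2) e'(2) by simp
  then obtain M where M: "maximal_left_ideal M ?Z" "?L \<subseteq> M" "\<one>\<^bsub>?A\<^esub> \<notin> M"
    using Z.proper_in_maximal[OF fl L] by auto
  have M_ideal: "left_ideal M ?Z"
    using M(1) by (simp add: maximal_left_ideal_def)
  have M_add: "x \<oplus>\<^bsub>?A\<^esub> y \<in> M" if "x \<in> M" "y \<in> M" for x y
    using Z.left_idealD(3)[OF M_ideal that] by simp
  have M_mult: "r \<otimes>\<^sub>F x \<in> M" if "r \<in> center ?A" "x \<in> M" for r x
    using Z.left_idealD(4)[OF M_ideal, of r x] that by simp
  have M_center: "x \<in> center ?A" if "x \<in> M" for x
    using Z.left_idealD(7)[OF M_ideal that] by simp
  define \<omega> where "\<omega> z = (SOME c. z \<ominus>\<^bsub>?A\<^esub> ?s c \<in> M)" for z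
  have \<omega>: "z \<ominus>\<^bsub>?A\<^esub> ?s (\<omega> z) \<in> M" if "z \<in> center ?A" for z
    using eigenvalue_modulo_maximal[OF M(1,3) that] unfolding \<omega>_def by (metis (mono_tags, lifting) someI)
  have minus: "(x \<ominus>\<^bsub>?A\<^esub> y) g = x g - y g" if "x \<in> carrier ?A" "y \<in> carrier ?A" for x y g
  proof -
    have "\<ominus>\<^bsub>?A\<^esub> y = (\<lambda>g. - y g)"
      using that by (intro A.minus_equality) (auto simp: group_algebra_simps)
    then show ?thesis
      by (simp add: a_minus_def group_algebra_simps)
  qed
  have s_in_M: "c = 0" if "?s c \<in> M" for c
  proof (rule ccontr)
    assume "c \<noteq> 0"
    have "?s (inverse c) \<otimes>\<^sub>F ?s c = \<one>\<^bsub>?A\<^esub>"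
      using \<open>c \<noteq> 0\<close> by (subst smult_one_mult) (simp_all add: smult_closed, simp add: group_algebra_simps fun_eq_iff)
    then show False
      using M_mult[OF smult_one_center that, of "inverse c"] M(3) by simp
  qed
  \<comment> \<open>Eigenvalues are unique: two of them differ by a scalar multiple of 1 in
    \<open>M\<close>, which forces the scalar to vanish. All homomorphism laws reduce to exhibiting
    an element of \<open>M\<close>.\<close>
  have \<omega>_eqI: "\<omega> z = c" if "z \<in> center ?A" "z \<ominus>\<^bsub>?A\<^esub> ?s c \<in> M" for z c
  proof -
    note [simp] = cc[OF that(1)] smult_closed
    have "?s (- 1) \<otimes>\<^sub>F (z \<ominus>\<^bsub>?A\<^esub> ?s (\<omega> z)) \<in> M"
      by (rule M_mult[OF smult_one_center \<omega>[OF that(1)]])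
    from M_add[OF that(2) this] have "(z \<ominus>\<^bsub>?A\<^esub> ?s c) \<oplus>\<^bsub>?A\<^esub> ?s (- 1) \<otimes>\<^sub>F (z \<ominus>\<^bsub>?A\<^esub> ?s (\<omega> z)) \<in> M" .
    also have "(z \<ominus>\<^bsub>?A\<^esub> ?s c) \<oplus>\<^bsub>?A\<^esub> ?s (- 1) \<otimes>\<^sub>F (z \<ominus>\<^bsub>?A\<^esub> ?s (\<omega> z)) = ?s (\<omega> z - c)"
      by (subst smult_one_mult, simp, rule ext, simp add: minus group_algebra_simps(4,5)[THEN fun_cong] algebra_simps)
    finally show ?thesis
      using s_in_M by fastforce
  qed
  have "\<omega> \<in> alg_hom ?Z base_algebra"
  proof (intro alg_homI ring_hom_memI)
    fix x y assume "x \<in> carrier ?Z" "y \<in> carrier ?Z"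
    then have xy: "x \<in> center ?A" "y \<in> center ?A"
      by auto
    note [simp] = cc[OF xy(1)] cc[OF xy(2)] smult_closed
    show "\<omega> (x \<oplus>\<^bsub>?Z\<^esub> y) = \<omega> x \<oplus>\<^bsub>base_algebra\<^esub> \<omega> y"
    proof -
      have "(x \<oplus>\<^bsub>?A\<^esub> y) \<ominus>\<^bsub>?A\<^esub> ?s (\<omega> x + \<omega> y) = (x \<ominus>\<^bsub>?A\<^esub> ?s (\<omega> x)) \<oplus>\<^bsub>?A\<^esub> (y \<ominus>\<^bsub>?A\<^esub> ?s (\<omega> y))"
        by (rule ext, simp add: minus group_algebra_simps(4,5)[THEN fun_cong] algebra_simps)
      then have "(x \<oplus>\<^bsub>?A\<^esub> y) \<ominus>\<^bsub>?A\<^esub> ?s (\<omega> x + \<omega> y) \<in> M"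
        using M_add[OF \<omega>[OF xy(1)] \<omega>[OF xy(2)]] by simp
      then have "\<omega> (x \<oplus>\<^bsub>?A\<^esub> y) = \<omega> x + \<omega> y"
        using xy by (intro \<omega>_eqI A.center_closed)
      then show ?thesis
        by (simp add: base_algebra_def)
    qed
    show "\<omega> (x \<otimes>\<^bsub>?Z\<^esub> y) = \<omega> x \<otimes>\<^bsub>base_algebra\<^esub> \<omega> y"
    proof -
      have 1: "x \<otimes>\<^sub>F (y \<ominus>\<^bsub>?A\<^esub> ?s (\<omega> y)) = x \<otimes>\<^sub>F y \<ominus>\<^bsub>?A\<^esub> \<omega> y \<odot>\<^bsub>?A\<^esub> x"
        by (simp add: a_minus_def A.r_distr A.r_minus flip: group_algebra_smult_mult(2))
      have 2: "?s (\<omega> y) \<otimes>\<^sub>F (x \<ominus>\<^bsub>?A\<^esub> ?s (\<omega> x)) = \<omega> y \<odot>\<^bsub>?A\<^esub> (x \<ominus>\<^bsub>?A\<^esub> ?s (\<omega> x))"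
        by (rule smult_one_mult) simp
      have "x \<otimes>\<^sub>F y \<ominus>\<^bsub>?A\<^esub> ?s (\<omega> x * \<omega> y) =
          x \<otimes>\<^sub>F (y \<ominus>\<^bsub>?A\<^esub> ?s (\<omega> y)) \<oplus>\<^bsub>?A\<^esub> ?s (\<omega> y) \<otimes>\<^sub>F (x \<ominus>\<^bsub>?A\<^esub> ?s (\<omega> x))"
        unfolding 1 2 by (rule ext, simp add: minus group_algebra_simps(4,5)[THEN fun_cong] algebra_simps)
      also have "\<dots> \<in> M"
        by (intro M_add M_mult \<omega> xy smult_one_center)
      finally have "\<omega> (x \<otimes>\<^sub>F y) = \<omega> x * \<omega> y"
        using xy by (intro \<omega>_eqI A.center_closed)
      then show ?thesis
        by (simp add: base_algebra_def)
    qed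
    show "\<omega> (c \<odot>\<^bsub>?Z\<^esub> x) = c \<odot>\<^bsub>base_algebra\<^esub> \<omega> x" for c
    proof -
      have 1: "?s c \<otimes>\<^sub>F (x \<ominus>\<^bsub>?A\<^esub> ?s (\<omega> x)) = c \<odot>\<^bsub>?A\<^esub> (x \<ominus>\<^bsub>?A\<^esub> ?s (\<omega> x))"
        by (rule smult_one_mult) simp
      have "c \<odot>\<^bsub>?A\<^esub> x \<ominus>\<^bsub>?A\<^esub> ?s (c * \<omega> x) = ?s c \<otimes>\<^sub>F (x \<ominus>\<^bsub>?A\<^esub> ?s (\<omega> x))"
        unfolding 1 by (rule ext, simp add: minus group_algebra_simps(4,5)[THEN fun_cong] algebra_simps)
      also have "\<dots> \<in> M"
        by (intro M_mult \<omega> xy smult_one_center)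
      finally have "\<omega> (c \<odot>\<^bsub>?A\<^esub> x) = c * \<omega> x"
        using xy by (intro \<omega>_eqI smult_center)
      then show ?thesis
        by (simp add: base_algebra_def)
    qed
  next
    have "\<one>\<^bsub>?A\<^esub> \<ominus>\<^bsub>?A\<^esub> ?s 1 = \<zero>\<^bsub>?A\<^esub>"
      by (rule ext, simp add: smult_closed minus, simp add: group_algebra_simps)
    then have "\<omega> \<one>\<^bsub>?A\<^esub> = 1"
      using Z.left_idealD(2)[OF M_ideal] by (intro \<omega>_eqI A.center_closed) simp
    then show "\<omega> \<one>\<^bsub>?Z\<^esub> = \<one>\<^bsub>base_algebra\<^esub>"
      by (simp add: base_algebra_def)
  qed (simp add: base_algebra_def)
  moreover have "\<omega> e = 1"
  proof (rule \<omega>_eqI[OF e'(1)])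
    have "e \<ominus>\<^bsub>?A\<^esub> ?s 1 = e \<ominus>\<^bsub>?A\<^esub> \<one>\<^bsub>?A\<^esub>"
      by (simp add: group_algebra_simps)
    also have "\<dots> \<in> ?L"
      using e'(1,2,3) by (simp add: A.center_closed a_minus_def A.r_distr A.r_minus A.r_neg)
    finally show "e \<ominus>\<^bsub>?A\<^esub> ?s 1 \<in> M"
      using M(2) by blast
  qed
  ultimately show thesis
    by (rule that)
qed

section \<open>Centralizers and the Brauer homomorphism\<close>

lemma centralizer_iff: "x \<in> centralizer G u \<longleftrightarrow> x \<in> carrier G \<and> x \<otimes> u = u \<otimes> x"
  by (simp add: centralizer_def)

lemma subgroup_centralizer:
  assumes u: "u \<in> carrier G"
  shows "subgroup (centralizer G u) G"
proof
  show "x \<otimes> y \<in> centralizer G u" if xy: "x \<in> centralizer G u" "y \<in> centralizer G u" for x y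
  proof -
    have "x \<otimes> y \<otimes> u = x \<otimes> (u \<otimes> y)"
      using xy u by (simp add: centralizer_iff m_assoc)
    also have "\<dots> = u \<otimes> x \<otimes> y"
      using xy u by (simp add: centralizer_iff flip: m_assoc)
    also have "\<dots> = u \<otimes> (x \<otimes> y)"
      using xy u by (simp add: centralizer_iff m_assoc)
    finally show ?thesis
      using xy by (simp add: centralizer_iff)
  qed
  show "inv x \<in> centralizer G u" if x: "x \<in> centralizer G u" for x
  proof -
    have xc: "x \<in> carrier G" "x \<otimes> u = u \<otimes> x"
      using x by (auto simp: centralizer_iff)
    have "inv x \<otimes> u = inv x \<otimes> (u \<otimes> x) \<otimes> inv x"
      using xc(1) u by (simp add: m_assoc)
    also have "\<dots> = u \<otimes> inv x"
      unfolding xc(2)[symmetric] using xc(1) u by simp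
    finally show ?thesis
      using xc(1) by (simp add: centralizer_iff)
  qed
qed (use u in \<open>auto simp: centralizer_iff\<close>)

lemma finite_group_centralizer:
  assumes "u \<in> carrier G"
  shows "finite_group (G\<lparr>carrier := centralizer G u\<rparr>)"
proof -
  interpret C: group "G\<lparr>carrier := centralizer G u\<rparr>"
    using subgroup.subgroup_is_group[OF subgroup_centralizer[OF assms] is_group] .
  show ?thesis
    by unfold_locales (auto simp: centralizer_def)
qed

lemma brauer_hom_apply: "brauer_hom G u z g = (if g \<in> centralizer G u then z g else 0)"
  by (simp add: brauer_hom_def restrict_to_def)

lemma brauer_hom_center:
  fixes z :: "'a \<Rightarrow> 'k::field"
  assumes u: "u \<in> carrier G" and z: "z \<in> center (group_algebra G)"
  shows "brauer_hom G u z \<in> center (subgroup_algebra G (centralizer G u))"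
proof -
  interpret C: finite_group "G\<lparr>carrier := centralizer G u\<rparr>"
    by (rule finite_group_centralizer[OF u])
  have "x \<otimes> y \<in> centralizer G u" if "x \<in> centralizer G u" "y \<in> centralizer G u" for x y
    using subgroup.m_closed[OF subgroup_centralizer[OF u] that] .
  then show ?thesis
    using z unfolding center_group_algebra_iff C.center_group_algebra_iff
    by (auto simp: group_algebra_simps brauer_hom_apply centralizer_iff)
qed

lemma brauer_hom_add:
  "brauer_hom G u (z \<oplus>\<^bsub>group_algebra G\<^esub> w) =
    brauer_hom G u z \<oplus>\<^bsub>subgroup_algebra G (centralizer G u)\<^esub> brauer_hom G u w"
  by (rule ext) (simp add: brauer_hom_apply group_algebra_simps)

lemma brauer_hom_smult:
  "brauer_hom G u (c \<odot>\<^bsub>group_algebra G\<^esub> z) =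
    c \<odot>\<^bsub>subgroup_algebra G (centralizer G u)\<^esub> brauer_hom G u z"
  by (rule ext) (simp add: brauer_hom_apply group_algebra_simps)

lemma brauer_hom_one:
  assumes "u \<in> carrier G"
  shows "brauer_hom G u \<one>\<^bsub>group_algebra G\<^esub> = \<one>\<^bsub>subgroup_algebra G (centralizer G u)\<^esub>"
  by (rule ext) (use assms in \<open>auto simp: brauer_hom_apply group_algebra_simps centralizer_iff\<close>)

text \<open>Conjugation by \<open>u\<close> permutes the factorizations of an element of \<open>C\<^sub>G(u)\<close>.\<close>

lemma brauer_hom_mult:
  fixes z w :: "'a \<Rightarrow> 'k::field"
  assumes p: "CHAR('k) = p" "prime p" and u: "u \<in> carrier G" "u [^] (p ^ n) = \<one>"
    and z: "z \<in> center (group_algebra G)" and w: "w \<in> center (group_algebra G)"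
  shows "brauer_hom G u (z \<otimes>\<^sub>F w) =
    brauer_hom G u z \<otimes>\<^bsub>subgroup_algebra G (centralizer G u)\<^esub> brauer_hom G u w"
proof
  fix c
  let ?C = "centralizer G u"
  interpret C: subgroup ?C G
    by (rule subgroup_centralizer[OF u(1)])
  show "brauer_hom G u (z \<otimes>\<^sub>F w) c =
    (brauer_hom G u z \<otimes>\<^bsub>subgroup_algebra G ?C\<^esub> brauer_hom G u w) c"
  proof (cases "c \<in> ?C")
    case False
    then have empty: "{(x, y) \<in> ?C \<times> ?C. x \<otimes> y = c} = {}"
      by auto
    have "(brauer_hom G u z \<otimes>\<^bsub>subgroup_algebra G ?C\<^esub> brauer_hom G u w) c =
        (\<Sum>(x, y) \<in> {(x, y) \<in> ?C \<times> ?C. x \<otimes> y = c}. brauer_hom G u z x * brauer_hom G u w y)"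
      by (simp add: group_algebra_def)
    then show ?thesis
      using False unfolding empty by (simp add: brauer_hom_apply)
  next
    case True
    then have c: "c \<in> carrier G" "c \<otimes> u = u \<otimes> c"
      by (auto simp: centralizer_iff)
    let ?X = "{(x, y) \<in> carrier G \<times> carrier G. x \<otimes> y = c}"
    let ?h = "\<lambda>(x, y). z x * w y"
    define \<sigma> where "\<sigma> = (\<lambda>(x, y). (u \<otimes> x \<otimes> inv u, u \<otimes> y \<otimes> inv u))"
    have conj: "f (u \<otimes> x \<otimes> inv u) = f x" if "f \<in> center (group_algebra G)" "x \<in> carrier G"
      for f :: "'a \<Rightarrow> 'k" and x
    proof -
      have "f ((u \<otimes> x) \<otimes> inv u) = f (inv u \<otimes> (u \<otimes> x))"
        using that u(1) unfolding center_group_algebra_iff by blast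
      then show ?thesis
        using that(2) u(1) by simp
    qed
    have iter: "(\<sigma> ^^ k) (x, y) = (u [^] k \<otimes> x \<otimes> inv (u [^] k), u [^] k \<otimes> y \<otimes> inv (u [^] k))"
      if "x \<in> carrier G" "y \<in> carrier G" for k x y
    proof (induction k)
      case (Suc k)
      have "(\<sigma> ^^ Suc k) (x, y) = \<sigma> (u [^] k \<otimes> x \<otimes> inv (u [^] k), u [^] k \<otimes> y \<otimes> inv (u [^] k))"
        using Suc by simp
      also have "\<dots> = (u [^] Suc k \<otimes> x \<otimes> inv (u [^] Suc k), u [^] Suc k \<otimes> y \<otimes> inv (u [^] Suc k))"
        using that u(1) nat_pow_Suc2[OF u(1), of k]
        by (simp add: \<sigma>_def m_assoc inv_mult_group del: nat_pow_Suc)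
      finally show ?case .
    qed (use that in simp)
    have fixed: "u \<otimes> x \<otimes> inv u = x \<longleftrightarrow> x \<otimes> u = u \<otimes> x" if "x \<in> carrier G" for x
      using inv_solve_right'[of x "u \<otimes> x" u] that u(1) by (auto simp del: r_cancel_one r_cancel_one')
    have "(z \<otimes>\<^sub>F w) c = sum ?h ?X"
      by (simp add: group_algebra_def)
    also have "\<dots> = sum ?h {s \<in> ?X. \<sigma> s = s}"
    proof (rule sum_eq_sum_fixed_points[OF p, of ?X \<sigma> n])
      show "finite ?X"
        by (rule finite_subset[of _ "carrier G \<times> carrier G"]) auto
      fix s assume "s \<in> ?X"
      then obtain x y where s: "s = (x, y)" "x \<in> carrier G" "y \<in> carrier G" "x \<otimes> y = c"
        by blast
      have "(u \<otimes> x \<otimes> inv u) \<otimes> (u \<otimes> y \<otimes> inv u) = u \<otimes> (x \<otimes> y) \<otimes> inv u"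
        using s(2,3) u(1) by (simp add: m_assoc)
      also have "\<dots> = c"
        using fixed[OF c(1)] c(2) s(4) by simp
      finally show "\<sigma> s \<in> ?X"
        using s(1-3) u(1) by (simp add: \<sigma>_def)
      show "(\<sigma> ^^ (p ^ n)) s = s"
        using iter[OF s(2,3), of "p ^ n"] s(1-3) u(2) by simp
      show "?h (\<sigma> s) = ?h s"
        using conj[OF z s(2)] conj[OF w s(3)] by (simp add: \<sigma>_def s(1))
    qed
    \<comment> \<open>A factorization is fixed by conjugation with \<open>u\<close> exactly when
      both factors centralize \<open>u\<close>, so what remains is the product in the smaller group
      algebra.\<close>
    also have "{s \<in> ?X. \<sigma> s = s} = {(x, y) \<in> ?C \<times> ?C. x \<otimes> y = c}"
      using fixed by (auto simp: \<sigma>_def centralizer_iff)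
    also have "sum ?h \<dots> = (\<Sum>(x, y) \<in> {(x, y) \<in> ?C \<times> ?C. x \<otimes> y = c}. brauer_hom G u z x * brauer_hom G u w y)"
      by (intro sum.cong) (auto simp: brauer_hom_apply)
    also have "\<dots> = (brauer_hom G u z \<otimes>\<^bsub>subgroup_algebra G ?C\<^esub> brauer_hom G u w) c"
      by (simp add: group_algebra_def)
    finally show ?thesis
      using True by (simp add: brauer_hom_apply)
  qed
qed

end

section \<open>Quotients and direct sums\<close>

text \<open>What makes the union defining scalar multiplication in \<open>quot_algebra\<close>
  collapse to a single coset.\<close>

definition scalar_compatible :: "('k::field, 'a) module \<Rightarrow> 'a set \<Rightarrow> bool"
  where "scalar_compatible A I \<longleftrightarrow>
    (\<forall>c. \<forall>x\<in>carrier A. c \<odot>\<^bsub>A\<^esub> x \<in> carrier A) \<and>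
    (\<forall>c. \<forall>x\<in>carrier A. \<forall>y\<in>carrier A. c \<odot>\<^bsub>A\<^esub> (x \<oplus>\<^bsub>A\<^esub> y) = c \<odot>\<^bsub>A\<^esub> x \<oplus>\<^bsub>A\<^esub> c \<odot>\<^bsub>A\<^esub> y) \<and>
    (\<forall>c. \<forall>x\<in>I. c \<odot>\<^bsub>A\<^esub> x \<in> I)"

lemma coset_iff: "y \<in> I +>\<^bsub>A\<^esub> x \<longleftrightarrow> (\<exists>i\<in>I. y = i \<oplus>\<^bsub>A\<^esub> x)"
  by (auto simp: a_r_coset_def r_coset_def)

lemma quot_algebra_simps:
  assumes "cring A" "ideal I A"
  shows "carrier (quot_algebra A I) = (\<lambda>x. I +>\<^bsub>A\<^esub> x) ` carrier A"
    "x \<in> carrier A \<Longrightarrow> y \<in> carrier A \<Longrightarrow>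
      (I +>\<^bsub>A\<^esub> x) \<otimes>\<^bsub>quot_algebra A I\<^esub> (I +>\<^bsub>A\<^esub> y) = I +>\<^bsub>A\<^esub> (x \<otimes>\<^bsub>A\<^esub> y)"
    "x \<in> carrier A \<Longrightarrow> y \<in> carrier A \<Longrightarrow>
      (I +>\<^bsub>A\<^esub> x) \<oplus>\<^bsub>quot_algebra A I\<^esub> (I +>\<^bsub>A\<^esub> y) = I +>\<^bsub>A\<^esub> (x \<oplus>\<^bsub>A\<^esub> y)"
    "\<one>\<^bsub>quot_algebra A I\<^esub> = I +>\<^bsub>A\<^esub> \<one>\<^bsub>A\<^esub>"
    "\<zero>\<^bsub>quot_algebra A I\<^esub> = I +>\<^bsub>A\<^esub> \<zero>\<^bsub>A\<^esub>"
    "\<zero>\<^bsub>quot_algebra A I\<^esub> = I"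
    "scalar_compatible A I \<Longrightarrow> x \<in> carrier A \<Longrightarrow>
      c \<odot>\<^bsub>quot_algebra A I\<^esub> (I +>\<^bsub>A\<^esub> x) = I +>\<^bsub>A\<^esub> (c \<odot>\<^bsub>A\<^esub> x)"
proof -
  interpret A: cring A by (rule assms(1))
  interpret I: ideal I A by (rule assms(2))
  show "carrier (quot_algebra A I) = (\<lambda>x. I +>\<^bsub>A\<^esub> x) ` carrier A"
    by (auto simp: quot_algebra_def FactRing_simps)
  show "x \<in> carrier A \<Longrightarrow> y \<in> carrier A \<Longrightarrow>
      (I +>\<^bsub>A\<^esub> x) \<otimes>\<^bsub>quot_algebra A I\<^esub> (I +>\<^bsub>A\<^esub> y) = I +>\<^bsub>A\<^esub> (x \<otimes>\<^bsub>A\<^esub> y)"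
    by (simp add: quot_algebra_def FactRing_def I.rcoset_mult_add)
  show "x \<in> carrier A \<Longrightarrow> y \<in> carrier A \<Longrightarrow>
      (I +>\<^bsub>A\<^esub> x) \<oplus>\<^bsub>quot_algebra A I\<^esub> (I +>\<^bsub>A\<^esub> y) = I +>\<^bsub>A\<^esub> (x \<oplus>\<^bsub>A\<^esub> y)"
    by (simp add: quot_algebra_def FactRing_def I.a_rcos_sum)
  show "\<one>\<^bsub>quot_algebra A I\<^esub> = I +>\<^bsub>A\<^esub> \<one>\<^bsub>A\<^esub>" "\<zero>\<^bsub>quot_algebra A I\<^esub> = I"
    by (simp_all add: quot_algebra_def FactRing_def)
  then show "\<zero>\<^bsub>quot_algebra A I\<^esub> = I +>\<^bsub>A\<^esub> \<zero>\<^bsub>A\<^esub>"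
    using I.a_rcos_const[OF I.zero_closed] by simp
  assume sc: "scalar_compatible A I" and x: "x \<in> carrier A"
  have "I +>\<^bsub>A\<^esub> (c \<odot>\<^bsub>A\<^esub> y) = I +>\<^bsub>A\<^esub> (c \<odot>\<^bsub>A\<^esub> x)" if y: "y \<in> I +>\<^bsub>A\<^esub> x" for y
  proof -
    obtain i where i: "i \<in> I" "y = i \<oplus>\<^bsub>A\<^esub> x"
      using y by (auto simp: coset_iff)
    have "c \<odot>\<^bsub>A\<^esub> y = c \<odot>\<^bsub>A\<^esub> i \<oplus>\<^bsub>A\<^esub> c \<odot>\<^bsub>A\<^esub> x"
      using sc x I.Icarr[OF i(1)] unfolding scalar_compatible_def i(2) by blast
    moreover have "c \<odot>\<^bsub>A\<^esub> i \<in> I" "c \<odot>\<^bsub>A\<^esub> x \<in> carrier A"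
      using sc x i(1) unfolding scalar_compatible_def by blast+
    ultimately show ?thesis
      by (intro I.a_repr_independence'[symmetric]) (auto simp: coset_iff)
  qed
  then have "(\<Union>y\<in>I +>\<^bsub>A\<^esub> x. I +>\<^bsub>A\<^esub> (c \<odot>\<^bsub>A\<^esub> y)) = I +>\<^bsub>A\<^esub> (c \<odot>\<^bsub>A\<^esub> x)"
    using I.a_rcos_self[OF x] by blast
  then show "c \<odot>\<^bsub>quot_algebra A I\<^esub> (I +>\<^bsub>A\<^esub> x) = I +>\<^bsub>A\<^esub> (c \<odot>\<^bsub>A\<^esub> x)"
    by (simp add: quot_algebra_def)
qed

lemma cring_quot_algebra:
  assumes "cring A" "ideal I A"
  shows "cring (quot_algebra A I)"
proof -
  interpret A: cring A by (rule assms(1))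
  interpret I: ideal I A by (rule assms(2))
  note Q = quot_algebra_simps[OF assms]
  show ?thesis
  proof (rule cringI)
    show "abelian_group (quot_algebra A I)"
    proof (rule abelian_groupI)
      fix S assume "S \<in> carrier (quot_algebra A I)"
      then obtain x where x: "x \<in> carrier A" "S = I +>\<^bsub>A\<^esub> x"
        unfolding Q(1) by blast
      then have "(I +>\<^bsub>A\<^esub> (\<ominus>\<^bsub>A\<^esub> x)) \<oplus>\<^bsub>quot_algebra A I\<^esub> S = \<zero>\<^bsub>quot_algebra A I\<^esub>"
        by (simp add: Q(3,5) A.l_neg)
      then show "\<exists>T\<in>carrier (quot_algebra A I). T \<oplus>\<^bsub>quot_algebra A I\<^esub> S = \<zero>\<^bsub>quot_algebra A I\<^esub>"
        using x(1) unfolding Q(1) by blast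
    qed (auto simp: Q(1,3,5) A.a_ac)
    show "comm_monoid (quot_algebra A I)"
      by (rule comm_monoidI) (auto simp: Q(1,2,4) A.m_ac)
  qed (auto simp: Q(1,2,3) A.l_distr)
qed

text \<open>The measure of a left ideal of the quotient is that of its preimage; taking preimages
  preserves strict inclusion as every member of the quotient is a coset.\<close>

lemma finite_length_quot_algebra:
  fixes A :: "('k::field, 'a) module"
  assumes A: "cring A" "ideal I A" and fl: "finite_length A"
  shows "finite_length (quot_algebra A I)"
proof -
  interpret A: cring A by (rule A(1))
  interpret I: ideal I A by (rule A(2))
  interpret Q: cring "quot_algebra A I" by (rule cring_quot_algebra[OF A])
  note Q = quot_algebra_simps[OF A]
  obtain len :: "'a set \<Rightarrow> nat"
    where len: "\<And>L L'. left_ideal L A \<Longrightarrow> left_ideal L' A \<Longrightarrow> L \<subset> L' \<Longrightarrow> len L < len L'"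
    using fl unfolding finite_length_def by blast
  define pre where "pre L = {x \<in> carrier A. I +>\<^bsub>A\<^esub> x \<in> L}" for L
  have pre: "left_ideal (pre L) A" if L: "left_ideal L (quot_algebra A I)" for L
  proof (rule A.left_idealI)
    show "\<zero>\<^bsub>A\<^esub> \<in> pre L"
      using Q.left_idealD(2)[OF L] by (simp add: pre_def Q(5))
    show "x \<oplus>\<^bsub>A\<^esub> y \<in> pre L" if "x \<in> pre L" "y \<in> pre L" for x y
      using that Q.left_idealD(3)[OF L, of "I +>\<^bsub>A\<^esub> x" "I +>\<^bsub>A\<^esub> y"] by (simp add: pre_def Q(3))
    show "r \<otimes>\<^bsub>A\<^esub> x \<in> pre L" if "r \<in> carrier A" "x \<in> pre L" for r x
      using that Q.left_idealD(4)[OF L, of "I +>\<^bsub>A\<^esub> r" "I +>\<^bsub>A\<^esub> x"] by (simp add: pre_def Q(1,2))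
  qed (auto simp: pre_def)
  have "pre L \<subset> pre L'"
    if LL': "left_ideal L (quot_algebra A I)" "left_ideal L' (quot_algebra A I)" "L \<subset> L'" for L L'
  proof -
    obtain S where "S \<in> L'" "S \<notin> L"
      using LL'(3) by blast
    moreover from this obtain x where "x \<in> carrier A" "S = I +>\<^bsub>A\<^esub> x"
      using Q.left_idealD(7)[OF LL'(2)] unfolding Q(1) by blast
    ultimately show ?thesis
      using LL'(3) unfolding pre_def by blast
  qed
  then have "len (pre L) < len (pre L')"
    if "left_ideal L (quot_algebra A I)" "left_ideal L' (quot_algebra A I)" "L \<subset> L'" for L L'
    using that pre by (intro len)
  then show ?thesis
    unfolding finite_length_def by (intro exI[of _ "\<lambda>L. len (pre L)"]) auto
qed

text \<open>The last two conditions on \<open>\<phi>\<close> say that \<open>I\<close> is exactly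
  the common preimage of the ideals \<open>I' i\<close>: one inclusion gives well-definedness, the
  other injectivity.\<close>

lemma quot_direct_sum_embedding:
  fixes A :: "('k::field, 'a) module" and A' :: "'i \<Rightarrow> ('k, 'b) module"
  assumes A: "cring A" "ideal I A" "scalar_compatible A I"
    and A': "\<And>i. i \<in> N \<Longrightarrow> cring (A' i)" "\<And>i. i \<in> N \<Longrightarrow> ideal (I' i) (A' i)"
      "\<And>i. i \<in> N \<Longrightarrow> scalar_compatible (A' i) (I' i)"
    and \<phi>: "\<And>i. i \<in> N \<Longrightarrow> \<phi> i \<in> alg_hom A (A' i)"
      "\<And>i x. i \<in> N \<Longrightarrow> x \<in> I \<Longrightarrow> \<phi> i x \<in> I' i"
      "\<And>x. x \<in> carrier A \<Longrightarrow> (\<And>i. i \<in> N \<Longrightarrow> \<phi> i x \<in> I' i) \<Longrightarrow> x \<in> I"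
  obtains f where "f \<in> alg_hom (quot_algebra A I) (direct_sum_algebra N (\<lambda>i. quot_algebra (A' i) (I' i)))"
    "inj_on f (carrier (quot_algebra A I))"
    "\<And>z. z \<in> carrier A \<Longrightarrow> f (I +>\<^bsub>A\<^esub> z) = (\<lambda>i\<in>N. I' i +>\<^bsub>A' i\<^esub> \<phi> i z)"
proof -
  interpret A: cring A by (rule A(1))
  interpret I: ideal I A by (rule A(2))
  note Q = quot_algebra_simps[OF A(1,2)]
  note Q' = quot_algebra_simps[OF A'(1,2)]
  note hom = alg_homD(1)[OF \<phi>(1)]
  have sc: "c \<odot>\<^bsub>A\<^esub> x \<in> carrier A" if "x \<in> carrier A" for c x
    using A(3) that by (simp add: scalar_compatible_def)
  \<comment> \<open>A map on cosets needs a chosen element; \<open>coset_cong\<close> shows that the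
    choice is immaterial.\<close>
  define f where "f S = (\<lambda>i\<in>N. I' i +>\<^bsub>A' i\<^esub> \<phi> i (SOME z. z \<in> S))" for S
  have coset_cong: "I' i +>\<^bsub>A' i\<^esub> \<phi> i y = I' i +>\<^bsub>A' i\<^esub> \<phi> i x"
    if ixy: "i \<in> N" "x \<in> carrier A" "y \<in> I +>\<^bsub>A\<^esub> x" for i x y
  proof -
    interpret I': ideal "I' i" "A' i" by (rule A'(2)[OF that(1)])
    obtain r where r: "r \<in> I" "y = r \<oplus>\<^bsub>A\<^esub> x"
      using ixy(3) by (auto simp: coset_iff)
    then have "\<phi> i y = \<phi> i r \<oplus>\<^bsub>A' i\<^esub> \<phi> i x"
      using ring_hom_add[OF hom[OF that(1)]] that(2) I.Icarr by simp
    then have "\<phi> i y \<in> I' i +>\<^bsub>A' i\<^esub> \<phi> i x"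
      using \<phi>(2)[OF that(1) r(1)] by (auto simp: coset_iff)
    then show ?thesis
      using I'.a_repr_independence' ring_hom_closed[OF hom[OF that(1)] that(2)] by simp
  qed
  have f: "f (I +>\<^bsub>A\<^esub> z) = (\<lambda>i\<in>N. I' i +>\<^bsub>A' i\<^esub> \<phi> i z)" if z: "z \<in> carrier A" for z
  proof -
    have "(SOME y. y \<in> I +>\<^bsub>A\<^esub> z) \<in> I +>\<^bsub>A\<^esub> z"
      using I.a_rcos_self[OF z] by (rule someI)
    then show ?thesis
      unfolding f_def using coset_cong[OF _ z] by (intro restrict_ext) blast
  qed
  have closed: "\<phi> i x \<in> carrier (A' i)" if "i \<in> N" "x \<in> carrier A" for i x
    using ring_hom_closed[OF hom] that by blast
  have "f \<in> alg_hom (quot_algebra A I) (direct_sum_algebra N (\<lambda>i. quot_algebra (A' i) (I' i)))"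
  proof (intro alg_homI ring_hom_memI)
    fix S T assume "S \<in> carrier (quot_algebra A I)" "T \<in> carrier (quot_algebra A I)"
    then obtain x y where xy: "x \<in> carrier A" "S = I +>\<^bsub>A\<^esub> x" "y \<in> carrier A" "T = I +>\<^bsub>A\<^esub> y"
      unfolding Q(1) by blast
    show "f S \<in> carrier (direct_sum_algebra N (\<lambda>i. quot_algebra (A' i) (I' i)))"
      using xy(1) closed unfolding xy(2) f[OF xy(1)]
      by (auto simp: direct_sum_algebra_def Q'(1))
    show "f (S \<otimes>\<^bsub>quot_algebra A I\<^esub> T) =
        f S \<otimes>\<^bsub>direct_sum_algebra N (\<lambda>i. quot_algebra (A' i) (I' i))\<^esub> f T"
      using xy(1,3) closed ring_hom_mult[OF hom] unfolding xy(2,4)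
      by (auto simp: direct_sum_algebra_def Q(2) Q'(2) f intro!: restrict_ext)
    show "f (S \<oplus>\<^bsub>quot_algebra A I\<^esub> T) =
        f S \<oplus>\<^bsub>direct_sum_algebra N (\<lambda>i. quot_algebra (A' i) (I' i))\<^esub> f T"
      using xy(1,3) closed ring_hom_add[OF hom] unfolding xy(2,4)
      by (auto simp: direct_sum_algebra_def Q(3) Q'(3) f intro!: restrict_ext)
    show "f (c \<odot>\<^bsub>quot_algebra A I\<^esub> S) =
        c \<odot>\<^bsub>direct_sum_algebra N (\<lambda>i. quot_algebra (A' i) (I' i))\<^esub> f S" for c
      using xy(1) closed sc A'(3) alg_homD(2)[OF \<phi>(1)] unfolding xy(2)
      by (auto simp: direct_sum_algebra_def Q(7)[OF A(3)] Q'(7) f intro!: restrict_ext)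
  next
    show "f \<one>\<^bsub>quot_algebra A I\<^esub> = \<one>\<^bsub>direct_sum_algebra N (\<lambda>i. quot_algebra (A' i) (I' i))\<^esub>"
      using ring_hom_one[OF hom] by (auto simp: direct_sum_algebra_def Q(4) Q'(4) f intro!: restrict_ext)
  qed
  moreover have "inj_on f (carrier (quot_algebra A I))"
  proof (rule inj_onI)
    fix S T assume "S \<in> carrier (quot_algebra A I)" "T \<in> carrier (quot_algebra A I)" and eq: "f S = f T"
    then obtain x y where xy: "x \<in> carrier A" "S = I +>\<^bsub>A\<^esub> x" "y \<in> carrier A" "T = I +>\<^bsub>A\<^esub> y"
      unfolding Q(1) by blast
    have "x \<ominus>\<^bsub>A\<^esub> y \<in> I"
    proof (rule \<phi>(3))
      fix i assume i: "i \<in> N"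
      interpret A': cring "A' i" by (rule A'(1)[OF i])
      have "I' i +>\<^bsub>A' i\<^esub> \<phi> i x = I' i +>\<^bsub>A' i\<^esub> \<phi> i y"
        using fun_cong[OF eq, of i] i f xy by simp
      then have "\<phi> i x \<ominus>\<^bsub>A' i\<^esub> \<phi> i y \<in> I' i"
        using A'.quotient_eq_iff_same_a_r_cos[OF A'(2)[OF i]] closed[OF i] xy(1,3) by simp
      moreover interpret h: ring_hom_ring A "A' i" "\<phi> i"
        by (rule ring_hom_ringI2[OF A.ring_axioms A'.ring_axioms hom[OF i]])
      have "\<phi> i (x \<ominus>\<^bsub>A\<^esub> y) = \<phi> i x \<ominus>\<^bsub>A' i\<^esub> \<phi> i y"
        using xy(1,3) by (simp add: a_minus_def)
      ultimately show "\<phi> i (x \<ominus>\<^bsub>A\<^esub> y) \<in> I' i"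
        by simp
    qed (use xy in simp)
    then show "S = T"
      using A.quotient_eq_iff_same_a_r_cos[OF A(2)] xy by simp
  qed
  ultimately show thesis
    using f by (rule that)
qed

lemma direct_sum_component_hom:
  assumes f: "f \<in> alg_hom A (direct_sum_algebra N A')" and i: "i \<in> N"
  shows "(\<lambda>x. f x i) \<in> ring_hom A (A' i)"
proof (rule ring_hom_memI)
  note hom = alg_homD(1)[OF f]
  show "f x i \<in> carrier (A' i)" if "x \<in> carrier A" for x
    using ring_hom_closed[OF hom that] i by (auto simp: direct_sum_algebra_def)
  show "f (x \<otimes>\<^bsub>A\<^esub> y) i = f x i \<otimes>\<^bsub>A' i\<^esub> f y i" if "x \<in> carrier A" "y \<in> carrier A" for x y
    using ring_hom_mult[OF hom that] i by (simp add: direct_sum_algebra_def)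
  show "f (x \<oplus>\<^bsub>A\<^esub> y) i = f x i \<oplus>\<^bsub>A' i\<^esub> f y i" if "x \<in> carrier A" "y \<in> carrier A" for x y
    using ring_hom_add[OF hom that] i by (simp add: direct_sum_algebra_def)
  show "f \<one>\<^bsub>A\<^esub> i = \<one>\<^bsub>A' i\<^esub>"
    using ring_hom_one[OF hom] i by (simp add: direct_sum_algebra_def)
qed

lemma loewy_length_le_Max_direct_sum:
  assumes A: "cring A" "finite_length A" and N: "finite N" "N \<noteq> {}"
    and A': "\<And>i. i \<in> N \<Longrightarrow> cring (A' i)" "\<And>i. i \<in> N \<Longrightarrow> finite_length (A' i)"
    and f: "f \<in> alg_hom A (direct_sum_algebra N A')" "inj_on f (carrier A)"
  shows "loewy_length A \<le> Max ((\<lambda>i. loewy_length (A' i)) ` N)"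
proof (rule loewy_length_le_Max[OF A N A'])
  interpret A: cring A by (rule A(1))
  show hom: "(\<lambda>x. f x i) \<in> ring_hom A (A' i)" if "i \<in> N" for i
    by (rule direct_sum_component_hom[OF f(1) that])
  show "x = \<zero>\<^bsub>A\<^esub>" if x: "x \<in> carrier A" "\<And>i. i \<in> N \<Longrightarrow> f x i = \<zero>\<^bsub>A' i\<^esub>" for x
  proof -
    have "f x i = f \<zero>\<^bsub>A\<^esub> i" for i
    proof (cases "i \<in> N")
      case True
      interpret A': cring "A' i" by (rule A'(1)[OF True])
      show ?thesis
        using x(2)[OF True] ring_hom_zero[OF hom[OF True] A.ring_axioms A'.ring_axioms] by simp
    next
      case False
      \<comment> \<open>Members of the direct sum take the value \<open>undefined\<close> off the
        index set, which is needed to compare them as total functions.\<close>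
      have "f y i = undefined" if "y \<in> carrier A" for y
        using ring_hom_closed[OF alg_homD(1)[OF f(1)] that] False by (auto simp: direct_sum_algebra_def)
      then show ?thesis
        using x(1) by simp
    qed
    then show ?thesis
      using inj_onD[OF f(2), of x "\<zero>\<^bsub>A\<^esub>"] x(1) by auto
  qed
qed auto

text \<open>The socle is available as a left ideal; inside the commutative center that is enough for
  a two-sided ideal.\<close>

lemma (in ring) ideal_reynolds: "ideal (reynolds R) (R\<lparr>carrier := center R\<rparr>)"
proof -
  interpret Z: cring "R\<lparr>carrier := center R\<rparr>" by (rule cring_center)
  have left: "left_ideal (reynolds R) (R\<lparr>carrier := center R\<rparr>)"
    using left_idealD(2,3,4)[OF left_ideal_socle] center_carrier
    by (intro Z.left_idealI) (auto simp: reynolds_def center_closed)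
  then have "subgroup (reynolds R) (add_monoid (R\<lparr>carrier := center R\<rparr>))"
    by (auto simp: left_ideal_def additive_subgroup_def)
  then show ?thesis
  proof (rule idealI[OF Z.ring_axioms])
    fix a x assume ax: "a \<in> reynolds R" "x \<in> carrier (R\<lparr>carrier := center R\<rparr>)"
    then show "x \<otimes>\<^bsub>R\<lparr>carrier := center R\<rparr>\<^esub> a \<in> reynolds R"
      using Z.left_idealD(4)[OF left] by blast
    then show "a \<otimes>\<^bsub>R\<lparr>carrier := center R\<rparr>\<^esub> x \<in> reynolds R"
      using Z.m_comm[OF ax(2) Z.left_idealD(7)[OF left ax(1)]] by simp
  qed
qed

section \<open>Brauer correspondence\<close>

lemma block_idem_nonzero:
  assumes A: "ring A" and B: "is_block A B"
  shows "block_idem A B \<noteq> \<zero>\<^bsub>A\<^esub>"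
proof
  interpret A: ring A by (rule A)
  note e = block_corner[OF A B]
  assume "block_idem A B = \<zero>\<^bsub>A\<^esub>"
  then have "x = \<zero>\<^bsub>A\<^esub>" if "x \<in> B" for x
    using A.corner_closed(6)[OF e(1), of x] that e(2) A.corner_carrier by auto
  then have "B = {\<zero>\<^bsub>A\<^esub>}"
    using A.corner_closed(1)[OF e(1)] e(2) by blast
  then show False
    using B by (simp add: is_block_def)
qed

context finite_group
begin

interpretation A: ring "group_algebra G :: ('k::field, 'a \<Rightarrow> 'k) module"
  by (rule ring_group_algebra)

text \<open>The component at \<open>(u, b)\<close> of the map in the theorem, considered also for
  blocks \<open>b\<close> that do not induce to \<open>B\<close>.\<close>

definition brauer_component :: "'a \<Rightarrow> ('a \<Rightarrow> 'k::field) set \<Rightarrow> ('a \<Rightarrow> 'k) \<Rightarrow> 'a \<Rightarrow> 'k"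
  where "brauer_component u b z = brauer_hom G u z \<otimes>\<^bsub>subgroup_algebra G (centralizer G u)\<^esub>
    block_idem (subgroup_algebra G (centralizer G u)) b"

lemma
  fixes z :: "'a \<Rightarrow> 'k::field"
  assumes u: "u \<in> carrier G" and b: "is_block (subgroup_algebra G (centralizer G u)) b"
    and z: "z \<in> center (group_algebra G)"
  shows brauer_component_center: "brauer_component u b z \<in> center (subgroup_algebra G (centralizer G u))"
    and brauer_component_block: "brauer_component u b z \<in> b"
proof -
  let ?F = "subgroup_algebra G (centralizer G u) :: ('k, 'a \<Rightarrow> 'k) module"
  interpret C: finite_group "G\<lparr>carrier := centralizer G u\<rparr>"
    by (rule finite_group_centralizer[OF u])
  interpret F: ring ?F
    by (rule C.ring_group_algebra)
  note e = block_corner[OF F.ring_axioms b]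
  note zF = brauer_hom_center[OF u z]
  show "brauer_component u b z \<in> center ?F"
    unfolding brauer_component_def using F.center_closed(6)[OF zF F.central_idempotentD(1)[OF e(1)]] .
  show "brauer_component u b z \<in> b"
    unfolding brauer_component_def using F.corner_mult(2)[OF e(1) F.center_carrier[OF zF]] e(2) by simp
qed

lemma brauer_component_smult:
  assumes "u \<in> carrier G"
  shows "brauer_component u b (c \<odot>\<^bsub>group_algebra G\<^esub> z) =
    c \<odot>\<^bsub>subgroup_algebra G (centralizer G u)\<^esub> brauer_component u b z"
proof -
  interpret C: finite_group "G\<lparr>carrier := centralizer G u\<rparr>"
    by (rule finite_group_centralizer[OF assms])
  show ?thesis
    unfolding brauer_component_def brauer_hom_smult C.group_algebra_smult_mult(1) ..
qed

lemma brauer_component_add: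
  fixes z w :: "'a \<Rightarrow> 'k::field"
  assumes u: "u \<in> carrier G" and b: "is_block (subgroup_algebra G (centralizer G u)) b"
    and z: "z \<in> center (group_algebra G)" and w: "w \<in> center (group_algebra G)"
  shows "brauer_component u b (z \<oplus>\<^bsub>group_algebra G\<^esub> w) =
    brauer_component u b z \<oplus>\<^bsub>subgroup_algebra G (centralizer G u)\<^esub> brauer_component u b w"
proof -
  let ?F = "subgroup_algebra G (centralizer G u) :: ('k, 'a \<Rightarrow> 'k) module"
  interpret C: finite_group "G\<lparr>carrier := centralizer G u\<rparr>"
    by (rule finite_group_centralizer[OF u])
  interpret F: ring ?F
    by (rule C.ring_group_algebra)
  show ?thesis
    unfolding brauer_component_def brauer_hom_add
    using block_corner(1)[OF F.ring_axioms b] brauer_hom_center[OF u z] brauer_hom_center[OF u w]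
    by (simp add: F.l_distr F.center_carrier F.central_idempotentD(2))
qed

text \<open>The primed form leaves the first factor unprojected. With the block idempotent of
  \<open>B\<close> as second factor it reduces the vanishing of a component of \<open>z\<close> to
  that of the component of the idempotent.\<close>

lemma
  fixes z w :: "'a \<Rightarrow> 'k::field"
  assumes p: "CHAR('k) = p" "prime p" and u: "u \<in> carrier G" "u [^] (p ^ n) = \<one>"
    and b: "is_block (subgroup_algebra G (centralizer G u)) b"
    and z: "z \<in> center (group_algebra G)" and w: "w \<in> center (group_algebra G)"
  shows brauer_component_mult: "brauer_component u b (z \<otimes>\<^sub>F w) =
      brauer_component u b z \<otimes>\<^bsub>subgroup_algebra G (centralizer G u)\<^esub> brauer_component u b w"
    and brauer_component_mult': "brauer_component u b (z \<otimes>\<^sub>F w) =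
      brauer_hom G u z \<otimes>\<^bsub>subgroup_algebra G (centralizer G u)\<^esub> brauer_component u b w"
proof -
  let ?F = "subgroup_algebra G (centralizer G u) :: ('k, 'a \<Rightarrow> 'k) module"
  interpret C: finite_group "G\<lparr>carrier := centralizer G u\<rparr>"
    by (rule finite_group_centralizer[OF u(1)])
  interpret F: ring ?F
    by (rule C.ring_group_algebra)
  note e = block_corner[OF F.ring_axioms b]
  let ?e = "block_idem ?F b"
  note [simp] = F.center_carrier[OF brauer_hom_center[OF u(1) z]]
    F.center_carrier[OF brauer_hom_center[OF u(1) w]] F.central_idempotentD(2)[OF e(1)]
  show mult': "brauer_component u b (z \<otimes>\<^sub>F w) = brauer_hom G u z \<otimes>\<^bsub>?F\<^esub> brauer_component u b w"
    unfolding brauer_component_def brauer_hom_mult[OF p u z w] by (simp add: F.m_assoc)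
  have "brauer_component u b w = ?e \<otimes>\<^bsub>?F\<^esub> brauer_component u b w"
    using F.corner_mult(2)[OF e(1), of "brauer_hom G u w"]
    by (simp add: brauer_component_def corner_def)
  then have "brauer_hom G u z \<otimes>\<^bsub>?F\<^esub> brauer_component u b w =
      brauer_hom G u z \<otimes>\<^bsub>?F\<^esub> (?e \<otimes>\<^bsub>?F\<^esub> brauer_component u b w)"
    by (rule arg_cong)
  also have "\<dots> = brauer_component u b z \<otimes>\<^bsub>?F\<^esub> brauer_component u b w"
    unfolding brauer_component_def by (simp add: F.m_assoc)
  finally show "brauer_component u b (z \<otimes>\<^sub>F w) = brauer_component u b z \<otimes>\<^bsub>?F\<^esub> brauer_component u b w"
    unfolding mult' .
qed

text \<open>The component is a central idempotent of \<open>b\<close>, hence 0 or the unit of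
  \<open>b\<close>. A central character of \<open>b\<close> tells the two apart: composed with the
  Brauer homomorphism it is a character of the center of the group algebra, whose value at the
  idempotent of \<open>B\<close> is 1 if and only if it belongs to \<open>B\<close>.\<close>

lemma brauer_component_block_idem:
  fixes B b :: "('a \<Rightarrow> 'k::alg_closed_field) set"
  assumes p: "CHAR('k) = p" "prime p" and u: "u \<in> carrier G" "u [^] (p ^ n) = \<one>"
    and B: "is_block (group_algebra G) B"
    and b: "is_block (subgroup_algebra G (centralizer G u)) b"
  shows "brauer_component u b (block_idem (group_algebra G) B) =
    (if brauer_induces G (centralizer G u) b B then block_idem (subgroup_algebra G (centralizer G u)) b
     else \<zero>\<^bsub>subgroup_algebra G (centralizer G u)\<^esub>)"
proof -
  let ?A = "group_algebra G :: ('k, 'a \<Rightarrow> 'k) module"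
  let ?F = "subgroup_algebra G (centralizer G u) :: ('k, 'a \<Rightarrow> 'k) module"
  interpret C: finite_group "G\<lparr>carrier := centralizer G u\<rparr>"
    by (rule finite_group_centralizer[OF u(1)])
  interpret F: ring ?F
    by (rule C.ring_group_algebra)
  let ?e = "block_idem ?F b" and ?E = "block_idem ?A B"
  let ?f = "brauer_component u b ?E"
  note e = block_corner[OF F.ring_axioms b] and E = block_corner[OF A.ring_axioms B]
  note ec = F.central_idempotentD[OF e(1)] and Ec = A.central_idempotentD[OF E(1)]
  have fc: "?f \<in> center ?F" "?f \<in> b"
    using brauer_component_center[OF u(1) b Ec(1)] brauer_component_block[OF u(1) b Ec(1)] .
  have "central_idempotent ?F ?f"
    using brauer_component_mult[OF p u b Ec(1) Ec(1)] fc(1) by (simp add: central_idempotent_def Ec(3))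
  then have dichotomy: "?f = \<zero>\<^bsub>?F\<^esub> \<or> ?f = ?e"
    using fc(2) by (rule block_idempotent_dichotomy[OF F.ring_axioms b])
  have Br_E: "brauer_hom G u ?E \<in> center ?F"
    by (rule brauer_hom_center[OF u(1) Ec(1)])
  have base: "x \<otimes>\<^bsub>base_algebra\<^esub> y = x * y" "x \<oplus>\<^bsub>base_algebra\<^esub> y = x + y" "\<one>\<^bsub>base_algebra\<^esub> = 1"
    "c \<odot>\<^bsub>base_algebra\<^esub> x = c * x" for x y c :: 'k
    by (simp_all add: base_algebra_def)
  have \<omega>f: "\<omega> ?f = \<omega> (brauer_hom G u ?E) * \<omega> ?e" if "\<omega> \<in> alg_hom (center_algebra ?F) base_algebra" for \<omega>
    using ring_hom_mult[OF alg_homD(1)[OF that], of "brauer_hom G u ?E" ?e] Br_E ec(1)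
    by (simp add: base brauer_component_def)
  show ?thesis
  proof (cases "brauer_induces G (centralizer G u) b B")
    case True
    then obtain \<omega> \<omega>' where \<omega>: "central_character ?F b \<omega>" "central_character ?A B \<omega>'"
      "\<And>z. z \<in> center ?A \<Longrightarrow> \<omega> (restrict_to (centralizer G u) z) = \<omega>' z"
      unfolding brauer_induces_def by blast
    have "\<omega> (brauer_hom G u ?E) = 1"
      using \<omega>(2) \<omega>(3)[OF Ec(1)] by (simp add: central_character_def brauer_hom_def)
    then have "\<omega> ?f = 1"
      using \<omega>(1) \<omega>f[of \<omega>] by (simp add: central_character_def)
    \<comment> \<open>\<open>base_algebra\<close> is used as a bare record here, so the value at
      zero is derived from additivity.\<close>
    moreover have "\<omega> \<zero>\<^bsub>?F\<^esub> = 0"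
    proof -
      have "\<omega> (\<zero>\<^bsub>?F\<^esub> \<oplus>\<^bsub>?F\<^esub> \<zero>\<^bsub>?F\<^esub>) = \<omega> \<zero>\<^bsub>?F\<^esub> + \<omega> \<zero>\<^bsub>?F\<^esub>"
        using \<omega>(1) ring_hom_add[of \<omega> "center_algebra ?F" base_algebra "\<zero>\<^bsub>?F\<^esub>" "\<zero>\<^bsub>?F\<^esub>"] F.center_closed(1)
        unfolding central_character_def alg_hom_def by (simp add: base del: F.r_zero F.l_zero)
      then have "\<omega> \<zero>\<^bsub>?F\<^esub> = \<omega> \<zero>\<^bsub>?F\<^esub> + \<omega> \<zero>\<^bsub>?F\<^esub>"
        by (simp only: F.r_zero[OF F.zero_closed])
      then show ?thesis
        by (rule iffD1[OF add_cancel_right_right])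
    qed
    ultimately have "?f \<noteq> \<zero>\<^bsub>?F\<^esub>"
      by auto
    then show ?thesis
      using dichotomy True by simp
  next
    case False
    have "?f \<noteq> ?e"
    proof
      assume fe: "?f = ?e"
      obtain \<omega> where \<omega>: "\<omega> \<in> alg_hom (center_algebra ?F) base_algebra" "\<omega> ?e = 1"
        using C.central_character_exists[OF e(1) block_idem_nonzero[OF F.ring_axioms b]] .
      note hom = alg_homD(1)[OF \<omega>(1)]
      \<comment> \<open>This composite is the witness for Brauer induction: it takes the value 1 at
        the idempotent of \<open>B\<close> if the component equals the unit of
        \<open>b\<close>.\<close>
      have "(\<lambda>z. \<omega> (brauer_hom G u z)) \<in> alg_hom (center_algebra ?A) base_algebra"
      proof (intro alg_homI ring_hom_memI)
        show "\<omega> (brauer_hom G u (x \<otimes>\<^bsub>center_algebra ?A\<^esub> y)) =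
            \<omega> (brauer_hom G u x) \<otimes>\<^bsub>base_algebra\<^esub> \<omega> (brauer_hom G u y)"
          if "x \<in> carrier (center_algebra ?A)" "y \<in> carrier (center_algebra ?A)" for x y
          using that brauer_hom_mult[OF p u, of x y] brauer_hom_center[OF u(1), of x]
            brauer_hom_center[OF u(1), of y] ring_hom_mult[OF hom, of "brauer_hom G u x" "brauer_hom G u y"]
          by simp
        show "\<omega> (brauer_hom G u (x \<oplus>\<^bsub>center_algebra ?A\<^esub> y)) =
            \<omega> (brauer_hom G u x) \<oplus>\<^bsub>base_algebra\<^esub> \<omega> (brauer_hom G u y)"
          if "x \<in> carrier (center_algebra ?A)" "y \<in> carrier (center_algebra ?A)" for x y
          using that brauer_hom_add[of u x y] brauer_hom_center[OF u(1), of x]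
            brauer_hom_center[OF u(1), of y] ring_hom_add[OF hom, of "brauer_hom G u x" "brauer_hom G u y"]
          by simp
        show "\<omega> (brauer_hom G u \<one>\<^bsub>center_algebra ?A\<^esub>) = \<one>\<^bsub>base_algebra\<^esub>"
        proof -
          have "brauer_hom G u \<one>\<^bsub>?A\<^esub> = \<one>\<^bsub>?F\<^esub>"
            by (rule brauer_hom_one[OF u(1)])
          then show ?thesis
            using ring_hom_one[OF hom] by simp
        qed
        show "\<omega> (brauer_hom G u (c \<odot>\<^bsub>center_algebra ?A\<^esub> x)) = c \<odot>\<^bsub>base_algebra\<^esub> \<omega> (brauer_hom G u x)"
          if "x \<in> carrier (center_algebra ?A)" for c x
          using that brauer_hom_smult[of u c x] brauer_hom_center[OF u(1), of x]
            alg_homD(2)[OF \<omega>(1), of "brauer_hom G u x" c] by simp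
      qed (simp add: base_algebra_def)
      moreover have "\<omega> (brauer_hom G u ?E) = 1"
        using \<omega>f[OF \<omega>(1)] \<omega>(2) fe by simp
      ultimately have "brauer_induces G (centralizer G u) b B"
        unfolding brauer_induces_def central_character_def
        using b B \<omega> by (auto simp: brauer_hom_def)
      then show False
        using False by simp
    qed
    then show ?thesis
      using dichotomy False by simp
  qed
qed

lemma brauer_component_not_induced:
  fixes B b :: "('a \<Rightarrow> 'k::alg_closed_field) set"
  assumes p: "CHAR('k) = p" "prime p" and u: "u \<in> carrier G" "u [^] (p ^ n) = \<one>"
    and B: "is_block (group_algebra G) B"
    and b: "is_block (subgroup_algebra G (centralizer G u)) b"
    and z: "z \<in> center (group_algebra G)" "z \<in> B" and not_ind: "\<not> brauer_induces G (centralizer G u) b B"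
  shows "brauer_component u b z = \<zero>\<^bsub>subgroup_algebra G (centralizer G u)\<^esub>"
proof -
  let ?F = "subgroup_algebra G (centralizer G u) :: ('k, 'a \<Rightarrow> 'k) module"
  interpret C: finite_group "G\<lparr>carrier := centralizer G u\<rparr>"
    by (rule finite_group_centralizer[OF u(1)])
  interpret F: ring ?F
    by (rule C.ring_group_algebra)
  note E = block_corner[OF A.ring_axioms B]
  have "z \<otimes>\<^sub>F block_idem (group_algebra G) B = z"
    using A.corner_closed(7)[OF E(1)] E(2) z(2) by blast
  then have "brauer_component u b z = brauer_component u b (z \<otimes>\<^sub>F block_idem (group_algebra G) B)"
    by simp
  also have "\<dots> = brauer_hom G u z \<otimes>\<^bsub>?F\<^esub> brauer_component u b (block_idem (group_algebra G) B)"
    by (rule brauer_component_mult'[OF p u b z(1) A.central_idempotentD(1)[OF E(1)]])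
  also have "\<dots> = \<zero>\<^bsub>?F\<^esub>"
    unfolding brauer_component_block_idem[OF p u B b]
    using not_ind F.center_carrier[OF brauer_hom_center[OF u(1) z(1)]] by simp
  finally show ?thesis .
qed

section \<open>Conjugation of subsections\<close>

lemma conj_mem_centralizer_iff:
  assumes "g \<in> carrier G" "v \<in> carrier G" "h \<in> carrier G"
  shows "inv g \<otimes> h \<otimes> g \<in> centralizer G v \<longleftrightarrow> h \<in> centralizer G (g \<otimes> v \<otimes> inv g)"
proof -
  have "inv g \<otimes> h \<otimes> g \<otimes> v = v \<otimes> (inv g \<otimes> h \<otimes> g) \<longleftrightarrow>
      g \<otimes> (inv g \<otimes> h \<otimes> g \<otimes> v) \<otimes> inv g = g \<otimes> (v \<otimes> (inv g \<otimes> h \<otimes> g)) \<otimes> inv g"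
    using assms by simp
  also have "\<dots> \<longleftrightarrow> h \<otimes> (g \<otimes> v \<otimes> inv g) = g \<otimes> v \<otimes> inv g \<otimes> h"
    using assms by (simp add: m_assoc)
  finally show ?thesis
    using assms by (simp add: centralizer_iff)
qed

lemma conj_elem_mult:
  fixes a c :: "'a \<Rightarrow> 'k::field"
  assumes g: "g \<in> carrier G" and v: "v \<in> carrier G"
  shows "conj_elem G g (a \<otimes>\<^bsub>subgroup_algebra G (centralizer G v)\<^esub> c) =
    conj_elem G g a \<otimes>\<^bsub>subgroup_algebra G (centralizer G (g \<otimes> v \<otimes> inv g))\<^esub> conj_elem G g c"
proof
  fix h
  let ?C = "centralizer G v" and ?D = "centralizer G (g \<otimes> v \<otimes> inv g)"
  have CD: "?C \<subseteq> carrier G" "?D \<subseteq> carrier G"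
    by (auto simp: centralizer_iff)
  have rhs: "(conj_elem G g a \<otimes>\<^bsub>subgroup_algebra G ?D\<^esub> conj_elem G g c) h =
      (\<Sum>(x, y) \<in> {(x, y) \<in> ?D \<times> ?D. x \<otimes> y = h}. conj_elem G g a x * conj_elem G g c y)"
    by (simp add: group_algebra_def)
  show "conj_elem G g (a \<otimes>\<^bsub>subgroup_algebra G ?C\<^esub> c) h =
      (conj_elem G g a \<otimes>\<^bsub>subgroup_algebra G ?D\<^esub> conj_elem G g c) h"
  proof (cases "h \<in> carrier G")
    case True
    have "conj_elem G g (a \<otimes>\<^bsub>subgroup_algebra G ?C\<^esub> c) h =
        (\<Sum>(x, y) \<in> {(x, y) \<in> ?C \<times> ?C. x \<otimes> y = inv g \<otimes> h \<otimes> g}. a x * c y)"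
      using True by (simp add: group_algebra_def conj_elem_def)
    also have "\<dots> = (\<Sum>(x, y) \<in> {(x, y) \<in> ?D \<times> ?D. x \<otimes> y = h}. conj_elem G g a x * conj_elem G g c y)"
    proof (rule sum.reindex_bij_witness[of _
          "\<lambda>(x, y). (inv g \<otimes> x \<otimes> g, inv g \<otimes> y \<otimes> g)" "\<lambda>(x, y). (g \<otimes> x \<otimes> inv g, g \<otimes> y \<otimes> inv g)"], goal_cases)
      case (1 s)
      then show ?case
        using g CD by (auto simp: m_assoc)
    next
      case (2 s)
      then obtain x y where s: "s = (x, y)" "x \<in> ?C" "y \<in> ?C" "x \<otimes> y = inv g \<otimes> h \<otimes> g"
        by blast
      have [simp]: "x \<in> carrier G" "y \<in> carrier G"
        using s CD by auto
      have "inv g \<otimes> (g \<otimes> w \<otimes> inv g) \<otimes> g = w" if "w \<in> carrier G" for w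
        using g that by (simp add: m_assoc)
      then have "g \<otimes> x \<otimes> inv g \<in> ?D" "g \<otimes> y \<otimes> inv g \<in> ?D"
        using conj_mem_centralizer_iff[OF g v, of "g \<otimes> x \<otimes> inv g"]
          conj_mem_centralizer_iff[OF g v, of "g \<otimes> y \<otimes> inv g"] s(2,3) g by auto
      moreover have "(g \<otimes> x \<otimes> inv g) \<otimes> (g \<otimes> y \<otimes> inv g) = g \<otimes> (x \<otimes> y) \<otimes> inv g"
        using g by (simp add: m_assoc)
      then have "(g \<otimes> x \<otimes> inv g) \<otimes> (g \<otimes> y \<otimes> inv g) = h"
        using g True by (simp add: s(4) m_assoc)
      ultimately show ?case
        by (simp add: s(1))
    next
      case (3 s)
      then show ?case
        using g CD by (auto simp: m_assoc)
    next
      case (4 s)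
      then obtain x y where s: "s = (x, y)" "x \<in> ?D" "y \<in> ?D" "x \<otimes> y = h"
        by blast
      have [simp]: "x \<in> carrier G" "y \<in> carrier G"
        using s CD by auto
      have "(inv g \<otimes> x \<otimes> g) \<otimes> (inv g \<otimes> y \<otimes> g) = inv g \<otimes> (x \<otimes> y) \<otimes> g"
        using g by (simp add: m_assoc)
      then show ?case
        using conj_mem_centralizer_iff[OF g v, of x] conj_mem_centralizer_iff[OF g v, of y] s by simp
    next
      case (5 s)
      then obtain x y where s: "s = (x, y)" "x \<in> ?C" "y \<in> ?C"
        by blast
      have "conj_elem G g f (g \<otimes> w \<otimes> inv g) = f w" if "w \<in> ?C" for f :: "'a \<Rightarrow> 'k" and w
      proof -
        have "w \<in> carrier G"
          using that CD by blast
        then show ?thesis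
          using g by (simp add: conj_elem_def m_assoc)
      qed
      then show ?case
        using s by simp
    qed
    finally show ?thesis
      unfolding rhs .
  next
    case False
    have "?D \<times> ?D \<inter> {(x, y). x \<otimes> y = h} = {}"
      using CD(2) False by auto
    then have "{(x, y) \<in> ?D \<times> ?D. x \<otimes> y = h} = {}"
      by blast
    then show ?thesis
      unfolding rhs using False by (simp only: sum.empty) (simp add: conj_elem_def)
  qed
qed

text \<open>That the conjugate of \<open>b\<close> is a block is a premise: in the application it
  comes with the conjugate subsection. What remains is to identify its unit and to use that
  \<open>z\<close> is a class function.\<close>

lemma brauer_component_conj:
  fixes z :: "'a \<Rightarrow> 'k::field"
  assumes g: "g \<in> carrier G" and v: "v \<in> carrier G"
    and b: "is_block (subgroup_algebra G (centralizer G v)) b"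
    and b': "is_block (subgroup_algebra G (centralizer G (g \<otimes> v \<otimes> inv g))) (conj_elem G g ` b)"
    and z: "z \<in> center (group_algebra G)"
  shows "brauer_component (g \<otimes> v \<otimes> inv g) (conj_elem G g ` b) z = conj_elem G g (brauer_component v b z)"
proof -
  let ?u = "g \<otimes> v \<otimes> inv g"
  let ?F = "subgroup_algebra G (centralizer G v) :: ('k, 'a \<Rightarrow> 'k) module"
  let ?F' = "subgroup_algebra G (centralizer G ?u) :: ('k, 'a \<Rightarrow> 'k) module"
  have u: "?u \<in> carrier G"
    using g v by simp
  interpret C: finite_group "G\<lparr>carrier := centralizer G v\<rparr>"
    by (rule finite_group_centralizer[OF v])
  interpret F: ring ?F
    by (rule C.ring_group_algebra)
  interpret C': finite_group "G\<lparr>carrier := centralizer G ?u\<rparr>"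
    by (rule finite_group_centralizer[OF u])
  interpret F': ring ?F'
    by (rule C'.ring_group_algebra)
  note e = block_corner[OF F.ring_axioms b]
  have idem: "block_idem ?F' (conj_elem G g ` b) = conj_elem G g (block_idem ?F b)"
  proof (rule block_idem_eqI[OF F'.ring_axioms b'])
    show "conj_elem G g (block_idem ?F b) \<in> conj_elem G g ` b"
      using F.central_idempotent_in_corner[OF e(1)] e(2) by blast
    fix x assume "x \<in> conj_elem G g ` b"
    then obtain y where y: "y \<in> b" "x = conj_elem G g y"
      by blast
    have "block_idem ?F b \<otimes>\<^bsub>?F\<^esub> y = y"
      using F.corner_closed(6)[OF e(1)] y(1) e(2) by blast
    then show "conj_elem G g (block_idem ?F b) \<otimes>\<^bsub>?F'\<^esub> x = x"
      using conj_elem_mult[OF g v, of "block_idem ?F b" y] y(2) by simp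
  qed
  have "brauer_hom G ?u z = conj_elem G g (brauer_hom G v z)"
  proof
    fix h
    show "brauer_hom G ?u z h = conj_elem G g (brauer_hom G v z) h"
    proof (cases "h \<in> carrier G")
      case True
      have "z (inv g \<otimes> (h \<otimes> g)) = z ((h \<otimes> g) \<otimes> inv g)"
        using z g True unfolding center_group_algebra_iff by blast
      then show ?thesis
        using conj_mem_centralizer_iff[OF g v True] g True
        by (simp add: brauer_hom_apply conj_elem_def m_assoc)
    next
      case False
      then show ?thesis
        by (simp add: brauer_hom_apply conj_elem_def centralizer_iff)
    qed
  qed
  then show ?thesis
    unfolding brauer_component_def idem conj_elem_mult[OF g v] by simp
qed

text \<open>Cauchy's theorem inside the centralizer of \<open>h\<close>, from a Sylow subgroup with
  exponent 1. Commuting is symmetric, so \<open>h\<close> centralizes the element found.\<close>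

lemma cauchy_centralizer:
  assumes p: "prime p" and h: "h \<in> carrier G" "p dvd card (centralizer G h)"
  obtains u where "u \<in> carrier G" "u [^] p = \<one>" "u \<noteq> \<one>" "h \<in> centralizer G u"
proof -
  let ?C = "G\<lparr>carrier := centralizer G h\<rparr>"
  interpret C: finite_group ?C
    by (rule finite_group_centralizer[OF h(1)])
  obtain m where "card (centralizer G h) = p * m"
    using h(2) by blast
  then have "Coset.order ?C = p ^ 1 * m"
    by (simp add: Coset.order_def)
  then obtain H where H: "subgroup H ?C" "card H = p"
    using sylow_thm[OF p C.is_group, of 1 m] C.finite_carrier by auto
  have "\<not> H \<subseteq> {\<one>}"
    using H(2) prime_gt_1_nat[OF p] card_mono[of "{\<one>}" H] by auto
  then obtain u where u: "u \<in> H" "u \<noteq> \<one>"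
    by blast
  interpret H: group "?C\<lparr>carrier := H\<rparr>"
    by (rule subgroup.subgroup_is_group[OF H(1) C.is_group])
  have uC: "u \<in> centralizer G h"
    using subgroup.subset[OF H(1)] u(1) by auto
  have "u [^]\<^bsub>?C\<lparr>carrier := H\<rparr>\<^esub> Coset.order (?C\<lparr>carrier := H\<rparr>) = \<one>\<^bsub>?C\<lparr>carrier := H\<rparr>\<^esub>"
    using u(1) by (intro H.pow_order_eq_1) simp
  then have "u [^] p = \<one>"
    using H(2) by (simp add: Coset.order_def nat_pow_def)
  then show thesis
    using that[of u] uC u(2) h(1) by (auto simp: centralizer_iff)
qed

text \<open>The elements carrying \<open>h\<close> to \<open>r\<close> form the coset of the
  centralizer of \<open>r\<close> through \<open>s\<close>.\<close>

lemma card_conj_eq: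
  assumes h: "h \<in> carrier G" and s: "s \<in> carrier G" "r = s \<otimes> h \<otimes> inv s"
  shows "card {t \<in> carrier G. t \<otimes> h \<otimes> inv t = r} = card (centralizer G r)"
proof (rule bij_betw_same_card[of "\<lambda>t. t \<otimes> inv s"], rule bij_betwI[of _ _ _ "\<lambda>c. c \<otimes> s"])
  have r: "r \<in> carrier G"
    using h s by simp
  have h_eq: "h = inv s \<otimes> r \<otimes> s"
    using h s by (simp add: m_assoc)
  have key: "(c \<otimes> s) \<otimes> h \<otimes> inv (c \<otimes> s) = r \<longleftrightarrow> c \<in> centralizer G r" if c: "c \<in> carrier G" for c
  proof -
    have "(c \<otimes> s) \<otimes> h \<otimes> inv (c \<otimes> s) = c \<otimes> r \<otimes> inv c"
      using c s(1) r unfolding h_eq by (simp add: inv_mult_group m_assoc)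
    moreover have "c \<otimes> r \<otimes> inv c = r \<longleftrightarrow> c \<otimes> r = r \<otimes> c"
      using inv_solve_right'[of r "c \<otimes> r" c] c r by (auto simp del: r_cancel_one r_cancel_one')
    ultimately show ?thesis
      using c by (simp add: centralizer_iff)
  qed
  show "(\<lambda>t. t \<otimes> inv s) \<in> {t \<in> carrier G. t \<otimes> h \<otimes> inv t = r} \<rightarrow> centralizer G r"
  proof (rule funcsetI)
    fix t assume "t \<in> {t \<in> carrier G. t \<otimes> h \<otimes> inv t = r}"
    then have "t \<in> carrier G" "t \<otimes> h \<otimes> inv t = r"
      by auto
    then show "t \<otimes> inv s \<in> centralizer G r"
      using key[of "t \<otimes> inv s"] s(1) by simp
  qed
  show "(\<lambda>c. c \<otimes> s) \<in> centralizer G r \<rightarrow> {t \<in> carrier G. t \<otimes> h \<otimes> inv t = r}"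
    using key s(1) by (auto simp: centralizer_iff)
qed (use s in \<open>auto simp: centralizer_iff\<close>)

text \<open>
  The preimage under the trace is supported on class representatives, where it is the given class
  function divided by the order of the centralizer.
\<close>

lemma rel_trace_trivial_surj:
  fixes e :: "'a \<Rightarrow> 'k::field"
  assumes e: "e \<in> center (group_algebra G)"
    and supp: "\<And>h. h \<in> carrier G \<Longrightarrow> of_nat (card (centralizer G h)) = (0::'k) \<Longrightarrow> e h = 0"
  shows "e \<in> rel_trace G {\<one>} ` fixed_elems G {\<one>}"
proof -
  define rep where "rep h = (SOME r. \<exists>s\<in>carrier G. r = s \<otimes> h \<otimes> inv s)" for h
  have rep: "\<exists>s\<in>carrier G. rep h = s \<otimes> h \<otimes> inv s" if "h \<in> carrier G" for h
    unfolding rep_def by (rule someI[of _ h]) (use that in \<open>auto intro: bexI[of _ \<one>]\<close>)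
  \<comment> \<open>Conjugate elements satisfy the same choice predicate, so the choice operator
    returns the same representative for both.\<close>
  have rep_conj: "rep (t \<otimes> h \<otimes> inv t) = rep h" if t: "t \<in> carrier G" "h \<in> carrier G" for t h
  proof -
    have "(\<exists>s\<in>carrier G. r = s \<otimes> (t \<otimes> h \<otimes> inv t) \<otimes> inv s) \<longleftrightarrow> (\<exists>s\<in>carrier G. r = s \<otimes> h \<otimes> inv s)" for r
    proof
      assume "\<exists>s\<in>carrier G. r = s \<otimes> (t \<otimes> h \<otimes> inv t) \<otimes> inv s"
      then obtain s where "s \<in> carrier G" "r = s \<otimes> (t \<otimes> h \<otimes> inv t) \<otimes> inv s"
        by blast
      then show "\<exists>s\<in>carrier G. r = s \<otimes> h \<otimes> inv s"
        using t by (intro bexI[of _ "s \<otimes> t"]) (auto simp: m_assoc inv_mult_group)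
    next
      assume "\<exists>s\<in>carrier G. r = s \<otimes> h \<otimes> inv s"
      then obtain s where "s \<in> carrier G" "r = s \<otimes> h \<otimes> inv s"
        by blast
      then show "\<exists>s\<in>carrier G. r = s \<otimes> (t \<otimes> h \<otimes> inv t) \<otimes> inv s"
        using t by (intro bexI[of _ "s \<otimes> inv t"]) (auto simp: m_assoc inv_mult_group)
    qed
    then show ?thesis
      by (simp add: rep_def)
  qed
  have e_conj: "e (s \<otimes> h \<otimes> inv s) = e h" if "s \<in> carrier G" "h \<in> carrier G" for s h
  proof -
    have "e ((s \<otimes> h) \<otimes> inv s) = e (inv s \<otimes> (s \<otimes> h))"
      using e that unfolding center_group_algebra_iff by blast
    then show ?thesis
      using that by simp
  qed
  define a where "a x = (if x \<in> carrier G \<and> rep x = x then e x / of_nat (card (centralizer G x)) else 0)" for x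
  have "conj_elem G \<one> a = a"
    by (rule ext) (auto simp: conj_elem_def a_def)
  then have "a \<in> fixed_elems G {\<one>}"
    by (auto simp: fixed_elems_def group_algebra_simps a_def)
  moreover have "rel_trace G {\<one>} a = e"
  proof
    fix h
    \<comment> \<open>The cosets of the trivial subgroup are singletons, so the choice in
      \<open>rel_trace\<close> is forced and the trace runs over all of \<open>G\<close>.\<close>
    have "rcosets {\<one>} = (\<lambda>t. {t}) ` carrier G"
      by (auto simp: RCOSETS_def r_coset_def)
    then have "rel_trace G {\<one>} a h = (\<Sum>t\<in>carrier G. conj_elem G (inv t) a h)"
      by (simp add: rel_trace_def sum.reindex)
    also have "\<dots> = e h"
    proof (cases "h \<in> carrier G")
      case True
      obtain s where s: "s \<in> carrier G" "rep h = s \<otimes> h \<otimes> inv s"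
        using rep[OF True] by blast
      define c where "c = of_nat (card (centralizer G (rep h))) * (e (rep h) / of_nat (card (centralizer G (rep h))))"
      have rh: "rep h \<in> carrier G"
        using s True by simp
      have "(\<Sum>t\<in>carrier G. conj_elem G (inv t) a h) =
          (\<Sum>t\<in>carrier G. if t \<otimes> h \<otimes> inv t = rep h then e (rep h) / of_nat (card (centralizer G (rep h))) else 0)"
        using True rep_conj by (intro sum.cong) (auto simp: conj_elem_def a_def)
      also have "\<dots> = (\<Sum>t | t \<in> carrier G \<and> t \<otimes> h \<otimes> inv t = rep h. e (rep h) / of_nat (card (centralizer G (rep h))))"
        by (simp add: sum.If_cases Int_def)
      also have "\<dots> = c"
        using card_conj_eq[OF True s] by (simp add: c_def)
      \<comment> \<open>If the order of the centralizer is 0 in the field, division by it yields 0,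
        which agrees with \<open>e (rep h) = 0\<close> from the support condition.\<close>
      also have "\<dots> = e (rep h)"
        using supp[OF rh] by (cases "of_nat (card (centralizer G (rep h))) = (0::'k)") (auto simp: c_def)
      also have "\<dots> = e h"
        using e_conj[OF s(1) True] s(2) by simp
      finally show ?thesis .
    next
      case False
      then show ?thesis
        using e by (simp add: conj_elem_def center_def group_algebra_simps)
    qed
    finally show "rel_trace G {\<one>} a h = e h" .
  qed
  ultimately show ?thesis
    by blast
qed

end

section \<open>Subsections\<close>

text \<open>With \<open>m = p^a m'\<close> and \<open>p\<close> not dividing \<open>m'\<close>, the
  power must be divisible by \<open>p^a\<close> and congruent to 1 modulo \<open>m'\<close>, so a
  large multiple of the totient of \<open>m'\<close> serves as exponent.\<close>

lemma exists_idempotent_prime_power: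
  assumes p: "prime (p::nat)" and m: "m > 0"
  obtains n where "n > 0" "m dvd p ^ n * p ^ n - p ^ n"
proof -
  define a where "a = multiplicity p m"
  obtain m' where m': "m = p ^ a * m'" "\<not> p dvd m'"
    unfolding a_def using p m by (metis multiplicity_decompose' not_prime_unit neq0_conv)
  have "m' > 0"
    using m m'(1) by (cases m') auto
  \<comment> \<open>The factor \<open>a + 1\<close> ensures \<open>a \<le> n\<close> and, even for
    \<open>a = 0\<close>, that \<open>n\<close> is positive.\<close>
  define n where "n = (a + 1) * totient m'"
  have tot: "totient m' > 0"
    using \<open>m' > 0\<close> by simp
  have "(a + 1) * 1 \<le> n"
    unfolding n_def using tot by (intro mult_le_mono2) linarith
  then have "a \<le> n" "n > 0"
    by auto
  have "coprime p m'"
    using p m'(2) by (rule prime_imp_coprime)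
  then have "[p ^ totient m' = 1] (mod m')"
    by (rule euler_theorem)
  then have "[(p ^ totient m') ^ (a + 1) = 1 ^ (a + 1)] (mod m')"
    by (rule cong_pow)
  then have "[p ^ n = 1] (mod m')"
    by (simp add: n_def power_mult[symmetric] power_add mult.commute)
  then have "m' dvd p ^ n - 1"
    using cong_to_1_nat by blast
  moreover have "p ^ a dvd p ^ n"
    using \<open>a \<le> n\<close> by (rule le_imp_power_dvd)
  ultimately have "m dvd p ^ n * (p ^ n - 1)"
    unfolding m'(1) by (rule mult_dvd_mono[rotated])
  then show thesis
    using that[of n] \<open>n > 0\<close> by (simp add: diff_mult_distrib2)
qed

context finite_group
begin

interpretation A: ring "group_algebra G :: ('k::field, 'a \<Rightarrow> 'k) module"
  by (rule ring_group_algebra)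

lemma pow_idempotent_exponent:
  assumes x: "x \<in> carrier G" and q: "card (carrier G) dvd q * q - q"
  shows "x [^] (q * q) = x [^] (q::nat)"
proof -
  obtain j where j: "q * q - q = card (carrier G) * j"
    using q by blast
  have "q \<le> q * q"
    by (cases q) auto
  then have "x [^] (q * q) = x [^] q \<otimes> x [^] (q * q - q)"
    using x by (simp add: nat_pow_mult)
  also have "x [^] (q * q - q) = (x [^] card (carrier G)) [^] j"
    unfolding j using x by (simp add: nat_pow_pow)
  also have "x [^] card (carrier G) = \<one>"
    using pow_order_eq_1[OF x] by (simp add: Coset.order_def)
  finally show ?thesis
    using x by simp
qed

lemma scalar_compatible_reynolds:
  fixes b :: "('a \<Rightarrow> 'k::field) set"
  assumes b: "is_block (group_algebra G) b"
  shows "scalar_compatible (center_algebra (block_algebra (group_algebra G) b))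
    (reynolds (block_algebra (group_algebra G) b))"
proof -
  let ?A = "group_algebra G :: ('k, 'a \<Rightarrow> 'k) module"
  let ?S = "block_algebra ?A b"
  interpret S: ring ?S
    by (rule ring_block_algebra[OF b])
  interpret R: ideal "reynolds ?S" "center_algebra ?S"
    by (rule S.ideal_reynolds)
  note e = block_corner[OF A.ring_axioms b]
  let ?e = "block_idem ?A b"
  have S_simps: "monoid.mult ?S = monoid.mult ?A" "ring.add ?S = ring.add ?A" "module.smult ?S = module.smult ?A"
    by (simp_all add: block_algebra_def)
  have closed: "c \<odot>\<^bsub>?A\<^esub> x \<in> center ?S" if "x \<in> center ?S" for c x
    using that smult_center[of x c] smult_corner[OF e(1), of x c] e(2) by (simp add: center_block_algebra[OF b])
  have eS: "?e \<in> center ?S"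
    using A.central_idempotentD(1)[OF e(1)] A.central_idempotent_in_corner[OF e(1)] e(2)
    by (simp add: center_block_algebra[OF b])
  \<comment> \<open>Scaling by \<open>c\<close> is multiplication by the central element
    \<open>c e\<close> of the block, so closure is the ideal property.\<close>
  have "c \<odot>\<^bsub>?A\<^esub> x \<in> reynolds ?S" if x: "x \<in> reynolds ?S" for c x
  proof -
    have "x \<in> b"
      using x by (simp add: reynolds_def center_block_algebra[OF b])
    then have "?e \<otimes>\<^sub>F x = x"
      using A.corner_closed(6)[OF e(1)] e(2) by blast
    then have "c \<odot>\<^bsub>?A\<^esub> x = (c \<odot>\<^bsub>?A\<^esub> ?e) \<otimes>\<^sub>F x"
      by (simp flip: group_algebra_smult_mult(1))
    moreover have "(c \<odot>\<^bsub>?A\<^esub> ?e) \<otimes>\<^bsub>center_algebra ?S\<^esub> x \<in> reynolds ?S"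
      using x closed[OF eS, of c] by (intro R.I_l_closed) auto
    ultimately show ?thesis
      by (simp add: S_simps)
  qed
  then show ?thesis
    using closed by (simp add: scalar_compatible_def S_simps group_algebra_simps algebra_simps)
qed

lemma cring_center_mod_reynolds:
  fixes b :: "('a \<Rightarrow> 'k::field) set"
  assumes b: "is_block (group_algebra G) b"
  shows "cring (center_mod_reynolds (block_algebra (group_algebra G) b))"
    and "finite_length (center_mod_reynolds (block_algebra (group_algebra G) b))"
  unfolding center_mod_reynolds_def
  using cring_center_block_algebra[OF b] ring.ideal_reynolds[OF ring_block_algebra[OF b]]
    finite_length_center_block_algebra[OF b]
  by (auto intro: cring_quot_algebra finite_length_quot_algebra)

lemma p_elementD:
  assumes "p_element p G u"
  obtains n where "u \<in> carrier G" "u [^] (p ^ n) = \<one>"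
  using assms pow_ord_eq_1[of u] unfolding p_element_def by (metis)

lemma p_elementI:
  assumes "prime p" "u \<in> carrier G" "u [^] (p ^ n) = \<one>"
  shows "p_element p G u"
  using assms pow_eq_id[of u "p ^ n"] divides_primepow_nat[of p "ord u" n] by (auto simp: p_element_def)

lemma nontrivial_subsectionsD:
  assumes "(u, b) \<in> nontrivial_subsections p G B"
  shows "p_element p G u" "u \<in> carrier G" "u \<noteq> \<one>" "brauer_induces G (centralizer G u) b B"
    "is_block (subgroup_algebra G (centralizer G u)) b"
  using assms by (auto simp: nontrivial_subsections_def subsections_def p_element_def brauer_induces_def)

lemma finite_length_group_algebra: "finite_length (group_algebra G :: ('k::field, 'a \<Rightarrow> 'k) module)"
  using finite_length_corner[OF A.central_idempotent_zero_one(2)] by (simp add: A.corner_one)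

text \<open>Transfers an additive condition from the block components of the truncated element to
  the element itself. It is applied to equality of two coefficients and to vanishing.\<close>

lemma brauer_hom_induct:
  fixes z :: "'a \<Rightarrow> 'k::field"
  assumes u: "u \<in> carrier G" and z: "z \<in> center (group_algebra G)"
    and zero: "P \<zero>\<^bsub>subgroup_algebra G (centralizer G u)\<^esub>"
    and add: "\<And>x y. P x \<Longrightarrow> P y \<Longrightarrow> P (x \<oplus>\<^bsub>subgroup_algebra G (centralizer G u)\<^esub> y)"
    and block: "\<And>b. is_block (subgroup_algebra G (centralizer G u)) b \<Longrightarrow> P (brauer_component u b z)"
  shows "P (brauer_hom G u z)"
proof -
  let ?F = "subgroup_algebra G (centralizer G u) :: ('k, 'a \<Rightarrow> 'k) module"
  interpret C: finite_group "G\<lparr>carrier := centralizer G u\<rparr>"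
    by (rule finite_group_centralizer[OF u])
  interpret F: ring ?F
    by (rule C.ring_group_algebra)
  show ?thesis
  proof (rule block_decomposition_induct[where P = P, OF F.ring_axioms C.finite_length_group_algebra])
    show "brauer_hom G u z \<in> carrier ?F"
      by (rule F.center_carrier[OF brauer_hom_center[OF u z]])
    show "P (brauer_hom G u z \<otimes>\<^bsub>?F\<^esub> block_idem ?F b)" if "is_block ?F b" for b
      using block[OF that] by (simp add: brauer_component_def)
  qed (use zero add in auto)
qed

text \<open>Each \<open>x\<close> is tested at its own \<open>p\<close>-part \<open>u\<close>.
  Components at blocks inducing to \<open>B\<close> satisfy the equation by assumption, all others
  vanish, and the truncation to the centralizer of \<open>u\<close> is assembled from both
  kinds.\<close>

lemma pow_invariant_of_brauer_components:
  fixes B :: "('a \<Rightarrow> 'k::alg_closed_field) set"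
  assumes p: "CHAR('k) = p" "prime p" "q = p ^ n" and q: "card (carrier G) dvd q * q - q"
    and B: "is_block (group_algebra G) B" and z: "z \<in> center (group_algebra G)" "z \<in> B"
    and comp: "\<And>u b y. (u, b) \<in> nontrivial_subsections p G B \<Longrightarrow> y \<in> centralizer G u \<Longrightarrow>
      brauer_component u b z y = brauer_component u b z (y [^] q)"
    and x: "x \<in> carrier G"
  shows "z x = z (x [^] q)"
proof (cases "x = x [^] q")
  case False
  \<comment> \<open>The \<open>p\<close>-part of \<open>x\<close>, since \<open>x [^] q\<close> is
    the \<open>p'\<close>-part. Its \<open>q\<close>-th power is trivial because
    \<open>x [^] q\<close> is unchanged by taking \<open>q\<close>-th powers.\<close>
  define u where "u = x \<otimes> inv (x [^] q)"
  have xq: "x \<otimes> x [^] q = x [^] q \<otimes> x"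
    using x nat_pow_Suc2[of x q] by simp
  have xi: "x \<otimes> inv (x [^] q) = inv (x [^] q) \<otimes> x"
  proof -
    have "inv (x [^] q) \<otimes> x = inv (x [^] q) \<otimes> (x \<otimes> x [^] q) \<otimes> inv (x [^] q)"
      using x by (simp add: m_assoc)
    also have "\<dots> = x \<otimes> inv (x [^] q)"
      unfolding xq using x by simp
    finally show ?thesis ..
  qed
  have u: "u \<in> carrier G" "u \<noteq> \<one>"
    using x False inv_solve_right'[of \<one> x "x [^] q"] by (auto simp: u_def)
  have "u [^] q = x [^] q \<otimes> inv (x [^] q) [^] q"
    unfolding u_def using x xi by (intro pow_mult_distrib) auto
  also have "inv (x [^] q) [^] q = inv (x [^] q)"
    using x pow_idempotent_exponent[OF x q] by (simp add: nat_pow_inv nat_pow_pow)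
  finally have uq: "u [^] (p ^ n) = \<one>"
    using x p(3) by simp
  have "u \<otimes> x = x \<otimes> (inv (x [^] q) \<otimes> x)"
    using x by (simp add: u_def m_assoc)
  also have "\<dots> = x \<otimes> u"
    unfolding u_def xi ..
  finally have xC: "x \<in> centralizer G u"
    using x by (simp add: centralizer_iff)
  \<comment> \<open>Both \<open>x\<close> and \<open>x [^] q\<close> centralize \<open>u\<close>, so
    the truncation keeps the two coefficients to be compared.\<close>
  have "brauer_hom G u z x = brauer_hom G u z (x [^] q)"
  proof (rule brauer_hom_induct[OF u(1) z(1), where P = "\<lambda>w. w x = w (x [^] q)"])
    fix b :: "('a \<Rightarrow> 'k) set"
    assume b: "is_block (subgroup_algebra G (centralizer G u)) b"
    show "brauer_component u b z x = brauer_component u b z (x [^] q)"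
    proof (cases "brauer_induces G (centralizer G u) b B")
      case True
      then have "(u, b) \<in> nontrivial_subsections p G B"
        using p_elementI[OF p(2) u(1) uq] u(2) by (simp add: nontrivial_subsections_def subsections_def)
      then show ?thesis
        using xC by (rule comp)
    next
      case False
      show ?thesis
        unfolding brauer_component_not_induced[OF p(1,2) u(1) uq B b z False]
        by (simp add: group_algebra_simps)
    qed
  qed (simp_all add: group_algebra_simps)
  moreover have "x [^] q \<in> centralizer G u"
    using subgroup.m_closed[OF subgroup_centralizer[OF u(1)]] subgroup.one_closed[OF subgroup_centralizer[OF u(1)]] xC
    by (induction q) auto
  ultimately show ?thesis
    using xC by (simp add: brauer_hom_apply)
qed simp

text \<open>Extends the invariance from a representative to its whole conjugacy class of
  subsections, as conjugation commutes with taking powers.\<close>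

lemma brauer_component_subsection_conj:
  fixes B :: "('a \<Rightarrow> 'k::field) set"
  assumes s: "(v, c) \<in> nontrivial_subsections p G B" "(u, b) \<in> nontrivial_subsections p G B"
    and conj: "subsection_conj G (v, c) (u, b)" and z: "z \<in> center (group_algebra G)"
    and inv: "\<And>y. y \<in> centralizer G v \<Longrightarrow> brauer_component v c z y = brauer_component v c z (y [^] (q::nat))"
    and y: "y \<in> centralizer G u"
  shows "brauer_component u b z y = brauer_component u b z (y [^] q)"
proof -
  obtain g where g: "g \<in> carrier G" "u = g \<otimes> v \<otimes> inv g" "b = conj_elem G g ` c"
    using conj by (auto simp: subsection_conj_def)
  note v = nontrivial_subsectionsD[OF s(1)] and u = nontrivial_subsectionsD[OF s(2)]
  have yc: "y \<in> carrier G"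
    using y by (simp add: centralizer_iff)
  have comp: "brauer_component u b z = conj_elem G g (brauer_component v c z)"
    unfolding g(2,3) using u(5) unfolding g(2,3) by (intro brauer_component_conj[OF g(1) v(2,5) _ z])
  have pow: "(inv g \<otimes> y \<otimes> g) [^] k = inv g \<otimes> y [^] k \<otimes> g" for k :: nat
    by (induction k) (use g(1) yc in \<open>simp_all add: m_assoc\<close>)
  have "inv g \<otimes> y \<otimes> g \<in> centralizer G v"
    using conj_mem_centralizer_iff[OF g(1) v(2) yc] y g(2) by simp
  from inv[OF this] show ?thesis
    using yc unfolding comp pow by (simp add: conj_elem_def)
qed

lemma nontrivial_subsection_exists:
  fixes B :: "('a \<Rightarrow> 'k::alg_closed_field) set"
  assumes p: "CHAR('k) = p" "prime p" and B: "is_block (group_algebra G) B"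
    and D: "defect_group G B D" "D \<noteq> {\<one>}"
  shows "nontrivial_subsections p G B \<noteq> {}"
proof
  assume empty: "nontrivial_subsections p G B = {}"
  let ?E = "block_idem (group_algebra G) B"
  note E = block_corner[OF A.ring_axioms B]
  note Ec = A.central_idempotentD(1)[OF E(1)]
  have E_B: "?E \<in> B"
    using A.central_idempotent_in_corner[OF E(1)] E(2) by blast
  have Br_zero: "brauer_hom G u ?E = \<zero>\<^bsub>subgroup_algebra G (centralizer G u)\<^esub>"
    if u: "u \<in> carrier G" "u [^] (p ^ n) = \<one>" "u \<noteq> \<one>" for u n
  proof (rule brauer_hom_induct[OF u(1) Ec, where P = "\<lambda>w. w = \<zero>\<^bsub>subgroup_algebra G (centralizer G u)\<^esub>"])
    fix b :: "('a \<Rightarrow> 'k) set"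
    assume b: "is_block (subgroup_algebra G (centralizer G u)) b"
    have "\<not> brauer_induces G (centralizer G u) b B"
      using empty u(3) p_elementI[OF p(2) u(1,2)] by (auto simp: nontrivial_subsections_def subsections_def)
    then show "brauer_component u b ?E = \<zero>\<^bsub>subgroup_algebra G (centralizer G u)\<^esub>"
      by (rule brauer_component_not_induced[OF p u(1,2) B b Ec E_B])
  qed (simp_all add: group_algebra_simps)
  \<comment> \<open>Cauchy's theorem provides an element \<open>u\<close> of order \<open>p\<close>
    centralized by \<open>h\<close>; the coefficient at \<open>h\<close> survives in the truncation
    to the centralizer of \<open>u\<close>, which is zero.\<close>
  have "?E h = 0" if h: "h \<in> carrier G" "of_nat (card (centralizer G h)) = (0::'k)" for h
  proof -
    have "p dvd card (centralizer G h)"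
      using h(2) p(1) by (simp add: of_nat_eq_0_iff_char_dvd)
    then obtain u where u: "u \<in> carrier G" "u [^] p = \<one>" "u \<noteq> \<one>" "h \<in> centralizer G u"
      using cauchy_centralizer[OF p(2) h(1)] by blast
    then have "brauer_hom G u ?E h = 0"
      using Br_zero[of u 1] by (simp add: group_algebra_simps)
    then show ?thesis
      using u(4) by (simp add: brauer_hom_apply)
  qed
  then have "?E \<in> rel_trace G {\<one>} ` fixed_elems G {\<one>}"
    by (rule rel_trace_trivial_surj[OF Ec])
  then have "trace_covers G B {\<one>}"
    using triv_subgroup by (simp add: trace_covers_def)
  moreover have "{\<one>} \<subseteq> D"
    using D(1) subgroup.one_closed[of D G] by (auto simp: defect_group_def trace_covers_def)
  ultimately show False
    using D by (auto simp: defect_group_def)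
qed

end

section \<open>The embedding and the bound on Loewy lengths\<close>

theorem proposition2:
  fixes G :: "('g, 'm) monoid_scheme"
    and p k :: nat
    and B :: "('g \<Rightarrow> 'k::alg_closed_field) set"
    and D :: "'g set"
    and u :: "nat \<Rightarrow> 'g"
    and b :: "nat \<Rightarrow> ('g \<Rightarrow> 'k) set"
  assumes "group G" and "finite (carrier G)"
    and "CHAR('k) = p" and "p > 0"
    and "is_block (group_algebra G) B"
    and "defect_group G B D" and "D \<noteq> {\<one>\<^bsub>G\<^esub>}"
    and "\<And>i. i \<in> {1..k} \<Longrightarrow> (u i, b i) \<in> nontrivial_subsections p G B"
    and "\<And>s. s \<in> nontrivial_subsections p G B \<Longrightarrow>
           \<exists>!i. i \<in> {1..k} \<and> subsection_conj G (u i, b i) s"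
  shows
    "(\<exists>f \<in> alg_hom
          (center_mod_reynolds (block_algebra (group_algebra G) B))
          (direct_sum_algebra {1..k} (\<lambda>i. center_mod_reynolds (centralizer_block G (u i) (b i)))).
        inj_on f (carrier (center_mod_reynolds (block_algebra (group_algebra G) B))) \<and>
        (\<forall>z \<in> center (block_algebra (group_algebra G) B).
          f (reynolds (block_algebra (group_algebra G) B)
               +>\<^bsub>center_algebra (block_algebra (group_algebra G) B)\<^esub> z) =
          (\<lambda>i\<in>{1..k}.
             reynolds (centralizer_block G (u i) (b i))
               +>\<^bsub>center_algebra (centralizer_block G (u i) (b i))\<^esub>
             (brauer_hom G (u i) z
               \<otimes>\<^bsub>subgroup_algebra G (centralizer G (u i))\<^esub>
              block_idem (subgroup_algebra G (centralizer G (u i))) (b i)))))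
     \<and> loewy_length (center_mod_reynolds (block_algebra (group_algebra G) B))
       \<le> Max ((\<lambda>i. loewy_length (center_mod_reynolds (centralizer_block G (u i) (b i)))) ` {1..k})"
proof -
  interpret finite_group G
    using assms(1,2) by (simp add: finite_group_def finite_group_axioms_def)
  note B = \<open>is_block (group_algebra G) B\<close> and char = \<open>CHAR('k) = p\<close>
  have p: "prime p"
    using prime_CHAR_semidom[where ?'a = 'k] char \<open>p > 0\<close> by simp
  let ?A = "group_algebra G :: ('k, 'g \<Rightarrow> 'k) module"
  let ?S = "block_algebra ?A B"
  let ?F = "\<lambda>i. subgroup_algebra G (centralizer G (u i)) :: ('k, 'g \<Rightarrow> 'k) module"
  let ?T = "\<lambda>i. centralizer_block G (u i) (b i)"
  interpret A: ring ?A
    by (rule ring_group_algebra)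
  obtain n where n: "n > 0" "card (carrier G) dvd p ^ n * p ^ n - p ^ n"
    using exists_idempotent_prime_power[OF p, of "card (carrier G)"]
    by (metis card_gt_0_iff finite_carrier one_closed empty_iff)
  \<comment> \<open>The exponent belongs to the order of \<open>G\<close>; as it works elementwise,
    it is used unchanged in every centralizer.\<close>
  define q where "q = p ^ n"
  note q = n(2)[folded q_def]
  note E = block_corner[OF A.ring_axioms B]
  have sub: "u i \<in> carrier G" "brauer_induces G (centralizer G (u i)) (b i) B" "is_block (?F i) (b i)"
    if "i \<in> {1..k}" for i
    using nontrivial_subsectionsD[OF assms(8)[OF that]] by auto
  have C: "finite_group (G\<lparr>carrier := centralizer G (u i)\<rparr>)" if "i \<in> {1..k}" for i
    by (rule finite_group_centralizer[OF sub(1)[OF that]])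
  have S_simps: "monoid.mult ?S = monoid.mult ?A" "ring.add ?S = ring.add ?A" "module.smult ?S = module.smult ?A"
    "\<one>\<^bsub>?S\<^esub> = block_idem ?A B"
    by (simp_all add: block_algebra_def)
  have T_simps: "monoid.mult (?T i) = monoid.mult (?F i)" "ring.add (?T i) = ring.add (?F i)"
    "module.smult (?T i) = module.smult (?F i)" "\<one>\<^bsub>?T i\<^esub> = block_idem (?F i) (b i)" for i
    by (simp_all add: block_algebra_def)
  have center_S: "center ?S = center ?A \<inter> B"
    by (rule center_block_algebra[OF B])
  have \<phi>_hom: "brauer_component (u i) (b i) \<in> alg_hom (center_algebra ?S) (center_algebra (?T i))"
    if i: "i \<in> {1..k}" for i
  proof -
    interpret C: finite_group "G\<lparr>carrier := centralizer G (u i)\<rparr>"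
      by (rule C[OF i])
    obtain l where l: "u i [^]\<^bsub>G\<^esub> (p ^ l) = \<one>\<^bsub>G\<^esub>"
      using p_elementD[OF nontrivial_subsectionsD(1)[OF assms(8)[OF i]]] by blast
    note c = char p sub(1)[OF i] l sub(3)[OF i]
    show ?thesis
    proof (intro alg_homI ring_hom_memI)
      fix x y assume "x \<in> carrier (center_algebra ?S)" "y \<in> carrier (center_algebra ?S)"
      then have xy: "x \<in> center ?A" "y \<in> center ?A"
        by (auto simp: center_S)
      show "brauer_component (u i) (b i) x \<in> carrier (center_algebra (?T i))"
        using brauer_component_center[OF c(3,5) xy(1)] brauer_component_block[OF c(3,5) xy(1)]
        by (simp add: C.center_block_algebra[OF sub(3)[OF i]])
      show "brauer_component (u i) (b i) (x \<otimes>\<^bsub>center_algebra ?S\<^esub> y) =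
          brauer_component (u i) (b i) x \<otimes>\<^bsub>center_algebra (?T i)\<^esub> brauer_component (u i) (b i) y"
        using brauer_component_mult[OF c xy] by (simp add: S_simps T_simps)
      show "brauer_component (u i) (b i) (x \<oplus>\<^bsub>center_algebra ?S\<^esub> y) =
          brauer_component (u i) (b i) x \<oplus>\<^bsub>center_algebra (?T i)\<^esub> brauer_component (u i) (b i) y"
        using brauer_component_add[OF c(3,5) xy] by (simp add: S_simps T_simps)
      show "brauer_component (u i) (b i) (a \<odot>\<^bsub>center_algebra ?S\<^esub> x) =
          a \<odot>\<^bsub>center_algebra (?T i)\<^esub> brauer_component (u i) (b i) x" for a
        using brauer_component_smult[OF c(3)] by (simp add: S_simps T_simps)
    next
      show "brauer_component (u i) (b i) \<one>\<^bsub>center_algebra ?S\<^esub> = \<one>\<^bsub>center_algebra (?T i)\<^esub>"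
        using brauer_component_block_idem[OF c(1-4) B c(5)] sub(2)[OF i] by (simp add: S_simps T_simps)
    qed
  qed
  \<comment> \<open>The condition \<open>z x = z (x [^] q)\<close> is inherited by the truncation to
    a centralizer, and multiplying by the block idempotent there lands in the Reynolds
    ideal.\<close>
  have \<phi>_reynolds: "brauer_component (u i) (b i) z \<in> reynolds (?T i)"
    if i: "i \<in> {1..k}" and z: "z \<in> reynolds ?S" for i z
  proof -
    interpret C: finite_group "G\<lparr>carrier := centralizer G (u i)\<rparr>"
      by (rule C[OF i])
    have zc: "z \<in> center ?A"
      using z by (simp add: reynolds_def center_S)
    have "brauer_hom G (u i) z y = brauer_hom G (u i) z (y [^]\<^bsub>G\<lparr>carrier := centralizer G (u i)\<rparr>\<^esub> q)"
      if y: "y \<in> carrier (G\<lparr>carrier := centralizer G (u i)\<rparr>)" for y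
    proof -
      have "y [^]\<^bsub>G\<^esub> q \<in> centralizer G (u i)"
        using C.nat_pow_closed[OF y, of q] by (simp flip: nat_pow_consistent)
      moreover have "y \<in> carrier G"
        using y by (simp add: centralizer_iff)
      then have "z y = z (y [^]\<^bsub>G\<^esub> q)"
        using reynolds_imp_pow_invariant[OF char p q_def B z] pow_idempotent_exponent[OF _ q] by blast
      ultimately show ?thesis
        using y by (simp add: brauer_hom_apply flip: nat_pow_consistent)
    qed
    then show ?thesis
      unfolding brauer_component_def
      using C.pow_invariant_imp_reynolds[OF char p q_def n(1) sub(3)[OF i] brauer_hom_center[OF sub(1)[OF i] zc]]
      by blast
  qed
  have \<phi>_inj: "z \<in> reynolds ?S"
    if z: "z \<in> carrier (center_algebra ?S)"
      and comp: "\<And>i. i \<in> {1..k} \<Longrightarrow> brauer_component (u i) (b i) z \<in> reynolds (?T i)" for z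
  proof -
    have zc: "z \<in> center ?A" "z \<in> B"
      using z by (auto simp: center_S)
    have component: "brauer_component (u i) (b i) z y = brauer_component (u i) (b i) z (y [^]\<^bsub>G\<^esub> q)"
      if i: "i \<in> {1..k}" and y: "y \<in> centralizer G (u i)" for i y
    proof -
      interpret C: finite_group "G\<lparr>carrier := centralizer G (u i)\<rparr>"
        by (rule C[OF i])
      have "y \<in> carrier G"
        using y by (simp add: centralizer_iff)
      then have "y [^]\<^bsub>G\<^esub> (q * q) = y [^]\<^bsub>G\<^esub> q"
        by (rule pow_idempotent_exponent[OF _ q])
      then show ?thesis
        using C.reynolds_imp_pow_invariant[OF char p q_def sub(3)[OF i] comp[OF i], of y] y
        by (simp flip: nat_pow_consistent)
    qed
    \<comment> \<open>The assumption speaks of the representatives; every non-trivial subsection is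
      conjugate to one of them, and the invariance is carried over.\<close>
    have "z x = z (x [^]\<^bsub>G\<^esub> q)" if "x \<in> carrier G" for x
    proof (rule pow_invariant_of_brauer_components[OF char p q_def q B zc _ that])
      fix v c y assume s: "(v, c) \<in> nontrivial_subsections p G B" and y: "y \<in> centralizer G v"
      obtain i where i: "i \<in> {1..k}" "subsection_conj G (u i, b i) (v, c)"
        using assms(9)[OF s] by blast
      show "brauer_component v c z y = brauer_component v c z (y [^]\<^bsub>G\<^esub> q)"
        by (rule brauer_component_subsection_conj[OF assms(8)[OF i(1)] s i(2) zc(1) component[OF i(1)] y])
    qed
    then have "z \<otimes>\<^bsub>?A\<^esub> block_idem ?A B \<in> reynolds ?S"
      by (rule pow_invariant_imp_reynolds[OF char p q_def n(1) B zc(1)])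
    moreover have "z \<otimes>\<^bsub>?A\<^esub> block_idem ?A B = z"
      using A.corner_closed(7)[OF E(1)] zc(2) E(2) by blast
    ultimately show ?thesis
      by simp
  qed
  have T_block: "cring (center_algebra (?T i))" "ideal (reynolds (?T i)) (center_algebra (?T i))"
    "scalar_compatible (center_algebra (?T i)) (reynolds (?T i))"
    "cring (center_mod_reynolds (?T i))" "finite_length (center_mod_reynolds (?T i))"
    if i: "i \<in> {1..k}" for i
  proof -
    interpret C: finite_group "G\<lparr>carrier := centralizer G (u i)\<rparr>"
      by (rule C[OF i])
    note c = sub(3)[OF i]
    show "cring (center_algebra (?T i))" "ideal (reynolds (?T i)) (center_algebra (?T i))"
      "scalar_compatible (center_algebra (?T i)) (reynolds (?T i))"
      "cring (center_mod_reynolds (?T i))" "finite_length (center_mod_reynolds (?T i))"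
      using C.cring_center_block_algebra[OF c] ring.ideal_reynolds[OF C.ring_block_algebra[OF c]]
        C.scalar_compatible_reynolds[OF c] C.cring_center_mod_reynolds[OF c] by auto
  qed
  obtain f where f: "f \<in> alg_hom (center_mod_reynolds ?S)
      (direct_sum_algebra {1..k} (\<lambda>i. center_mod_reynolds (?T i)))"
    "inj_on f (carrier (center_mod_reynolds ?S))"
    "\<And>z. z \<in> carrier (center_algebra ?S) \<Longrightarrow> f (reynolds ?S +>\<^bsub>center_algebra ?S\<^esub> z) =
      (\<lambda>i\<in>{1..k}. reynolds (?T i) +>\<^bsub>center_algebra (?T i)\<^esub> brauer_component (u i) (b i) z)"
    by (rule quot_direct_sum_embedding[of "center_algebra ?S" "reynolds ?S" "{1..k}"
          "\<lambda>i. center_algebra (?T i)" "\<lambda>i. reynolds (?T i)" "\<lambda>i. brauer_component (u i) (b i)",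
          OF cring_center_block_algebra[OF B] ring.ideal_reynolds[OF ring_block_algebra[OF B]]
            scalar_compatible_reynolds[OF B] T_block(1,2,3) \<phi>_hom \<phi>_reynolds \<phi>_inj,
          folded center_mod_reynolds_def])
      (assumption | (rule that, assumption+))+
  \<comment> \<open>Some non-trivial subsection exists because the defect group is not trivial, and
    it is represented by an index.\<close>
  have "{1..k} \<noteq> {}"
    using nontrivial_subsection_exists[OF char p B assms(6,7)] assms(9) by blast
  then have "loewy_length (center_mod_reynolds ?S) \<le> Max ((\<lambda>i. loewy_length (center_mod_reynolds (?T i))) ` {1..k})"
    using cring_center_mod_reynolds[OF B] T_block(4,5) f(1,2)
    by (intro loewy_length_le_Max_direct_sum) auto
  then show ?thesis
    using f by (intro conjI bexI[of _ f]) (auto simp: brauer_component_def)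
qed

end
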